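(* There exist absolute constants $C_5>0$ and $C'_5>0$ such that the following holds. Let $m,n$ be positive integers with $mn\ge 2$, let $P$ be a set of $m$ distinct points in $\mathbb{R}^5$ and $Q$ a set of $n$ distinct hyperplanes in $\mathbb{R}^5$, and let $I$ be the number of pairs $(p,q)\in P\times Q$ with $p\in q$. If $$I\geq C_5\left(mn^{3/4}+nm^{2/3}\right),$$ then there exist $r$ points of $P$ and $s$ hyperplanes of $Q$ such that each of these $r$ points lies on each of these $s$ hyperplanes (i.e. the incidence graph $G(P,Q)$ contains a complete bipartite subgraph $K_{r,s}$), with $$rs\geq C'_5\left(\frac{I}{mn}\right)^{3} mn\,(\log mn)^{-10}.$$ Equivalently, $rs_5(m,n,I)\geq C'_5\left(\frac{I}{mn}\right)^{3} mn(\log mn)^{-10}$.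
   Context: For a set $P$ of points and a set $Q$ of hyperplanes in $\mathbb{R}^d$, the incidence graph $G(P,Q)$ is the bipartite graph on vertex set $P\cup Q$ in which $(p,q)\in P\times Q$ is an edge iff $p\in q$. $rs(P,Q)$ denotes the maximum of $rs$ over all complete bipartite subgraphs $K_{r,s}$ of $G(P,Q)$ ($r$ points, $s$ hyperplanes), and $rs_d(m,n,I)$ is the minimum of $rs(P,Q)$ over all sets $P$ of $m$ points and $Q$ of $n$ hyperplanes in $\mathbb{R}^d$ whose incidence graph has exactly $I$ edges. The logarithm may be taken in base 2 (the base only affects the constants). *)

theory Defs
  imports "HOL-Analysis.Analysis"
begin

definition hyperplane :: "'a::euclidean_space set \<Rightarrow> bool" where
  "hyperplane h \<longleftrightarrow> (\<exists>a b. a \<noteq> 0 \<and> h = {x. a \<bullet> x = b})"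

text \<open>The incidence graph is bipartite with parts \<open>P\<close> and \<open>Q\<close>, which live in different types;
  it is represented by its set of edges, oriented from points to hyperplanes.\<close>

definition incidence_graph :: "'a set \<Rightarrow> 'a set set \<Rightarrow> ('a \<times> 'a set) set" where
  "incidence_graph P Q = {(p, q) \<in> P \<times> Q. p \<in> q}"

definition contains_K :: "'a set \<Rightarrow> 'a set set \<Rightarrow> nat \<Rightarrow> nat \<Rightarrow> bool" where
  "contains_K P Q r s \<longleftrightarrow>
     (\<exists>A B. A \<subseteq> P \<and> card A = r \<and> B \<subseteq> Q \<and> card B = s \<and> A \<times> B \<subseteq> incidence_graph P Q)"

text \<open>The degenerate values \<open>r = 0\<close> and \<open>s = 0\<close> are allowed, so for finite \<open>P\<close> and \<open>Q\<close> the maximum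
  below ranges over a finite nonempty set; it is \<open>0\<close> when there is no incidence.\<close>

definition rs :: "'a set \<Rightarrow> 'a set set \<Rightarrow> nat" where
  "rs P Q = Max {r * s | r s. contains_K P Q r s}"

definition configuration ::
    "nat \<Rightarrow> nat \<Rightarrow> nat \<Rightarrow> 'a::euclidean_space set \<Rightarrow> 'a set set \<Rightarrow> bool" where
  "configuration m n I P Q \<longleftrightarrow>
     finite P \<and> card P = m \<and> finite Q \<and> card Q = n \<and> (\<forall>q\<in>Q. hyperplane q) \<and>
     card (incidence_graph P Q) = I"

text \<open>The ambient space is passed as a type, so that \<open>rs_min TYPE(real ^ 'd)\<close> is the function usually
  written \<open>rs\<^sub>d\<close>. \<open>Inf\<close> on \<open>nat\<close> is the attained minimum of a nonempty set, but \<open>Inf {} = 0\<close>, so the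
  value is meaningful only if some configuration with these parameters exists.\<close>

definition rs_min :: "'a::euclidean_space itself \<Rightarrow> nat \<Rightarrow> nat \<Rightarrow> nat \<Rightarrow> nat" where
  "rs_min _ m n I =
     Inf {rs P Q | (P :: 'a set) (Q :: 'a set set). configuration m n I P Q}"

end

theory Submission
  imports Defs
begin

text \<open>Points and hyperplanes of \<open>\<real>\<^sup>5\<close> become two sets \<open>P\<close>, \<open>Q\<close> of pairwise non-proportional vectors of a
  \<open>6\<close>-dimensional space, incidence becomes orthogonality, and flats become subspaces. Let \<open>\<epsilon> = I / (m n)\<close>.

  The theorem of Elekes and Toth bounds the number of \<open>k\<close>-dimensional subspaces that contain \<open>r\<close> of \<open>m\<close> given
  points, not concentrated on proper subspaces, by \<open>O(m^k / r^(k+1) + (m / r)^(k-1))\<close>. It follows from Beck's theorem,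
  by which almost all \<open>(k-1)\<close>-tuples of points of such a subspace span a subspace with boundedly many points, and
  from the theorem of Szemeredi and Trotter in the quotients by the spans of \<open>(k-2)\<close>-tuples.

  As \<open>\<epsilon>\<^sup>4 n\<close> is large, most hyperplanes are degenerate: their points concentrate on a non-degenerate smaller flat
  with about \<open>\<epsilon> m\<close> points. There are only \<open>O(1 / \<epsilon>\<^sup>2)\<close> such flats of linear dimension at most \<open>3\<close>, so if these
  prevail then one of them lies on \<open>\<epsilon>\<^sup>2 n\<close> hyperplanes. Otherwise there are flats of linear dimension \<open>4\<close>. If there
  are only \<open>O(1 / \<epsilon>\<^sup>2)\<close> of them, one is again popular. If there are \<open>N\<close>, many more, then these are turned by a
  generic projection and duality into \<open>N\<close> points, and the points of \<open>P\<close> into \<open>4\<close>-dimensional subspaces. As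
  \<open>\<epsilon>\<^sup>3 m\<close> is large, most of these are degenerate, and concentrate on one of \<open>O(1 / \<epsilon>\<^sup>2)\<close> subspaces of dimension at
  most \<open>3\<close>: this gives \<open>\<epsilon>\<^sup>2 m\<close> points and \<open>\<epsilon> N\<close> flats, that is, a fraction \<open>\<epsilon>\<close> of the hyperplanes.\<close>

section \<open>The Szemeredi-Trotter theorem\<close>

text \<open>The two terms of the hypothesis say \<open>\<epsilon> \<ge> C n^(-1/4)\<close> and
  \<open>\<epsilon> \<ge> C m^(-1/3)\<close>, which is exactly the largeness of
  \<open>\<epsilon>^4 n\<close> and \<open>\<epsilon>^3 m\<close>. For \<open>r = \<eta> m\<close>
  the bound of Elekes and Toth in linear dimension \<open>k\<close> is
  \<open>O(1 / \<eta>^(k-1))\<close> as soon as \<open>\<eta>^2 m\<close> is large. For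
  \<open>k = 4\<close> this is the obstacle: pigeonholing hyperplanes among
  \<open>1 / \<epsilon>^3\<close> flats would yield only \<open>\<epsilon>^4 m n\<close>. In the
  dual the cubic bound is harmless, because there it only has to show that most of the 4-dimensional
  subspaces are degenerate. Densities are not uniform, and an ordinary dyadic pigeonhole would cost
  a logarithm each time. Instead a level \<eta> is selected that is reached by a proportion of order
  \<open>(\<epsilon> / \<eta>)^2\<close>; the factor \<open>\<eta>^2\<close> in the popularity of a
  flat gives this loss back. A logarithm arises only from the multiplicities with which one flat of
  dimension 4 serves several hyperplanes, so a single factor \<open>1 + ln n\<close> is lost, well
  within the tenth power.\<close>

abbreviation rcard :: "'a set \<Rightarrow> real" where
  "rcard A \<equiv> real (card A)"

section \<open>Straight-line drawings without crossings\<close>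

type_synonym edge = "(real \<times> real) \<times> (real \<times> real)"

definition slope :: "edge \<Rightarrow> real" where
  "slope e = (snd (snd e) - snd (fst e)) / (fst (snd e) - fst (fst e))"

definition ht :: "edge \<Rightarrow> real \<Rightarrow> real" where
  "ht e t = snd (fst e) + slope e * (t - fst (fst e))"

definition over :: "edge \<Rightarrow> real \<Rightarrow> bool" where
  "over e t \<longleftrightarrow> fst (fst e) < t \<and> t < fst (snd e)"

text \<open>Segments are read as graphs of affine functions over the open interval between their end
  abscissae, left endpoint first. Crossing is then an equation in one real variable, and planar
  topology never enters; a common endpoint alone is not a crossing.\<close>

definition crosses :: "edge \<Rightarrow> edge \<Rightarrow> bool" where
  "crosses e f \<longleftrightarrow> (\<exists>t. over e t \<and> over f t \<and> ht e t = ht f t)"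

lemma ex_min_image:
  fixes f :: "'a \<Rightarrow> real"
  assumes "finite A" "A \<noteq> {}"
  shows "\<exists>a\<in>A. \<forall>b\<in>A. f a \<le> f b"
proof -
  have "Min (f ` A) \<in> f ` A" using assms by (intro Min_in) auto
  then obtain a where "a \<in> A" "f a = Min (f ` A)" by auto
  then show ?thesis using assms Min_le by (metis finite_imageI imageI)
qed

lemma affine_zero:
  fixes A B t t' :: real
  assumes "A + B * t > 0" "A + B * t' < 0"
  shows "\<exists>s. (t < s \<and> s < t' \<or> t' < s \<and> s < t) \<and> A + B * s = 0"
proof -
  have B: "B \<noteq> 0" using assms by auto
  define s where "s = - A / B"
  have s: "A + B * s = 0" using B by (simp add: s_def)
  have 1: "B * (t - s) > 0" "B * (t' - s) < 0" using assms s by (auto simp: algebra_simps)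
  show ?thesis
  proof (cases "B > 0")
    case True
    then have "t > s" "t' < s" using 1 by (auto simp: zero_less_mult_iff mult_less_0_iff)
    then show ?thesis using s by blast
  next
    case False
    then have "t < s" "t' > s" using 1 B by (auto simp: zero_less_mult_iff mult_less_0_iff)
    then show ?thesis using s by blast
  qed
qed

lemma ht_diff: "ht f t - ht e t = (snd (fst f) - slope f * fst (fst f) - snd (fst e) + slope e * fst (fst e))
    + (slope f - slope e) * t"
  by (simp add: ht_def algebra_simps)

lemma ht_cross_between:
  assumes "ht e t < ht f t" "ht f t' < ht e t'"
  obtains s where "t < s \<and> s < t' \<or> t' < s \<and> s < t" "ht e s = ht f s"
proof -
  have "ht f t - ht e t > 0" "ht f t' - ht e t' < 0" using assms by auto
  then obtain s where "t < s \<and> s < t' \<or> t' < s \<and> s < t" "ht f s - ht e s = 0"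
    using affine_zero unfolding ht_diff by meson
  then show ?thesis using that[of s] by simp
qed

lemma ht_left [simp]: "ht e (fst (fst e)) = snd (fst e)"
  by (simp add: ht_def)

lemma ht_right: "fst (fst e) < fst (snd e) \<Longrightarrow> ht e (fst (snd e)) = snd (snd e)"
  by (simp add: ht_def slope_def)

text \<open>All conditions are inherited by subsets of the vertices and edges, which the sampling
  argument needs. \<open>injV\<close> orders the vertices by abscissa, and \<open>clean\<close>
  keeps vertices out of the interior of edges.\<close>

locale geo_graph =
  fixes V :: "(real \<times> real) set" and E :: "edge set"
  assumes finV: "finite V" and injV: "inj_on fst V" and EV: "E \<subseteq> V \<times> V"
    and lr: "e \<in> E \<Longrightarrow> fst (fst e) < fst (snd e)"
    and clean: "e \<in> E \<Longrightarrow> v \<in> V \<Longrightarrow> over e (fst v) \<Longrightarrow> snd v \<noteq> ht e (fst v)"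
begin

lemma finE: "finite E"
  using EV finV finite_subset by blast

lemma ends: "e \<in> E \<Longrightarrow> fst e \<in> V" "e \<in> E \<Longrightarrow> snd e \<in> V"
  using EV by auto

lemma Vinj: "u \<in> V \<Longrightarrow> v \<in> V \<Longrightarrow> fst u = fst v \<Longrightarrow> u = v"
  using injV by (auto dest: inj_onD)

text \<open>If the right endpoints differed, the nearer one would lie inside the longer edge,
  against \<open>clean\<close>.\<close>

lemma same_left_same_slope:
  assumes "e \<in> E" "f \<in> E" "fst e = fst f" "slope e = slope f"
  shows "e = f"
proof (rule ccontr)
  assume "e \<noteq> f"
  then have ne: "snd e \<noteq> snd f" using assms(3) by (auto simp: prod_eq_iff)
  then have ne': "fst (snd e) \<noteq> fst (snd f)" using Vinj ends assms by blast
  have hh: "ht e t = ht f t" for t using assms by (simp add: ht_def)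
  show False
  proof (cases "fst (snd e) < fst (snd f)")
    case True
    then have "over f (fst (snd e))" using lr[OF assms(1)] assms(3) by (auto simp: over_def)
    then show False using clean[OF assms(2) ends(2)[OF assms(1)]] ht_right[OF lr[OF assms(1)]] hh by auto
  next
    case False
    then have "over e (fst (snd f))" using lr[OF assms(2)] assms(3) ne' by (auto simp: over_def)
    then show False using clean[OF assms(1) ends(2)[OF assms(2)]] ht_right[OF lr[OF assms(2)]] hh by auto
  qed
qed

text \<open>Distinct edges with a common endpoint lie over disjoint intervals or on different lines,
  which meet only there. A crossing thus involves four vertices; this is the exponent 4 in the
  sampling.\<close>

lemma cross_distinct:
  assumes "e \<in> E" "f \<in> E" "e \<noteq> f" "crosses e f"
  shows "distinct [fst e, snd e, fst f, snd f]"
proof -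
  obtain t where t: "over e t" "over f t" "ht e t = ht f t" using assms by (auto simp: crosses_def)
  have 1: "fst e \<noteq> fst f"
  proof
    assume l: "fst e = fst f"
    then have "slope e * (t - fst (fst e)) = slope f * (t - fst (fst e))" using t by (simp add: ht_def)
    then have "slope e = slope f" using t by (auto simp: over_def)
    then show False using same_left_same_slope assms l by blast
  qed
  have 2: "snd e \<noteq> snd f"
  proof
    assume r: "snd e = snd f"
    have eqr: "ht e (fst (snd e)) = ht f (fst (snd e))" using ht_right lr assms r by metis
    have "(slope f - slope e) * (fst (snd e) - t) = 0"
      using eqr t(3) by (simp add: ht_def algebra_simps)
    then have s: "slope e = slope f" using t by (auto simp: over_def)
    then have hh: "ht e x = ht f x" for x using t(3) by (simp add: ht_def algebra_simps)
    have "fst (fst e) \<noteq> fst (fst f)" using 1 Vinj ends assms by blast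
    then consider "fst (fst e) < fst (fst f)" | "fst (fst f) < fst (fst e)" by linarith
    then show False
    proof cases
      case 1
      then have "over e (fst (fst f))" using lr[OF assms(2)] r by (auto simp: over_def)
      then show False using clean[OF assms(1) ends(1)[OF assms(2)]] hh by auto
    next
      case 2
      then have "over f (fst (fst e))" using lr[OF assms(1)] r by (auto simp: over_def)
      then show False using clean[OF assms(2) ends(1)[OF assms(1)]] hh[of "fst (fst e)"] by auto
    qed
  qed
  have 3: "fst e \<noteq> snd f" "snd e \<noteq> fst f" "fst e \<noteq> snd e" "fst f \<noteq> snd f"
    using t by (auto simp: over_def)
  show ?thesis using 1 2 3 by auto
qed

text \<open>Affine functions that change their strict order agree somewhere strictly in between;
  both edges live over that whole interval, so they would cross. \<open>a\<close> and
  \<open>b\<close> may come in either order.\<close>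

lemma no_swap:
  assumes nc: "\<And>e f. e \<in> E \<Longrightarrow> f \<in> E \<Longrightarrow> e \<noteq> f \<Longrightarrow> \<not> crosses e f"
    and "e \<in> E" "f \<in> E" "ht e a < ht f a" "fst (fst e) \<le> min a b" "fst (fst f) \<le> min a b"
    "max a b \<le> fst (snd e)" "max a b \<le> fst (snd f)"
  shows "ht e b \<le> ht f b"
proof (rule ccontr)
  assume "\<not> ht e b \<le> ht f b"
  then obtain s where s: "a < s \<and> s < b \<or> b < s \<and> s < a" "ht e s = ht f s"
    using ht_cross_between[of e a f b] assms(4) by auto
  then have "over e s" "over f s" using assms(5-8) by (auto simp: over_def)
  then show False using nc[OF assms(2,3)] assms(4) s by (auto simp: crosses_def)
qed

text \<open>Two edges that are consecutive around a common left endpoint span a wedge. The leftmost vertex in the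
  wedge sees both of them, because an edge in between would bring a vertex further left.\<close>

lemma wedge_vertex:
  assumes nc: "\<And>e f. e \<in> E \<Longrightarrow> f \<in> E \<Longrightarrow> e \<noteq> f \<Longrightarrow> \<not> crosses e f"
    and e: "e \<in> E" and f: "f \<in> E" and p: "fst e = fst f" and sl: "slope e < slope f"
    and cons: "\<And>g. g \<in> E \<Longrightarrow> fst g = fst e \<Longrightarrow> \<not> (slope e < slope g \<and> slope g < slope f)"
  obtains v where "v \<in> V" "fst (fst e) < fst v" "fst v \<le> fst (snd e)" "fst v \<le> fst (snd f)"
    "ht e (fst v) \<le> snd v" "snd v \<le> ht f (fst v)"
    "\<And>g. g \<in> E \<Longrightarrow> over g (fst v) \<Longrightarrow> \<not> (ht e (fst v) < ht g (fst v) \<and> ht g (fst v) < ht f (fst v))"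
proof -
  define B where "B = {v \<in> V. fst (fst e) < fst v \<and> fst v \<le> fst (snd e) \<and> fst v \<le> fst (snd f) \<and>
     ht e (fst v) \<le> snd v \<and> snd v \<le> ht f (fst v)}"
  have le: "t > fst (fst e) \<Longrightarrow> ht e t < ht f t" for t
    using sl p by (simp add: ht_def)
  have "B \<noteq> {}"
  proof (cases "fst (snd e) \<le> fst (snd f)")
    case True
    then have "snd e \<in> B" unfolding B_def using ends e lr[OF e] ht_right[OF lr[OF e]] le[of "fst (snd e)"] by auto
    then show ?thesis by auto
  next
    case False
    then have "snd f \<in> B" unfolding B_def using ends f lr[OF f] ht_right[OF lr[OF f]] le[of "fst (snd f)"] p by auto
    then show ?thesis by auto
  qed
  moreover have "finite B" using finV by (auto simp: B_def)
  ultimately obtain v where v: "v \<in> B" "\<And>u. u \<in> B \<Longrightarrow> fst v \<le> fst u"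
    using ex_min_image[of B fst] by blast
  have vV: "v \<in> V" and v1: "fst (fst e) < fst v" "fst v \<le> fst (snd e)" "fst v \<le> fst (snd f)"
    "ht e (fst v) \<le> snd v" "snd v \<le> ht f (fst v)" using v(1) by (auto simp: B_def)
  have "\<not> (ht e (fst v) < ht g (fst v) \<and> ht g (fst v) < ht f (fst v))"
    if g: "g \<in> E" "over g (fst v)" for g
  proof
    assume b: "ht e (fst v) < ht g (fst v) \<and> ht g (fst v) < ht f (fst v)"
    let ?u = "fst g"
    have uv: "fst ?u < fst v" "fst v < fst (snd g)" using g by (auto simp: over_def)
    consider "fst ?u > fst (fst e)" | "fst ?u = fst (fst e)" | "fst ?u < fst (fst e)" by linarith
    then show False
    proof cases
      case 1
      have "ht e (fst ?u) \<le> ht g (fst ?u)" "ht g (fst ?u) \<le> ht f (fst ?u)"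
        using no_swap[OF nc e g(1), of "fst v" "fst ?u"] no_swap[OF nc g(1) f, of "fst v" "fst ?u"] b uv v1 1 p
        by auto
      then have "?u \<in> B" unfolding B_def using ends(1)[OF g(1)] 1 uv v1 by auto
      then show False using v(2) uv by fastforce
    next
      case 2
      then have up: "fst g = fst e" using Vinj ends e g by blast
      have "slope e < slope g \<and> slope g < slope f"
        using b v1(1) up p by (simp add: ht_def)
      then show False using cons g(1) up by blast
    next
      case 3
      let ?p = "fst (fst e)"
      have og: "over g ?p" using 3 uv v1 by (auto simp: over_def)
      have "ht e ?p \<le> ht g ?p" "ht g ?p \<le> ht f ?p"
        using no_swap[OF nc e g(1), of "fst v" ?p] no_swap[OF nc g(1) f, of "fst v" ?p] b uv v1 3 p by auto
      then have "ht g ?p = snd (fst e)" using p ht_left[of e] ht_left[of f] by simp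
      then show False using clean[OF g(1) ends(1)[OF e] og] by simp
    qed
  qed
  then show ?thesis using that vV v1 by blast
qed

text \<open>A substitute for Euler's formula. Each vertex pays for at most three edges: the steepest
  one that starts there, and one each for what it sees directly below and directly above.\<close>

lemma noncrossing_card:
  assumes nc: "\<And>e f. e \<in> E \<Longrightarrow> f \<in> E \<Longrightarrow> e \<noteq> f \<Longrightarrow> \<not> crosses e f"
  shows "card E \<le> 3 * card V"
proof -
  define T where "T = {e \<in> E. \<forall>f\<in>E. fst f = fst e \<longrightarrow> slope f \<le> slope e}"
  have "inj_on fst T"
  proof (rule inj_onI)
    fix e f assume "e \<in> T" "f \<in> T" "fst e = fst f"
    then have "e \<in> E" "f \<in> E" "slope e = slope f" by (auto simp: T_def intro: antisym)
    then show "e = f" using same_left_same_slope \<open>fst e = fst f\<close> by blast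
  qed
  moreover have "fst ` T \<subseteq> V" using ends by (auto simp: T_def)
  ultimately have T: "card T \<le> card V" using card_inj_on_le finV by blast
  \<comment> \<open>An edge that is not the steepest at its left endpoint is charged to the vertex of the wedge above it,
    which sees either the edge itself directly below or its successor directly above.\<close>
  define lo where "lo e v \<longleftrightarrow> over e (fst v) \<and> ht e (fst v) < snd v \<and>
      (\<forall>g\<in>E. over g (fst v) \<longrightarrow> \<not> (ht e (fst v) < ht g (fst v) \<and> ht g (fst v) < snd v))" for e v
  define up where "up f v \<longleftrightarrow> over f (fst v) \<and> snd v < ht f (fst v) \<and>
      (\<forall>g\<in>E. over g (fst v) \<longrightarrow> \<not> (snd v < ht g (fst v) \<and> ht g (fst v) < ht f (fst v)))" for f v
  define nxt where "nxt e f \<longleftrightarrow> f \<in> E \<and> fst e = fst f \<and> slope e < slope f \<and>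
      (\<forall>g\<in>E. fst g = fst e \<longrightarrow> \<not> (slope e < slope g \<and> slope g < slope f))" for e f
  define R where "R e x \<longleftrightarrow> (if snd x then lo e (fst x) else (\<exists>f. nxt e f \<and> up f (fst x)))"
    for e and x :: "(real \<times> real) \<times> bool"
  have ex: "\<exists>x. x \<in> V \<times> UNIV \<and> R e x" if e: "e \<in> E - T" for e
  proof -
    let ?N = "{f \<in> E. fst f = fst e \<and> slope e < slope f}"
    obtain f0 where "f0 \<in> E" "fst f0 = fst e" "\<not> slope f0 \<le> slope e" using e unfolding T_def by blast
    then have "f0 \<in> ?N" by simp
    then have "?N \<noteq> {}" by blast
    moreover have "finite ?N" using finE by simp
    ultimately have "?N \<noteq> {}" "finite ?N" by blast+
    then obtain f where f: "f \<in> ?N" "\<And>g. g \<in> ?N \<Longrightarrow> slope f \<le> slope g"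
      using ex_min_image[of ?N slope] by blast
    have n: "nxt e f" unfolding nxt_def using f by force
    have eE: "e \<in> E" using e by auto
    obtain v where v: "v \<in> V" "fst (fst e) < fst v" "fst v \<le> fst (snd e)" "fst v \<le> fst (snd f)"
      "ht e (fst v) \<le> snd v" "snd v \<le> ht f (fst v)"
      "\<And>g. g \<in> E \<Longrightarrow> over g (fst v) \<Longrightarrow> \<not> (ht e (fst v) < ht g (fst v) \<and> ht g (fst v) < ht f (fst v))"
      using wedge_vertex[OF nc eE, of f] n unfolding nxt_def by blast
    show ?thesis
    proof (cases "v = snd e")
      case False
      then have "fst v < fst (snd e)" using v Vinj ends(2)[OF eE] by fastforce
      then have o: "over e (fst v)" using v by (auto simp: over_def)
      have "ht e (fst v) < snd v" using clean[OF eE v(1) o] v(5) by auto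
      then have "lo e v" unfolding lo_def using o v by fastforce
      then have "R e (v, True)" by (simp add: R_def)
      then show ?thesis using v(1) by blast
    next
      case True
      \<comment> \<open>The wedge vertex is the right end of \<open>e\<close>, so \<open>e\<close>
        does not extend over it. It lies strictly below the successor \<open>f\<close>, through
        which \<open>e\<close> is charged instead.\<close>
      have sv: "ht e (fst v) = snd v" using True ht_right lr eE by auto
      have fE: "f \<in> E" using n by (auto simp: nxt_def)
      have "v \<noteq> snd f"
      proof
        assume "v = snd f"
        then have "e = f" using True n by (auto simp: nxt_def prod_eq_iff)
        then show False using n by (auto simp: nxt_def)
      qed
      then have "fst v < fst (snd f)" using v Vinj ends(2)[OF fE] by fastforce
      then have o: "over f (fst v)" using v n by (auto simp: over_def nxt_def)
      have "snd v < ht f (fst v)" using clean[OF fE v(1) o] v(6) by auto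
      then have "up f v" unfolding up_def using o v sv by auto
      then have "\<exists>f. nxt e f \<and> up f v" using n by blast
      then have "R e (v, False)" by (simp add: R_def)
      then show ?thesis using v(1) by blast
    qed
  qed
  have hteq: "e = f" if "e \<in> E" "f \<in> E" "over e t" "over f t" "ht e t = ht f t" for e f t
    using nc[OF that(1,2)] that(3-) unfolding crosses_def by blast
  have lo_unique: "e = e'" if "e \<in> E" "e' \<in> E" "lo e v" "lo e' v" for e e' v
    using hteq[of e e' "fst v"] that unfolding lo_def by (meson linorder_neqE)
  have up_unique: "e = e'" if "e \<in> E" "e' \<in> E" "up e v" "up e' v" for e e' v
    using hteq[of e e' "fst v"] that unfolding up_def by (meson linorder_neqE)
  have nxt_unique: "e = e'" if "e \<in> E" "e' \<in> E" "nxt e f" "nxt e' f" for e e' f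
    using same_left_same_slope[of e e'] that unfolding nxt_def by (metis linorder_neqE)
  have R_unique: "e = e'" if "e \<in> E" "e' \<in> E" "R e x" "R e' x" for e e' x
  proof (cases "snd x")
    case True
    then show ?thesis using that lo_unique[of e e'] by (auto simp: R_def)
  next
    case False
    then have "\<exists>f. nxt e f \<and> up f (fst x)" "\<exists>f. nxt e' f \<and> up f (fst x)"
      using that(3,4) unfolding R_def by simp_all
    then obtain f f' where f: "nxt e f" "up f (fst x)" "nxt e' f'" "up f' (fst x)" by blast
    then have "f = f'" using up_unique[of f f'] by (simp add: nxt_def)
    then show ?thesis using nxt_unique[of e e' f] that f by simp
  qed
  have "\<forall>e\<in>E-T. \<exists>x. x \<in> V \<times> UNIV \<and> R e x" using ex by blast
  then obtain c where c: "\<And>e. e \<in> E - T \<Longrightarrow> c e \<in> V \<times> UNIV \<and> R e (c e)"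
    using bchoice[of "E - T" "\<lambda>e x. x \<in> V \<times> UNIV \<and> R e x"] by blast
  have "inj_on c (E - T)"
  proof (rule inj_onI)
    fix e e' assume "e \<in> E - T" "e' \<in> E - T" "c e = c e'"
    then show "e = e'" using c[of e] c[of e'] R_unique[of e e' "c e"] by auto
  qed
  moreover have "c ` (E - T) \<subseteq> V \<times> UNIV" using c by blast
  moreover have "finite (V \<times> (UNIV :: bool set))" using finV by simp
  ultimately have "card (E - T) \<le> card (V \<times> (UNIV :: bool set))"
    using card_inj_on_le by blast
  then have "card (E - T) \<le> 2 * card V" by (simp add: card_cartesian_product)
  moreover have "card E = card (E - T) + card T"
  proof -
    have "T \<subseteq> E" by (auto simp: T_def)
    then show ?thesis using finE by (metis card_Diff_subset card_mono finite_subset le_add_diff_inverse2)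
  qed
  ultimately show ?thesis using T by linarith
qed


text \<open>Pairs are ordered, so each crossing counts twice; this fits the later bound by ordered
  pairs of lines.\<close>

definition crossings :: "(edge \<times> edge) set" where
  "crossings = {(e, f) \<in> E \<times> E. e \<noteq> f \<and> crosses e f}"

end

section \<open>The crossing inequality\<close>

lemma geo_graph_sub:
  assumes "geo_graph V E" "V' \<subseteq> V" "E' \<subseteq> E" "E' \<subseteq> V' \<times> V'"
  shows "geo_graph V' E'"
proof -
  interpret geo_graph V E by fact
  show ?thesis
  proof
    show "finite V'" "inj_on fst V'" "E' \<subseteq> V' \<times> V'"
      using assms finV injV by (auto intro: finite_subset inj_on_subset)
    show "fst (fst e) < fst (snd e)" if "e \<in> E'" for e using lr assms(3) that by blast
    show "snd v \<noteq> ht e (fst v)" if "e \<in> E'" "v \<in> V'" "over e (fst v)" for e v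
      using clean assms that by blast
  qed
qed

text \<open>Deleting one edge of a crossing pair lowers the number of edges by one and the number of
  crossings by at least one, until the crossing-free bound applies.\<close>

lemma card_le_crossings:
  assumes "geo_graph V E"
  shows "card E \<le> 3 * card V + card (geo_graph.crossings E)"
  using assms
proof (induction "card E" arbitrary: E)
  case 0
  then show ?case by simp
next
  case (Suc n)
  interpret geo_graph V E by fact
  show ?case
  proof (cases "\<exists>e\<in>E. \<exists>f\<in>E. e \<noteq> f \<and> crosses e f")
    case False
    then have "card E \<le> 3 * card V" by (intro noncrossing_card) blast
    then show ?thesis by linarith
  next
    case True
    then obtain e f where ef: "e \<in> E" "f \<in> E" "e \<noteq> f" "crosses e f" by blast
    let ?E = "E - {e}"
    have g: "geo_graph V ?E" using geo_graph_sub[OF Suc.prems, of V ?E] EV by auto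
    have cE: "n = card ?E" "card E = Suc (card ?E)" using Suc.hyps(2) ef finE by simp_all
    have "geo_graph.crossings ?E \<subseteq> crossings - {(e, f)}"
      unfolding geo_graph.crossings_def[OF g] crossings_def by auto
    moreover have fin: "finite crossings"
      unfolding crossings_def by (rule finite_subset[of _ "E \<times> E"]) (use finE in auto)
    ultimately have "card (geo_graph.crossings ?E) \<le> card (crossings - {(e, f)})"
      by (simp add: card_mono)
    also have "\<dots> = card crossings - 1" using fin ef by (simp add: crossings_def)
    finally have "card (geo_graph.crossings ?E) \<le> card crossings - 1" .
    moreover have "(e, f) \<in> crossings" using ef by (simp add: crossings_def)
    then have "crossings \<noteq> {}" by blast
    then have "card crossings \<ge> 1" using fin by (simp add: Suc_leI card_gt_0_iff)
    ultimately show ?thesis using Suc.hyps(1)[OF cE(1) g] cE(2) by linarith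
  qed
qed

lemma card_colourings:
  assumes "finite V" "A \<subseteq> V" "k \<ge> 1"
  shows "rcard {c \<in> V \<rightarrow>\<^sub>E {..<k}. \<forall>v\<in>A. c v = 0} = real k ^ card V / real k ^ card A"
proof -
  have "{c \<in> V \<rightarrow>\<^sub>E {..<k}. \<forall>v\<in>A. c v = 0} = (\<Pi>\<^sub>E v\<in>V. if v \<in> A then {0} else {..<k})"
  proof (intro set_eqI iffI)
    fix c assume "c \<in> {c \<in> V \<rightarrow>\<^sub>E {..<k}. \<forall>v\<in>A. c v = 0}"
    then show "c \<in> (\<Pi>\<^sub>E v\<in>V. if v \<in> A then {0} else {..<k})" by (simp add: PiE_iff)
  next
    fix c assume c: "c \<in> (\<Pi>\<^sub>E v\<in>V. if v \<in> A then {0} else {..<k})"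
    then have "c v < k" if "v \<in> V" for v
      using that assms(3) PiE_mem[OF c that] by (cases "v \<in> A") auto
    moreover have "c v = 0" if "v \<in> A" for v
      using that assms(2) PiE_mem[OF c, of v] by auto
    ultimately show "c \<in> {c \<in> V \<rightarrow>\<^sub>E {..<k}. \<forall>v\<in>A. c v = 0}"
      using c by (auto simp: PiE_iff)
  qed
  then have "card {c \<in> V \<rightarrow>\<^sub>E {..<k}. \<forall>v\<in>A. c v = 0} = (\<Prod>v\<in>V. if v \<in> A then 1 else k)"
    using assms(1) by (simp add: card_PiE if_distrib cong: if_cong)
  also have "\<dots> = (\<Prod>v\<in>V - A. k)"
    using assms by (simp add: prod.If_cases Diff_eq Compl_eq)
  also have "\<dots> = k ^ (card V - card A)" using assms by (simp add: card_Diff_subset finite_subset)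
  finally have "rcard {c \<in> V \<rightarrow>\<^sub>E {..<k}. \<forall>v\<in>A. c v = 0} = real k ^ (card V - card A)" by simp
  then show ?thesis using assms by (simp add: power_diff card_mono)
qed

text \<open>Expectation in counting form: under a uniformly random \<open>k\<close>-colouring,
  \<open>j\<close> given vertices all receive colour 0 with probability
  \<open>1 / k ^ j\<close>.\<close>

lemma sum_card_colourings:
  assumes "finite V" "finite X" "\<And>x. x \<in> X \<Longrightarrow> A x \<subseteq> V \<and> card (A x) = j" "k \<ge> 1"
  shows "(\<Sum>c\<in>V \<rightarrow>\<^sub>E {..<k::nat}. rcard {x \<in> X. \<forall>v\<in>A x. c v = 0})
       = rcard X * real k ^ card V / real k ^ j"
proof -
  let ?F = "V \<rightarrow>\<^sub>E {..<k}"
  have fin: "finite ?F" using assms(1) by (simp add: finite_PiE)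
  have "(\<Sum>c\<in>?F. rcard {x \<in> X. \<forall>v\<in>A x. c v = 0})
      = (\<Sum>c\<in>?F. \<Sum>x\<in>X. if \<forall>v\<in>A x. c v = 0 then 1 else 0)"
    using assms(2) by (simp add: sum.If_cases Int_def)
  also have "\<dots> = (\<Sum>x\<in>X. \<Sum>c\<in>?F. if \<forall>v\<in>A x. c v = 0 then 1 else 0)" by (rule sum.swap)
  also have "\<dots> = (\<Sum>x\<in>X. rcard {c \<in> ?F. \<forall>v\<in>A x. c v = 0})"
    using fin by (simp add: sum.If_cases Int_def)
  also have "\<dots> = (\<Sum>x\<in>X. real k ^ card V / real k ^ j)"
    using assms card_colourings[of V _ k] by (intro sum.cong) auto
  finally show ?thesis by simp
qed

text \<open>Amplification: the linear bound is averaged over the vertices of colour \<open>0\<close> in all colourings with \<open>k\<close>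
  colours, that is, over random vertex sets of density \<open>1 / k\<close>.\<close>

lemma crossing_lemma:
  assumes "geo_graph V E" "6 * card V \<le> card E"
  shows "rcard E ^ 3 \<le> 288 * rcard V ^ 2 * rcard (geo_graph.crossings E)"
proof (cases "card V = 0")
  case True
  interpret geo_graph V E by fact
  have "V = {}" using True finV by simp
  then have "E = {}" using EV by auto
  then show ?thesis by simp
next
  case False
  interpret geo_graph V E by fact
  define e v where "e = rcard E" and "v = rcard V"
  \<comment> \<open>The choice gives \<open>6 * v * k \<le> e\<close>, so after scaling the vertex
    term is at most half of \<open>e * k ^ 2\<close>. Rounding down costs a factor 2, that is
    \<open>k \<ge> e / (12 * v)\<close>, and \<open>288 = 2 * 12 ^ 2\<close>.\<close>
  define k where "k = nat \<lfloor>e / (6 * v)\<rfloor>"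
  have v: "v > 0" using False by (simp add: v_def)
  have ev: "6 * v \<le> e" using assms(2) by (simp add: e_def v_def)
  then have "e / (6 * v) \<ge> 1" using v by simp
  then have fl: "\<lfloor>e / (6 * v)\<rfloor> \<ge> 1" by linarith
  then have rk: "real k = of_int \<lfloor>e / (6 * v)\<rfloor>" unfolding k_def by simp
  have k1: "k \<ge> 1" using fl unfolding k_def by linarith
  have kle: "real k \<le> e / (6 * v)" unfolding rk by linarith
  have kge': "real k \<ge> e / (6 * v) / 2"
  proof -
    have "e / (6 * v) < real k + 1" unfolding rk by linarith
    moreover have "real k \<ge> 1" using k1 by simp
    ultimately have "e / (6 * v) < 2 * real k" by linarith
    then show ?thesis by simp
  qed
  have kge: "real k \<ge> e / (12 * v)" using kge' by (simp add: field_simps)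
  define cr where "cr = rcard crossings"
  let ?F = "V \<rightarrow>\<^sub>E {..<k}"
  have finC: "finite crossings"
    unfolding crossings_def by (rule finite_subset[of _ "E \<times> E"]) (use finE in auto)
  have step: "rcard {x \<in> E. \<forall>u\<in>{fst x, snd x}. c u = 0}
     \<le> 3 * rcard {x \<in> V. \<forall>u\<in>{x}. c u = 0} +
       rcard {x \<in> crossings. \<forall>u\<in>{fst (fst x), snd (fst x), fst (snd x), snd (snd x)}. c u = 0}" for c :: "real \<times> real \<Rightarrow> nat"
  proof -
    let ?E = "{x \<in> E. \<forall>u\<in>{fst x, snd x}. c u = (0::nat)}"
    let ?V = "{x \<in> V. \<forall>u\<in>{x}. c u = 0}"
    have g: "geo_graph ?V ?E" using assms(1) by (rule geo_graph_sub) (use EV in auto)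
    have "geo_graph.crossings ?E = {x \<in> crossings. \<forall>u\<in>{fst (fst x), snd (fst x), fst (snd x), snd (snd x)}. c u = 0}"
      unfolding geo_graph.crossings_def[OF g] crossings_def by auto
    then show ?thesis using card_le_crossings[OF g] by simp
  qed
  have s1: "(\<Sum>c\<in>?F. rcard {x \<in> E. \<forall>u\<in>{fst x, snd x}. c u = 0}) = e * real k ^ card V / real k ^ 2"
    unfolding e_def
  proof (rule sum_card_colourings[OF finV finE _ k1])
    fix x assume x: "x \<in> E"
    then have "fst x \<noteq> snd x" using lr[OF x] by auto
    then show "{fst x, snd x} \<subseteq> V \<and> card {fst x, snd x} = 2" using ends[OF x] by auto
  qed
  have s2: "(\<Sum>c\<in>?F. rcard {x \<in> V. \<forall>u\<in>{x}. c u = 0}) = v * real k ^ card V / real k ^ 1"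
    unfolding v_def by (rule sum_card_colourings[OF finV finV _ k1]) auto
  have s3: "(\<Sum>c\<in>?F. rcard {x \<in> crossings. \<forall>u\<in>{fst (fst x), snd (fst x), fst (snd x), snd (snd x)}. c u = 0})
     = cr * real k ^ card V / real k ^ 4"
    unfolding cr_def
  proof (rule sum_card_colourings[OF finV finC _ k1])
    fix x assume "x \<in> crossings"
    then have x: "fst x \<in> E" "snd x \<in> E" "fst x \<noteq> snd x" "crosses (fst x) (snd x)" by (auto simp: crossings_def)
    show "{fst (fst x), snd (fst x), fst (snd x), snd (snd x)} \<subseteq> V \<and>
       card {fst (fst x), snd (fst x), fst (snd x), snd (snd x)} = 4"
      using cross_distinct[OF x] ends[OF x(1)] ends[OF x(2)] by auto
  qed
  have "e * real k ^ card V / real k ^ 2 \<le> 3 * (v * real k ^ card V / real k ^ 1) + cr * real k ^ card V / real k ^ 4"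
    unfolding s1[symmetric] s2[symmetric] s3[symmetric] sum_distrib_left sum.distrib[symmetric]
    by (rule sum_mono) (rule step)
  then have "(e / real k ^ 2) * real k ^ card V \<le> (3 * (v / real k) + cr / real k ^ 4) * real k ^ card V"
    by (simp add: algebra_simps)
  then have "e / real k ^ 2 \<le> 3 * (v / real k) + cr / real k ^ 4"
    by (rule mult_right_le_imp_le) (use k1 in simp)
  then have "e / real k ^ 2 * real k ^ 4 \<le> (3 * (v / real k) + cr / real k ^ 4) * real k ^ 4"
    by (intro mult_right_mono) auto
  moreover have "e / real k ^ 2 * real k ^ 4 = e * real k ^ 2"
    using k1 by (simp add: power2_eq_square power4_eq_xxxx)
  moreover have "(3 * (v / real k) + cr / real k ^ 4) * real k ^ 4 = 3 * v * real k * real k ^ 2 + cr"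
    using k1 by (simp add: distrib_right) (simp add: power2_eq_square power4_eq_xxxx)
  ultimately have "e * real k ^ 2 \<le> 3 * v * real k * real k ^ 2 + cr" by linarith
  moreover have "6 * v * real k \<le> e" using kle v by (simp add: field_simps)
  then have "6 * v * real k * real k ^ 2 \<le> e * real k ^ 2" by (intro mult_right_mono) auto
  ultimately have "e * real k ^ 2 \<le> 2 * cr" by linarith
  moreover have "e * (e / (12 * v)) ^ 2 \<le> e * real k ^ 2"
    using kge v by (intro mult_left_mono power_mono) (auto simp: e_def)
  ultimately have "e * (e / (12 * v)) ^ 2 \<le> 2 * cr" by linarith
  then have "e * (e / (12 * v)) ^ 2 * (144 * v ^ 2) \<le> 2 * cr * (144 * v ^ 2)" by (intro mult_right_mono) auto
  then show ?thesis using v unfolding e_def[symmetric] v_def[symmetric] cr_def[symmetric]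
    by (simp add: field_simps power2_eq_square power3_eq_cube)
qed


section \<open>Points and lines in the plane\<close>

definition on_line :: "(real \<times> real) set \<Rightarrow> real \<times> real \<Rightarrow> (real \<times> real) set" where
  "on_line X l = {v \<in> X. snd v = fst l * fst v + snd l}"

lemma two_points_one_line:
  assumes "p \<in> on_line X l" "q \<in> on_line X l" "p \<in> on_line X l'" "q \<in> on_line X l'" "fst p \<noteq> fst q"
  shows "l = l'"
proof -
  have e: "snd p = fst l * fst p + snd l" "snd q = fst l * fst q + snd l"
    "snd p = fst l' * fst p + snd l'" "snd q = fst l' * fst q + snd l'"
    using assms by (auto simp: on_line_def)
  then have "(fst l - fst l') * (fst p - fst q) = 0" by (simp add: algebra_simps)
  then have "fst l = fst l'" using assms(5) by simp
  then show ?thesis using e by (simp add: prod_eq_iff)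
qed

definition consecutive :: "(real \<times> real) set \<Rightarrow> edge set" where
  "consecutive A = {(p, q) \<in> A \<times> A. fst p < fst q \<and> (\<forall>v\<in>A. \<not> (fst p < fst v \<and> fst v < fst q))}"

lemma card_consecutive:
  assumes fin: "finite A" and inj: "inj_on fst A"
  shows "card A - 1 \<le> card (consecutive A)"
proof (cases "A = {}")
  case False
  obtain a where a: "a \<in> A" "\<forall>b\<in>A. fst b \<le> fst a"
    using ex_min_image[OF fin False, of "\<lambda>p. - fst p"] by auto
  have ex: "\<exists>q. (p, q) \<in> consecutive A" if p: "p \<in> A - {a}" for p
  proof -
    let ?N = "{q \<in> A. fst p < fst q}"
    have "fst p \<noteq> fst a" using p a inj by (auto dest: inj_onD)
    then have "a \<in> ?N" using a p by force
    then obtain q where q: "q \<in> ?N" "\<forall>b\<in>?N. fst q \<le> fst b"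
      using ex_min_image[of ?N fst] fin by fastforce
    then have "(p, q) \<in> consecutive A" using p by (force simp: consecutive_def)
    then show ?thesis by blast
  qed
  have "A - {a} \<subseteq> fst ` consecutive A" using ex by force
  moreover have "finite (consecutive A)"
    by (rule finite_subset[of _ "A \<times> A"]) (use fin in \<open>auto simp: consecutive_def\<close>)
  ultimately have "card (A - {a}) \<le> card (consecutive A)" by (meson surj_card_le)
  then show ?thesis using a by simp
qed simp

lemma consecutive_unique:
  assumes "e \<in> consecutive A" "f \<in> consecutive A" "over e t" "over f t" "inj_on fst A"
  shows "e = f"
proof -
  have e: "fst e \<in> A" "snd e \<in> A" "\<And>v. v \<in> A \<Longrightarrow> \<not> (fst (fst e) < fst v \<and> fst v < fst (snd e))"
    and f: "fst f \<in> A" "snd f \<in> A" "\<And>v. v \<in> A \<Longrightarrow> \<not> (fst (fst f) < fst v \<and> fst v < fst (snd f))"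
    using assms by (auto simp: consecutive_def)
  have "fst (fst e) = fst (fst f)" "fst (snd e) = fst (snd f)"
    using e(3)[OF f(1)] e(3)[OF f(2)] f(3)[OF e(1)] f(3)[OF e(2)] assms(3,4) by (auto simp: over_def)
  then show ?thesis using e f assms(5) by (auto simp: prod_eq_iff dest: inj_onD)
qed

lemma ht_on_line:
  assumes "fst e \<in> on_line X l" "snd e \<in> on_line X l" "fst (fst e) < fst (snd e)"
  shows "ht e t = fst l * t + snd l"
proof -
  have "slope e = fst l" using assms
    by (simp add: slope_def on_line_def flip: right_diff_distrib)
  then show ?thesis using assms by (simp add: ht_def on_line_def algebra_simps)
qed

text \<open>Szekely's argument: consecutive points on each line are joined by edges. A line gives at
  least \<open>k / 2\<close> of them, and \<open>|L|^2\<close> bounds the ordered crossings. The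
  crossing inequality yields the first term, with \<open>2304 = 8 * 288\<close>; when there are
  fewer than six edges per vertex, counting edges yields the second. Coding lines by slope and
  intercept is enough, since no vertical line carries two points of \<open>X\<close>.\<close>

theorem szemeredi_trotter_plane:
  fixes X L :: "(real \<times> real) set"
  assumes finX: "finite X" and inj: "inj_on fst X" and finL: "finite L" and k: "k \<ge> 2"
    and rich: "\<And>l. l \<in> L \<Longrightarrow> k \<le> rcard (on_line X l)"
  shows "rcard L \<le> 2304 * (rcard X ^ 2 / k ^ 3 + rcard X / k)"
proof -
  define E where "E = (\<Union>l\<in>L. consecutive (on_line X l))"
  have sub: "on_line X l \<subseteq> X" for l by (auto simp: on_line_def)
  have injl: "inj_on fst (on_line X l)" and finl: "finite (on_line X l)" for l
    using sub inj finX by (meson inj_on_subset, meson finite_subset)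
  have Eht: "ht e t = fst l * t + snd l" if "e \<in> consecutive (on_line X l)" for e l t
    using that by (intro ht_on_line[of e X]) (auto simp: consecutive_def)
  interpret geo_graph X E
  proof
    show "E \<subseteq> X \<times> X" using sub by (fastforce simp: E_def consecutive_def)
    show "fst (fst e) < fst (snd e)" if "e \<in> E" for e
      using that by (auto simp: E_def consecutive_def)
    show "snd v \<noteq> ht e (fst v)" if e: "e \<in> E" and v: "v \<in> X" "over e (fst v)" for e v
    proof
      assume s: "snd v = ht e (fst v)"
      obtain l where l: "e \<in> consecutive (on_line X l)" using e by (auto simp: E_def)
      then have "v \<in> on_line X l" using Eht s v by (simp add: on_line_def)
      then show False using l v by (auto simp: consecutive_def over_def)
    qed
  qed (fact finX, fact inj)
  have fc: "finite (consecutive (on_line X l))" for l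
    by (rule finite_subset[of _ "on_line X l \<times> on_line X l"]) (use finl in \<open>auto simp: consecutive_def\<close>)
  have line_unique: "l = l'" if "e \<in> consecutive (on_line X l)" "e \<in> consecutive (on_line X l')" for e l l'
    by (rule two_points_one_line[of "fst e" X l "snd e" l']) (use that in \<open>auto simp: consecutive_def\<close>)
  have "card E = (\<Sum>l\<in>L. card (consecutive (on_line X l)))"
    unfolding E_def using line_unique finL fc by (intro card_UN_disjoint) auto
  moreover have "k / 2 \<le> rcard (consecutive (on_line X l))" if "l \<in> L" for l
  proof -
    have "k / 2 \<le> rcard (on_line X l) - 1" using rich[OF that] k by linarith
    also have "\<dots> \<le> real (card (on_line X l) - 1)" by linarith
    also have "\<dots> \<le> rcard (consecutive (on_line X l))"
      using card_consecutive[OF finl injl] by simp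
    finally show ?thesis .
  qed
  then have "(\<Sum>l\<in>L. k / 2) \<le> (\<Sum>l\<in>L. rcard (consecutive (on_line X l)))" by (rule sum_mono)
  ultimately have cE: "rcard L * k / 2 \<le> rcard E" by simp
  define line_of where "line_of e = (THE l. l \<in> L \<and> e \<in> consecutive (on_line X l))" for e
  have line_of: "line_of e \<in> L \<and> e \<in> consecutive (on_line X (line_of e))" if "e \<in> E" for e
  proof -
    obtain l where l: "l \<in> L \<and> e \<in> consecutive (on_line X l)" using \<open>e \<in> E\<close> unfolding E_def by blast
    then have "\<exists>!l. l \<in> L \<and> e \<in> consecutive (on_line X l)" using line_unique by blast
    then show ?thesis unfolding line_of_def by (rule theI')
  qed
  \<comment> \<open>Two lines meet over one abscissa only, and over it each line has at most one
    edge, so a crossing is recovered from its pair of lines.\<close>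
  have injc: "inj_on (\<lambda>(e, f). (line_of e, line_of f)) crossings"
  proof (rule inj_onI, clarify)
    fix e f e' f'
    assume 1: "(e, f) \<in> crossings" "(e', f') \<in> crossings" and eq: "line_of e = line_of e'" "line_of f = line_of f'"
    then have E: "e \<in> E" "f \<in> E" "e' \<in> E" "f' \<in> E" by (auto simp: crossings_def)
    obtain t where t: "over e t" "over f t" "ht e t = ht f t" using 1 by (auto simp: crossings_def crosses_def)
    obtain t' where t': "over e' t'" "over f' t'" "ht e' t' = ht f' t'" using 1 by (auto simp: crossings_def crosses_def)
    have ne: "line_of e \<noteq> line_of f"
    proof
      assume "line_of e = line_of f"
      then have "e = f" using consecutive_unique[OF _ _ t(1,2) injl] line_of E by metis
      then show False using 1 by (auto simp: crossings_def)
    qed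
    have a: "fst (line_of e) * t + snd (line_of e) = fst (line_of f) * t + snd (line_of f)"
      "fst (line_of e) * t' + snd (line_of e) = fst (line_of f) * t' + snd (line_of f)"
      using t(3) t'(3) Eht line_of E eq by metis+
    then have "(fst (line_of e) - fst (line_of f)) * (t - t') = 0" by (simp add: algebra_simps)
    moreover have "fst (line_of e) \<noteq> fst (line_of f)" using a(1) ne by (auto simp: prod_eq_iff)
    ultimately have "t = t'" by simp
    then have o: "over e' t" "over f' t" using t' by auto
    have "e \<in> consecutive (on_line X (line_of e))" "e' \<in> consecutive (on_line X (line_of e))"
      "f \<in> consecutive (on_line X (line_of f))" "f' \<in> consecutive (on_line X (line_of f))"
      using line_of[OF E(1)] line_of[OF E(2)] line_of[OF E(3)] line_of[OF E(4)] eq by auto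
    then have "e = e'" "f = f'"
      using consecutive_unique[OF _ _ t(1) o(1) injl] consecutive_unique[OF _ _ t(2) o(2) injl] by blast+
    then
    show "e = e' \<and> f = f'" ..
  qed
  have "(\<lambda>(e, f). (line_of e, line_of f)) ` crossings \<subseteq> L \<times> L" using line_of by (auto simp: crossings_def)
  then have "card crossings \<le> card (L \<times> L)" using card_inj_on_le[OF injc] finL by blast
  then have "card crossings \<le> (card L)\<^sup>2" by (simp add: card_cartesian_product power2_eq_square)
  then have cr: "rcard crossings \<le> rcard L ^ 2" by (metis of_nat_le_iff of_nat_power)
  define M N where "M = rcard X" and "N = rcard L"
  have "N \<le> 2304 * (M ^ 2 / k ^ 3 + M / k)"
  proof (cases "6 * card X \<le> card E")
    case False
    then have "rcard E \<le> 6 * M" unfolding M_def by linarith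
    then have "N * k / 2 \<le> 6 * M" using cE by (simp add: N_def)
    then have "N \<le> 12 * (M / k)" using k by (simp add: field_simps)
    also have "\<dots> \<le> 2304 * (M ^ 2 / k ^ 3 + M / k)"
    proof -
      have "12 * a \<le> 2304 * (b + a)" if "0 \<le> a" "0 \<le> b" for a b :: real using that by simp
      moreover have "0 \<le> M / k" "0 \<le> M ^ 2 / k ^ 3" using k by (simp_all add: M_def)
      ultimately show ?thesis by blast
    qed
    finally show ?thesis .
  next
    case True
    have "(N * k / 2) ^ 3 \<le> rcard E ^ 3" using cE k by (intro power_mono) (auto simp: N_def)
    also have "\<dots> \<le> 288 * M ^ 2 * rcard crossings"
      unfolding M_def using crossing_lemma[OF _ True] geo_graph_axioms by blast
    also have "\<dots> \<le> 288 * M ^ 2 * N ^ 2" using cr by (intro mult_left_mono) (auto simp: N_def)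
    finally have *: "N ^ 2 * (N * k ^ 3) \<le> N ^ 2 * (2304 * M ^ 2)"
      by (simp add: power_mult_distrib power_divide power2_eq_square power3_eq_cube mult_ac)
    have "N * k ^ 3 \<le> 2304 * M ^ 2"
    proof (cases "N = 0")
      case False
      then have "N ^ 2 > 0" by simp
      then show ?thesis using * by (simp only: mult_le_cancel_left_pos)
    qed simp
    then have "N \<le> 2304 * (M ^ 2 / k ^ 3)" using k by (simp add: field_simps)
    also have "\<dots> \<le> 2304 * (M ^ 2 / k ^ 3 + M / k)" using k by (simp add: M_def)
    finally show ?thesis .
  qed
  then show ?thesis by (simp add: M_def N_def)
qed

section \<open>Generic projection of a quotient space to the plane\<close>

lemma generic_orthogonal:
  fixes F W :: "'a::euclidean_space set"
  assumes F: "subspace F" and W: "finite W" "W \<inter> F = {}"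
  shows "\<exists>y. (\<forall>f\<in>F. y \<bullet> f = 0) \<and> (\<forall>w\<in>W. y \<bullet> w \<noteq> 0)"
  using W
proof (induction W rule: finite_induct)
  case empty
  then show ?case by (intro exI[of _ 0]) simp
next
  case (insert w W)
  then obtain y where y: "\<forall>f\<in>F. y \<bullet> f = 0" "\<forall>w\<in>W. y \<bullet> w \<noteq> 0" by auto
  obtain a u where au: "a \<in> span F" "\<And>v. v \<in> span F \<Longrightarrow> orthogonal u v" "w = a + u"
    using orthogonal_subspace_decomp_exists[of F w] by blast
  have sF: "span F = F" using F by (simp add: span_eq_iff)
  have uF: "\<forall>f\<in>F. u \<bullet> f = 0" using au(2) sF by (simp add: orthogonal_def)
  have "u \<noteq> 0" using au insert.prems sF by auto
  then have uw: "u \<bullet> w \<noteq> 0" using au uF sF by (simp add: inner_add_right)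
  \<comment> \<open>The old \<open>y\<close> is moved along the component \<open>u\<close> of
    \<open>w\<close> orthogonal to \<open>F\<close>. Every vector excludes at most one parameter
    \<open>t\<close>, and there are infinitely many.\<close>
  have "finite ((\<lambda>v. - (y \<bullet> v) / (u \<bullet> v)) ` insert w W)" using insert.hyps by simp
  then obtain t where t: "t \<notin> (\<lambda>v. - (y \<bullet> v) / (u \<bullet> v)) ` insert w W"
    using ex_new_if_finite[OF infinite_UNIV_char_0] by blast
  have "(y + t *\<^sub>R u) \<bullet> v \<noteq> 0" if v: "v \<in> insert w W" for v
  proof
    assume 0: "(y + t *\<^sub>R u) \<bullet> v = 0"
    then have e: "y \<bullet> v + t * (u \<bullet> v) = 0" by (simp add: inner_add_left)
    show False
    proof (cases "u \<bullet> v = 0")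
      case True
      then show False using e y(2) uw v by auto
    next
      case False
      then have "t = - (y \<bullet> v) / (u \<bullet> v)" using e by (simp add: field_simps)
      then show False using t v by blast
    qed
  qed
  moreover have "\<forall>f\<in>F. (y + t *\<^sub>R u) \<bullet> f = 0" using y uF by (simp add: inner_add_left)
  ultimately show ?case by blast
qed

lemma card_ge_2_obtain:
  assumes "rcard A \<ge> 2"
  obtains a b where "a \<in> A" "b \<in> A" "a \<noteq> b"
proof -
  have "\<not> card A \<le> Suc 0" using assms by simp
  then have "\<exists>a\<in>A. \<exists>b\<in>A. a \<noteq> b"
    by (metis card.empty card_le_Suc0_iff_eq card.infinite zero_le)
  then show ?thesis using that by blast
qed

text \<open>The Szemeredi-Trotter bound for points and lines of the projective space of the quotient by \<open>F\<close>, obtained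
  from the affine plane by the generic projection \<open>v \<mapsto> (x \<bullet> v / z \<bullet> v, y \<bullet> v / z \<bullet> v)\<close>.\<close>

theorem szemeredi_trotter_quotient:
  fixes F X :: "'a::euclidean_space set" and L :: "'a set set"
  assumes F: "subspace F" and finX: "finite X" and XF: "X \<inter> F = {}"
    and indep: "\<And>a b. a \<in> X \<Longrightarrow> b \<in> X \<Longrightarrow> a \<noteq> b \<Longrightarrow> b \<notin> span (insert a F)"
    and finL: "finite L" and k: "k \<ge> 2" and rich: "\<And>S. S \<in> L \<Longrightarrow> k \<le> rcard (X \<inter> S)"
    and line: "\<And>S a b. S \<in> L \<Longrightarrow> a \<in> X \<inter> S \<Longrightarrow> b \<in> X \<inter> S \<Longrightarrow> a \<noteq> b \<Longrightarrow> S = span (insert a (insert b F))"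
  shows "rcard L \<le> 2304 * (rcard X ^ 2 / k ^ 3 + rcard X / k)"
proof -
  have sF: "F \<subseteq> span (insert a F)" for a by (meson span_superset subset_insertI subset_trans)
  obtain z where zF: "\<forall>f\<in>F. z \<bullet> f = 0" and z: "\<forall>v\<in>X. z \<bullet> v \<noteq> 0"
    using generic_orthogonal[OF F finX XF] by blast
  \<comment> \<open>\<open>x\<close> has to separate the images: \<open>D a b\<close> below is its
    inner product with such a vector, and it vanishes iff the images of \<open>a\<close> and
    \<open>b\<close> have the same abscissa.\<close>
  define W1 where "W1 = (\<lambda>(a, b). (z \<bullet> b) *\<^sub>R a - (z \<bullet> a) *\<^sub>R b) ` {(a, b) \<in> X \<times> X. a \<noteq> b}"
  have "(z \<bullet> b) *\<^sub>R a - (z \<bullet> a) *\<^sub>R b \<notin> F" if ab: "a \<in> X" "b \<in> X" "a \<noteq> b" for a b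
  proof
    assume f: "(z \<bullet> b) *\<^sub>R a - (z \<bullet> a) *\<^sub>R b \<in> F"
    have aT: "a \<in> span (insert a F)" and fT: "(z \<bullet> b) *\<^sub>R a - (z \<bullet> a) *\<^sub>R b \<in> span (insert a F)"
      using f sF by (auto intro: span_base)
    have m: "(1 / (z \<bullet> a)) *\<^sub>R ((z \<bullet> b) *\<^sub>R a - ((z \<bullet> b) *\<^sub>R a - (z \<bullet> a) *\<^sub>R b)) \<in> span (insert a F)"
      by (rule span_scale[OF span_diff[OF span_scale[OF aT] fT]])
    have eq: "(1 / (z \<bullet> a)) *\<^sub>R ((z \<bullet> b) *\<^sub>R a - ((z \<bullet> b) *\<^sub>R a - (z \<bullet> a) *\<^sub>R b)) = b"
      using z ab by simp
    show False using m unfolding eq using ab indep by blast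
  qed
  then have "W1 \<inter> F = {}" by (auto simp: W1_def)
  moreover have "finite W1" unfolding W1_def using finX
    by (intro finite_imageI) (rule finite_subset[of _ "X \<times> X"], auto)
  ultimately obtain x where xF: "\<forall>f\<in>F. x \<bullet> f = 0" and x: "\<forall>w\<in>W1. x \<bullet> w \<noteq> 0"
    using generic_orthogonal[OF F] by blast
  define D where "D a b = (x \<bullet> a) * (z \<bullet> b) - (x \<bullet> b) * (z \<bullet> a)" for a b
  have D: "D a b \<noteq> 0" if "a \<in> X" "b \<in> X" "a \<noteq> b" for a b
  proof -
    have "(z \<bullet> b) *\<^sub>R a - (z \<bullet> a) *\<^sub>R b \<in> W1" using that by (auto simp: W1_def)
    then have "x \<bullet> ((z \<bullet> b) *\<^sub>R a - (z \<bullet> a) *\<^sub>R b) \<noteq> 0" using x by blast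
    then show ?thesis by (simp add: D_def inner_diff_right mult.commute)
  qed
  \<comment> \<open>\<open>D\<close> is a 2 by 2 determinant, so \<open>x\<close> and
    \<open>z\<close> annihilate \<open>w a b c\<close>, and \<open>y \<bullet> w a b c\<close> is
    the 3 by 3 determinant that vanishes iff the three images are collinear. A generic
    \<open>y\<close> lets this happen only when \<open>w a b c\<close> lies in \<open>F\<close>,
    that is, when \<open>a\<close>, \<open>b\<close>, \<open>c\<close> were already collinear modulo
    \<open>F\<close>.\<close>
  define w where "w a b c = D b c *\<^sub>R a + D c a *\<^sub>R b + D a b *\<^sub>R c" for a b c
  define W2 where "W2 = (\<lambda>(a, b, c). w a b c) ` (X \<times> X \<times> X) - F"
  have "finite W2" using finX by (simp add: W2_def)
  then obtain y where yF: "\<forall>f\<in>F. y \<bullet> f = 0" and y: "\<forall>w\<in>W2. y \<bullet> w \<noteq> 0"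
    using generic_orthogonal[OF F, of W2] by (auto simp: W2_def)
  define \<phi> where "\<phi> v = ((x \<bullet> v) / (z \<bullet> v), (y \<bullet> v) / (z \<bullet> v))" for v
  have injf: "inj_on (\<lambda>v. fst (\<phi> v)) X"
  proof (rule inj_onI, rule ccontr)
    fix a b assume ab: "a \<in> X" "b \<in> X" "fst (\<phi> a) = fst (\<phi> b)" "a \<noteq> b"
    then have "D a b = 0" using z by (simp add: \<phi>_def D_def field_simps)
    then show False using D ab by blast
  qed
  have inj: "inj_on \<phi> X" using injf by (auto simp: inj_on_def)
  have injfst: "inj_on fst (\<phi> ` X)" using injf by (auto simp: inj_on_def)
  have "\<exists>l. \<forall>u\<in>S. y \<bullet> u = fst l * (x \<bullet> u) + snd l * (z \<bullet> u)" if S: "S \<in> L" for S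
  proof -
    obtain a b where ab: "a \<in> X \<inter> S" "b \<in> X \<inter> S" "a \<noteq> b"
      using card_ge_2_obtain[OF order_trans[OF k rich[OF S]]] by blast
    have d: "D a b \<noteq> 0" using D ab by blast
    \<comment> \<open>Cramer's rule: \<open>s\<close> and \<open>c\<close> are slope and intercept
      of the line through the images of \<open>a\<close> and \<open>b\<close>.\<close>
    define s where "s = ((y \<bullet> a) * (z \<bullet> b) - (y \<bullet> b) * (z \<bullet> a)) / D a b"
    define c where "c = ((x \<bullet> a) * (y \<bullet> b) - (x \<bullet> b) * (y \<bullet> a)) / D a b"
    define g where "g = y - s *\<^sub>R x - c *\<^sub>R z"
    have g: "g \<bullet> u = y \<bullet> u - s * (x \<bullet> u) - c * (z \<bullet> u)" for u
      by (simp add: g_def inner_diff_left)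
    have "D a b * (g \<bullet> a) = 0" "D a b * (g \<bullet> b) = 0"
      unfolding g s_def c_def using d
      by (simp_all add: right_diff_distrib) (simp_all add: D_def algebra_simps)
    then have "g \<bullet> a = 0" "g \<bullet> b = 0" using d by auto
    moreover have "g \<bullet> f = 0" if "f \<in> F" for f using g xF yF zF that by simp
    ultimately have "insert a (insert b F) \<subseteq> {u. g \<bullet> u = 0}" by auto
    then have "span (insert a (insert b F)) \<subseteq> {u. g \<bullet> u = 0}"
      by (intro span_minimal subspace_hyperplane)
    then have "\<forall>u\<in>S. g \<bullet> u = 0" using line[OF S ab] by blast
    then show ?thesis using g by (intro exI[of _ "(s, c)"]) auto
  qed
  then obtain l where l: "\<And>S u. S \<in> L \<Longrightarrow> u \<in> S \<Longrightarrow> y \<bullet> u = fst (l S) * (x \<bullet> u) + snd (l S) * (z \<bullet> u)"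
    using bchoice[of L "\<lambda>S l. \<forall>u\<in>S. y \<bullet> u = fst l * (x \<bullet> u) + snd l * (z \<bullet> u)"] by blast
  have injl: "inj_on l L"
  proof (rule inj_onI, rule ccontr)
    fix S S' assume SS: "S \<in> L" "S' \<in> L" "l S = l S'" "S \<noteq> S'"
    obtain a b where ab: "a \<in> X \<inter> S" "b \<in> X \<inter> S" "a \<noteq> b"
      using card_ge_2_obtain[OF order_trans[OF k rich[OF SS(1)]]] by blast
    \<comment> \<open>If all points of \<open>X\<close> on \<open>S'\<close> were also on
      \<open>S\<close>, two of them would span both.\<close>
    obtain c where c: "c \<in> X" "c \<in> S'" "c \<notin> S"
    proof (rule ccontr)
      assume "\<not> thesis"
      then have sub: "X \<inter> S' \<subseteq> X \<inter> S" using that by blast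
      obtain a' b' where ab': "a' \<in> X \<inter> S'" "b' \<in> X \<inter> S'" "a' \<noteq> b'"
        using card_ge_2_obtain[OF order_trans[OF k rich[OF SS(2)]]] by blast
      then have "S = S'" using line[OF SS(1), of a' b'] line[OF SS(2), of a' b'] sub by blast
      then show False using SS by simp
    qed
    have nF: "w a b c \<notin> F"
    proof
      assume wF: "w a b c \<in> F"
      let ?T = "span (insert a (insert b F))"
      have T: "a \<in> ?T" "b \<in> ?T" "w a b c \<in> ?T" using wF by (auto intro: span_base)
      have "(1 / D a b) *\<^sub>R (w a b c - D b c *\<^sub>R a - D c a *\<^sub>R b) \<in> ?T"
        using T by (intro span_scale span_diff)
      moreover have "(1 / D a b) *\<^sub>R (w a b c - D b c *\<^sub>R a - D c a *\<^sub>R b) = c"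
        using D ab by (simp add: w_def)
      ultimately show False using line[OF SS(1) ab] c by simp
    qed
    have "x \<bullet> w a b c = 0" "z \<bullet> w a b c = 0"
      by (simp_all add: w_def D_def inner_add_right algebra_simps)
    moreover have "y \<bullet> u = fst (l S) * (x \<bullet> u) + snd (l S) * (z \<bullet> u)" if "u \<in> {a, b, c}" for u
      using that l[OF SS(1), of u] l[OF SS(2), of u] SS(3) ab c by auto
    then have "y \<bullet> w a b c = fst (l S) * (x \<bullet> w a b c) + snd (l S) * (z \<bullet> w a b c)"
      by (simp add: w_def inner_add_right algebra_simps)
    ultimately have "y \<bullet> w a b c = 0" by simp
    moreover have "w a b c \<in> W2"
      using nF ab c image_eqI[of "w a b c" "\<lambda>(a, b, c). w a b c" "(a, b, c)" "X \<times> X \<times> X"]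
      by (simp add: W2_def)
    ultimately show False using y by blast
  qed
  have rl: "k \<le> rcard (on_line (\<phi> ` X) m)" if "m \<in> l ` L" for m
  proof -
    obtain S where S: "S \<in> L" "m = l S" using \<open>m \<in> l ` L\<close> by blast
    have "\<phi> ` (X \<inter> S) \<subseteq> on_line (\<phi> ` X) m"
    proof (rule image_subsetI)
      fix v assume "v \<in> X \<inter> S"
      then have v: "v \<in> X" "v \<in> S" by auto
      then have "y \<bullet> v = fst m * (x \<bullet> v) + snd m * (z \<bullet> v)" using l S by blast
      then have "snd (\<phi> v) = fst m * fst (\<phi> v) + snd m" using z v by (simp add: \<phi>_def field_simps)
      then show "\<phi> v \<in> on_line (\<phi> ` X) m" using v by (simp add: on_line_def)
    qed
    moreover have "finite (on_line (\<phi> ` X) m)" using finX by (simp add: on_line_def)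
    ultimately have "card (\<phi> ` (X \<inter> S)) \<le> card (on_line (\<phi> ` X) m)" by (simp add: card_mono)
    moreover have "card (\<phi> ` (X \<inter> S)) = card (X \<inter> S)"
      using inj by (meson card_image inf_le1 inj_on_subset)
    ultimately show ?thesis using rich[OF S(1)] by linarith
  qed
  have "rcard (l ` L) \<le> 2304 * (rcard (\<phi> ` X) ^ 2 / k ^ 3 + rcard (\<phi> ` X) / k)"
    by (rule szemeredi_trotter_plane[OF _ injfst _ k rl]) (use finX finL in auto)
  then show ?thesis by (simp add: card_image[OF inj] card_image[OF injl])
qed


text \<open>A simple set of vectors represents distinct points of projective space.\<close>

definition simple :: "'a::euclidean_space set \<Rightarrow> bool" where
  "simple P \<longleftrightarrow> 0 \<notin> P \<and> (\<forall>a\<in>P. \<forall>b\<in>P. a \<noteq> b \<longrightarrow> b \<notin> span {a})"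

lemma simple_subset: "simple P \<Longrightarrow> Q \<subseteq> P \<Longrightarrow> simple Q"
  by (auto simp: simple_def)

lemma simple_card_span: "simple P \<Longrightarrow> a \<in> P \<Longrightarrow> P \<inter> span {a} = {a}"
  by (auto simp: simple_def span_base)

lemma span_insert_exchange:
  fixes F :: "'a::euclidean_space set"
  assumes "subspace F" "b \<in> span (insert a F)" "b \<notin> F"
  shows "a \<in> span (insert b F)"
proof -
  have "span F = F" using assms(1) by (simp add: span_eq_iff)
  then show ?thesis using in_span_insert assms by metis
qed

text \<open>Greedy choice of one vector for each point of the projective space of the quotient by
  \<open>F\<close>; how many vectors of \<open>H\<close> share that point is controlled
  separately.\<close>

lemma representatives:
  fixes F H :: "'a::euclidean_space set"
  assumes F: "subspace F" and "finite H" "H \<inter> F = {}"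
  shows "\<exists>X\<subseteq>H. (\<forall>a\<in>X. \<forall>b\<in>X. a \<noteq> b \<longrightarrow> b \<notin> span (insert a F)) \<and> (\<forall>p\<in>H. \<exists>x\<in>X. p \<in> span (insert x F))"
  using assms(2,3)
proof (induction H rule: finite_induct)
  case empty
  then show ?case by auto
next
  case (insert h H)
  then obtain X where X: "X \<subseteq> H" "\<forall>a\<in>X. \<forall>b\<in>X. a \<noteq> b \<longrightarrow> b \<notin> span (insert a F)"
    "\<forall>p\<in>H. \<exists>x\<in>X. p \<in> span (insert x F)" by auto
  show ?case
  proof (cases "\<exists>x\<in>X. h \<in> span (insert x F)")
    case True
    then show ?thesis using X by (intro exI[of _ X]) auto
  next
    case False
    have "a \<notin> span (insert h F)" if "a \<in> X" for a
      using span_insert_exchange[OF F, of a h] that False X(1) insert.prems by blast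
    then show ?thesis using X False
      by (intro exI[of _ "insert h X"]) (auto intro: span_base)
  qed
qed

text \<open>Dyadic shells: with \<open>M = |X|\<close> and \<open>K = 2 ^ i * k\<close>, at most
  \<open>2304 * (M ^ 2 / K ^ 3 + M / K)\<close> lines have between \<open>K\<close> and
  \<open>2 * K\<close> points, and each contributes at most \<open>4 * K ^ 2\<close>. The two
  factors in the bound are the geometric sums of \<open>1 / 2 ^ i\<close> and of
  \<open>2 ^ i\<close> over \<open>i < j\<close>, and \<open>9216 = 4 * 2304\<close>.\<close>

lemma st_shell_sum:
  fixes F X :: "'a::euclidean_space set" and L :: "'a set set"
  assumes F: "subspace F" and finX: "finite X" and XF: "X \<inter> F = {}"
    and indep: "\<And>a b. a \<in> X \<Longrightarrow> b \<in> X \<Longrightarrow> a \<noteq> b \<Longrightarrow> b \<notin> span (insert a F)"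
    and finL: "finite L" and k: "k \<ge> 2" and rich: "\<And>S. S \<in> L \<Longrightarrow> k \<le> rcard (X \<inter> S)"
    and line: "\<And>S a b. S \<in> L \<Longrightarrow> a \<in> X \<inter> S \<Longrightarrow> b \<in> X \<inter> S \<Longrightarrow> a \<noteq> b \<Longrightarrow> S = span (insert a (insert b F))"
    and poor: "\<And>S. S \<in> L \<Longrightarrow> rcard (X \<inter> S) < 2 ^ j * k"
  shows "(\<Sum>S\<in>L. rcard (X \<inter> S) ^ 2)
     \<le> 9216 * (rcard X ^ 2 / k * (2 - 2 / 2 ^ j) + rcard X * k * (2 ^ j - 1))"
  using finL rich line poor
proof (induction j arbitrary: L)
  case 0
  then have "L = {}" by force
  then show ?case by simp
next
  case (Suc j)
  define A where "A = {S \<in> L. rcard (X \<inter> S) < 2 ^ j * k}"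
  define B where "B = L - A"
  define M where "M = rcard X"
  define K where "K = 2 ^ j * k"
  have "k \<le> K" unfolding K_def using k by simp
  then have K: "K \<ge> 2" using k by simp
  have IH: "(\<Sum>S\<in>A. rcard (X \<inter> S) ^ 2) \<le> 9216 * (M ^ 2 / k * (2 - 2 / 2 ^ j) + M * k * (2 ^ j - 1))"
    unfolding M_def
  proof (rule Suc.IH)
    show "finite A" using Suc.prems(1) by (simp add: A_def)
    show "k \<le> rcard (X \<inter> S)" if "S \<in> A" for S using Suc.prems(2) that by (simp add: A_def)
    show "S = span (insert a (insert b F))"
      if "S \<in> A" "a \<in> X \<inter> S" "b \<in> X \<inter> S" "a \<noteq> b" for S a b
      using Suc.prems(3)[of S a b] that unfolding A_def by blast
    show "rcard (X \<inter> S) < 2 ^ j * k" if "S \<in> A" for S using that by (simp add: A_def)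
  qed
  have cB: "rcard B \<le> 2304 * (M ^ 2 / K ^ 3 + M / K)"
    unfolding M_def
  proof (rule szemeredi_trotter_quotient[OF F finX XF indep _ K])
    show "finite B" using Suc.prems(1) by (simp add: B_def)
    show "K \<le> rcard (X \<inter> S)" if "S \<in> B" for S using that by (simp add: B_def A_def K_def not_less)
    show "S = span (insert a (insert b F))"
      if "S \<in> B" "a \<in> X \<inter> S" "b \<in> X \<inter> S" "a \<noteq> b" for S a b
      using Suc.prems(3)[of S a b] that unfolding B_def by blast
  qed
  have "(\<Sum>S\<in>B. rcard (X \<inter> S) ^ 2) \<le> (\<Sum>S\<in>B. (2 * K) ^ 2)"
  proof (rule sum_mono)
    fix S assume "S \<in> B"
    then have "rcard (X \<inter> S) \<le> 2 * K" using Suc.prems(4)[of S] by (auto simp: B_def K_def)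
    then show "rcard (X \<inter> S) ^ 2 \<le> (2 * K) ^ 2" by (intro power_mono) auto
  qed
  also have "\<dots> = rcard B * (4 * K ^ 2)" by (simp add: power_mult_distrib)
  also have "\<dots> \<le> 2304 * (M ^ 2 / K ^ 3 + M / K) * (4 * K ^ 2)" using cB by (intro mult_right_mono) auto
  also have "\<dots> = 9216 * (M ^ 2 / K + M * K)" using K by (simp add: field_simps power2_eq_square power3_eq_cube)
  finally have sB: "(\<Sum>S\<in>B. rcard (X \<inter> S) ^ 2) \<le> 9216 * (M ^ 2 / K + M * K)" .
  have "(\<Sum>S\<in>L. rcard (X \<inter> S) ^ 2) = (\<Sum>S\<in>B. rcard (X \<inter> S) ^ 2) + (\<Sum>S\<in>A. rcard (X \<inter> S) ^ 2)"
    unfolding B_def by (rule sum.subset_diff) (use Suc.prems in \<open>auto simp: A_def\<close>)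
  also have "\<dots> \<le> 9216 * (M ^ 2 / K + M * K) + 9216 * (M ^ 2 / k * (2 - 2 / 2 ^ j) + M * k * (2 ^ j - 1))"
    using sB IH by linarith
  also have "\<dots> = 9216 * (M ^ 2 / k * (2 - 2 / 2 ^ Suc j) + M * k * (2 ^ Suc j - 1))"
    unfolding K_def using k by (simp add: field_simps)
  finally show ?case by (simp add: M_def)
qed

text \<open>Bounds the pairs of points joined by lines that are rich but not too rich. The least
  number of shells that passes \<open>B\<close> overshoots by at most a factor 2.\<close>

lemma st_second_moment:
  fixes F X :: "'a::euclidean_space set" and L :: "'a set set"
  assumes F: "subspace F" and finX: "finite X" and XF: "X \<inter> F = {}"
    and indep: "\<And>a b. a \<in> X \<Longrightarrow> b \<in> X \<Longrightarrow> a \<noteq> b \<Longrightarrow> b \<notin> span (insert a F)"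
    and finL: "finite L" and k: "k \<ge> 2" and rich: "\<And>S. S \<in> L \<Longrightarrow> k \<le> rcard (X \<inter> S)"
    and line: "\<And>S a b. S \<in> L \<Longrightarrow> a \<in> X \<inter> S \<Longrightarrow> b \<in> X \<inter> S \<Longrightarrow> a \<noteq> b \<Longrightarrow> S = span (insert a (insert b F))"
    and poor: "\<And>S. S \<in> L \<Longrightarrow> rcard (X \<inter> S) \<le> B" and B: "B \<ge> 0"
  shows "(\<Sum>S\<in>L. rcard (X \<inter> S) ^ 2) \<le> 18432 * (rcard X ^ 2 / k + rcard X * B)"
proof (cases "L = {}")
  case True
  then show ?thesis using B k by simp
next
  case False
  then obtain S0 where "S0 \<in> L" by blast
  then have kB: "k \<le> B" using rich poor by fastforce
  define j where "j = (LEAST j. B < 2 ^ j * k)"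
  have "\<exists>j. B / k < 2 ^ j" by (rule real_arch_pow) simp
  then have ex: "\<exists>j. B < 2 ^ j * k" using k by (simp add: field_simps)
  then have j: "B < 2 ^ j * k" unfolding j_def by (rule LeastI_ex)
  then have "j \<noteq> 0" using kB by (intro notI) simp
  then obtain i where i: "j = Suc i" by (cases j) auto
  then have "\<not> B < 2 ^ i * k" using not_less_Least[of i "\<lambda>j. B < 2 ^ j * k"] by (simp add: j_def)
  then have jB: "2 ^ j * k \<le> 2 * B" using i by simp
  have "(\<Sum>S\<in>L. rcard (X \<inter> S) ^ 2)
     \<le> 9216 * (rcard X ^ 2 / k * (2 - 2 / 2 ^ j) + rcard X * k * (2 ^ j - 1))"
    by (rule st_shell_sum[OF F finX XF indep finL k rich line]) (assumption | rule order_le_less_trans[OF poor j])+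
  also have "\<dots> \<le> 9216 * (rcard X ^ 2 / k * 2 + rcard X * (2 * B))"
  proof (intro mult_left_mono add_mono)
    have "k * (2 ^ j - 1) \<le> 2 * B" using jB k by (simp add: algebra_simps)
    then show "rcard X * k * (2 ^ j - 1) \<le> rcard X * (2 * B)"
      by (simp add: mult.assoc mult_left_mono)
  qed (use k in auto)
  finally show ?thesis by simp
qed

section \<open>Beck's theorem and non-degenerate subspaces\<close>

lemma span_insert_span [simp]: "span (insert a (span A)) = span (insert a A)" for A :: "'a::euclidean_space set"
proof
  have "insert a (span A) \<subseteq> span (insert a A)"
    using span_mono[of A "insert a A"] by (auto intro: span_base)
  then show "span (insert a (span A)) \<subseteq> span (insert a A)" by (simp add: span_minimal)
  show "span (insert a A) \<subseteq> span (insert a (span A))" by (rule span_mono) (auto intro: span_base)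
qed

lemma span_insert2_span: "span (insert a (insert b (span A))) = span (insert a (insert b A))"
  for A :: "'a::euclidean_space set"
  by (metis span_insert_span)

lemma span_insert_eq:
  fixes G :: "'a::euclidean_space set"
  assumes "subspace G" "q \<in> span (insert p G)" "q \<notin> G"
  shows "span (insert q G) = span (insert p G)"
proof
  show "span (insert q G) \<subseteq> span (insert p G)"
    using assms(2) by (intro span_minimal) (auto intro: span_base)
  show "span (insert p G) \<subseteq> span (insert q G)"
    using span_insert_exchange[OF assms] by (intro span_minimal) (auto intro: span_base)
qed

lemma span_two_eq:
  fixes F S :: "'a::euclidean_space set"
  assumes "subspace F" "subspace S" "F \<subseteq> S" "dim S \<le> dim F + 2" "a \<in> S" "b \<in> S" "a \<notin> F"
    "b \<notin> span (insert a F)"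
  shows "S = span (insert a (insert b F))"
proof -
  have sF: "span F = F" using assms(1) by (simp add: span_eq_iff)
  have "dim (insert b (insert a F)) = dim F + 2"
    using assms(7,8) by (subst dim_insert, subst dim_insert) (simp only: sF, simp)
  then have d: "dim (span (insert a (insert b F))) = dim F + 2" by (simp add: insert_commute)
  have "span (insert a (insert b F)) \<subseteq> S" using assms by (intro span_minimal) auto
  then show ?thesis using subspace_dim_equal[OF subspace_span assms(2)] d assms(4) by metis
qed

text \<open>Every representative stands for at most \<open>w\<close> points of \<open>H\<close>,
  those in its span with \<open>F\<close>. This converts counts of vectors into counts of points of
  the quotient.\<close>

lemma card_le_representatives:
  fixes P F H X S :: "'a::euclidean_space set"
  assumes finP: "finite P" and F: "subspace F" and HP: "H \<subseteq> P" and HF: "H \<inter> F = {}" and XH: "X \<subseteq> H"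
    and cover: "\<And>p. p \<in> H \<Longrightarrow> \<exists>x\<in>X. p \<in> span (insert x F)"
    and light: "\<And>p. p \<in> H \<Longrightarrow> rcard (P \<inter> span (insert p F)) \<le> w"
    and S: "subspace S" "F \<subseteq> S"
  shows "rcard (H \<inter> S) \<le> w * rcard (X \<inter> S)"
proof -
  have finX: "finite (X \<inter> S)" using finP HP XH by (meson finite_Int finite_subset)
  have "H \<inter> S \<subseteq> (\<Union>x\<in>X \<inter> S. P \<inter> span (insert x F))"
  proof
    fix p assume p: "p \<in> H \<inter> S"
    then obtain x where x: "x \<in> X" "p \<in> span (insert x F)" using cover by blast
    have "x \<in> span (insert p F)" using span_insert_exchange[OF F x(2)] p HF by blast
    moreover have "span (insert p F) \<subseteq> S" using p S by (intro span_minimal) auto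
    ultimately show "p \<in> (\<Union>x\<in>X \<inter> S. P \<inter> span (insert x F))" using x p HP by blast
  qed
  then have "card (H \<inter> S) \<le> card (\<Union>x\<in>X \<inter> S. P \<inter> span (insert x F))"
    using finX finP by (intro card_mono) auto
  also have "\<dots> \<le> (\<Sum>x\<in>X \<inter> S. card (P \<inter> span (insert x F)))" by (rule card_UN_le[OF finX])
  finally have "rcard (H \<inter> S) \<le> (\<Sum>x\<in>X \<inter> S. rcard (P \<inter> span (insert x F)))"
    by (metis of_nat_le_iff of_nat_sum)
  also have "\<dots> \<le> (\<Sum>x\<in>X \<inter> S. w)" by (rule sum_mono) (use light XH in blast)
  finally show ?thesis by (simp add: mult.commute)
qed

lemma card_pairs_le:
  assumes "finite H" "A \<subseteq> H \<times> H" "\<And>p. p \<in> H \<Longrightarrow> rcard {q. (q, p) \<in> A} \<le> c" "rcard H \<le> m" "c \<ge> 0"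
  shows "rcard A \<le> m * c"
proof -
  have fin: "finite {q. (q, p) \<in> A}" for p
    by (rule finite_subset[OF _ assms(1)]) (use assms(2) in auto)
  have "A = (\<lambda>(p, q). (q, p)) ` (SIGMA p:H. {q. (q, p) \<in> A})" using assms(2) by force
  then have "card A \<le> card (SIGMA p:H. {q. (q, p) \<in> A})"
    using card_image_le[of "SIGMA p:H. {q. (q, p) \<in> A}" "\<lambda>(p, q). (q, p)"] fin assms(1) by simp
  also have "\<dots> = (\<Sum>p\<in>H. card {q. (q, p) \<in> A})" using assms(1) fin by (simp add: card_SigmaI)
  finally have "rcard A \<le> (\<Sum>p\<in>H. rcard {q. (q, p) \<in> A})"
    by (metis of_nat_le_iff of_nat_sum)
  also have "\<dots> \<le> (\<Sum>p\<in>H. c)" by (rule sum_mono) (use assms(3) in blast)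
  also have "\<dots> = rcard H * c" by simp
  also have "\<dots> \<le> m * c" using assms(4,5) by (rule mult_right_mono)
  finally show ?thesis .
qed

text \<open>The subspaces spanned by \<open>G\<close> and one further vector are disjoint outside
  \<open>G\<close>. Hence at most \<open>|P|\<close> of them occur, together they have at most
  \<open>|P|\<close> points outside \<open>G\<close>, and each has at most \<open>w\<close> inside:
  this is the factor \<open>1 + w\<close>.\<close>

lemma sparse_partners:
  fixes P F H :: "'a::euclidean_space set"
  assumes finP: "finite P" and G: "subspace G" and HP: "H \<subseteq> P"
    and light: "rcard (P \<inter> G) \<le> w" and \<eta>: "\<eta> \<ge> 0" and w: "w \<ge> 0"
  shows "rcard {q \<in> H. q \<notin> G \<and> rcard (H \<inter> span (insert q G)) < \<eta> * rcard (P \<inter> span (insert q G))}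
     \<le> \<eta> * (1 + w) * rcard P"
proof -
  define N where "N = {q \<in> H. q \<notin> G \<and> rcard (H \<inter> span (insert q G)) < \<eta> * rcard (P \<inter> span (insert q G))}"
  define Ss where "Ss = (\<lambda>q. span (insert q G)) ` N"
  have finN: "finite N" using finP HP by (auto simp: N_def intro: finite_subset)
  then have finS: "finite Ss" by (simp add: Ss_def)
  have S_eq: "S = span (insert q G)" if "S \<in> Ss" "q \<in> S - G" for S q
    using that span_insert_eq[OF G, of q] unfolding Ss_def by blast
  have card_split: "rcard (P \<inter> S) \<le> rcard (P \<inter> (S - G)) + w" for S
  proof -
    have "P \<inter> S \<subseteq> (P \<inter> (S - G)) \<union> (P \<inter> G)" by blast
    then have "card (P \<inter> S) \<le> card ((P \<inter> (S - G)) \<union> (P \<inter> G))" using finP by (intro card_mono) auto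
    also have "\<dots> \<le> card (P \<inter> (S - G)) + card (P \<inter> G)" by (rule card_Un_le)
    finally show ?thesis using light by linarith
  qed
  have "(\<Sum>S\<in>Ss. card (P \<inter> (S - G))) = card (\<Union>S\<in>Ss. P \<inter> (S - G))"
  proof (rule card_UN_disjoint[symmetric])
    show "\<forall>S\<in>Ss. \<forall>T\<in>Ss. S \<noteq> T \<longrightarrow> P \<inter> (S - G) \<inter> (P \<inter> (T - G)) = {}" using S_eq by blast
  qed (use finS finP in auto)
  also have "\<dots> \<le> card P" using finP by (intro card_mono) auto
  finally have sumP: "(\<Sum>S\<in>Ss. card (P \<inter> (S - G))) \<le> card P" .
  have "1 \<le> card (P \<inter> (S - G))" if "S \<in> Ss" for S
  proof -
    obtain q where q: "q \<in> N" "S = span (insert q G)" using \<open>S \<in> Ss\<close> by (auto simp: Ss_def)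
    then have "q \<in> P \<inter> (S - G)" using HP by (auto simp: N_def intro: span_base)
    then show ?thesis using finP by (metis One_nat_def Suc_leI card_gt_0_iff empty_iff finite_Int)
  qed
  then have "(\<Sum>S\<in>Ss. 1) \<le> (\<Sum>S\<in>Ss. card (P \<inter> (S - G)))" by (rule sum_mono)
  then have cS: "card Ss \<le> card P" using sumP by simp
  have "N \<subseteq> (\<Union>S\<in>Ss. H \<inter> S)" by (auto simp: Ss_def N_def intro: span_base)
  then have "card N \<le> card (\<Union>S\<in>Ss. H \<inter> S)" using finS finP HP by (intro card_mono) (auto intro: finite_subset)
  also have "\<dots> \<le> (\<Sum>S\<in>Ss. card (H \<inter> S))" by (rule card_UN_le[OF finS])
  finally have "rcard N \<le> (\<Sum>S\<in>Ss. rcard (H \<inter> S))" by (metis of_nat_le_iff of_nat_sum)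
  also have "\<dots> \<le> (\<Sum>S\<in>Ss. \<eta> * (rcard (P \<inter> (S - G)) + w))"
  proof (rule sum_mono)
    fix S assume "S \<in> Ss"
    then have "rcard (H \<inter> S) \<le> \<eta> * rcard (P \<inter> S)" by (auto simp: Ss_def N_def)
    also have "\<dots> \<le> \<eta> * (rcard (P \<inter> (S - G)) + w)" by (rule mult_left_mono[OF card_split \<eta>])
    finally show "rcard (H \<inter> S) \<le> \<eta> * (rcard (P \<inter> (S - G)) + w)" .
  qed
  also have "\<dots> = \<eta> * (real (\<Sum>S\<in>Ss. card (P \<inter> (S - G))) + rcard Ss * w)"
    by (simp add: sum_distrib_left[symmetric] sum.distrib)
  also have "\<dots> \<le> \<eta> * (rcard P + rcard P * w)"
    using cS w \<eta> of_nat_mono[OF sumP, where 'a=real] by (intro mult_left_mono add_mono mult_right_mono) simp_all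
  finally show ?thesis by (simp add: N_def algebra_simps)
qed

text \<open>The planar core of Beck's theorem, in the quotient by \<open>F\<close>. \<open>B\<close>
  caps the richest lines; the threshold \<open>w * K / \<eta>\<close> is what leaves
  \<open>K\<close> representatives on a line on which an \<eta>-fraction of the points belongs to
  \<open>H\<close>.\<close>

lemma rich_pairs_bound:
  fixes P F H :: "'a::euclidean_space set"
  assumes finP: "finite P" and F: "subspace F" and HP: "H \<subseteq> P" and HF: "H \<inter> F = {}" and w: "w \<ge> 1"
    and light: "\<And>p. p \<in> H \<Longrightarrow> rcard (P \<inter> span (insert p F)) \<le> w"
    and poor: "\<And>p q. p \<in> H \<Longrightarrow> q \<in> H \<Longrightarrow> rcard (P \<inter> span (insert q (insert p F))) \<le> B"
    and B: "B \<ge> 0" and \<eta>: "\<eta> > 0" and K: "K \<ge> 2"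
  shows "rcard {(q, p) \<in> H \<times> H. q \<in> span (insert p F) \<or>
             w * K / \<eta> < rcard (P \<inter> span (insert q (insert p F)))}
     \<le> rcard P * w + rcard P * (\<eta> * (1 + w) * rcard P)
       + w ^ 2 * (18432 * (rcard P ^ 2 / K + rcard P * B))"
proof -
  define m where "m = rcard P"
  define S where "S q p = span (insert q (insert p F))" for q p
  have finH: "finite H" using finP HP finite_subset by blast
  have mH: "rcard H \<le> m" unfolding m_def using card_mono[OF finP HP] by simp
  have Sspan: "S q p = span (insert q (span (insert p F)))" for q p by (simp add: S_def)
  \<comment> \<open>On a line \<open>S q p\<close> of the quotient the light points \<open>H\<close> are either rare (\<open>A2\<close>), and then there are few
    choices of \<open>q\<close> for a given \<open>p\<close>, or frequent (\<open>A3\<close>), and then Szemeredi-Trotter applies to them.\<close>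
  define A1 where "A1 = {(q, p) \<in> H \<times> H. q \<in> span (insert p F)}"
  define A2 where "A2 = {(q, p) \<in> H \<times> H. q \<notin> span (insert p F) \<and> rcard (H \<inter> S q p) < \<eta> * rcard (P \<inter> S q p)}"
  define A3 where "A3 = {(q, p) \<in> H \<times> H. q \<notin> span (insert p F) \<and> w * K / \<eta> < rcard (P \<inter> S q p) \<and>
     \<eta> * rcard (P \<inter> S q p) \<le> rcard (H \<inter> S q p)}"
  have c1: "rcard A1 \<le> m * w"
  proof (rule card_pairs_le[OF finH _ _ mH])
    fix p assume p: "p \<in> H"
    have "{q. (q, p) \<in> A1} \<subseteq> P \<inter> span (insert p F)" using HP by (auto simp: A1_def)
    then have "card {q. (q, p) \<in> A1} \<le> card (P \<inter> span (insert p F))" using finP by (intro card_mono) auto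
    then show "rcard {q. (q, p) \<in> A1} \<le> w" using light[OF p] by linarith
  qed (use w in \<open>auto simp: A1_def\<close>)
  have c2: "rcard A2 \<le> m * (\<eta> * (1 + w) * m)"
  proof (rule card_pairs_le[OF finH _ _ mH])
    fix p assume p: "p \<in> H"
    have "{q. (q, p) \<in> A2} = {q \<in> H. q \<notin> span (insert p F) \<and>
        rcard (H \<inter> span (insert q (span (insert p F)))) < \<eta> * rcard (P \<inter> span (insert q (span (insert p F))))}"
      using p by (auto simp: A2_def Sspan)
    then show "rcard {q. (q, p) \<in> A2} \<le> \<eta> * (1 + w) * m"
      using sparse_partners[OF finP subspace_span HP light[OF p], of \<eta>] \<eta> w by (simp add: m_def)
  qed (use w \<eta> in \<open>auto simp: A2_def m_def\<close>)
  obtain X where X: "X \<subseteq> H" "\<And>a b. a \<in> X \<Longrightarrow> b \<in> X \<Longrightarrow> a \<noteq> b \<Longrightarrow> b \<notin> span (insert a F)"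
    "\<And>p. p \<in> H \<Longrightarrow> \<exists>x\<in>X. p \<in> span (insert x F)"
    using representatives[OF F finH HF] by blast
  define L where "L = (\<lambda>(q, p). S q p) ` A3"
  have finA3: "finite A3" by (rule finite_subset[of _ "H \<times> H"]) (use finH in \<open>auto simp: A3_def\<close>)
  have finX: "finite X" using X(1) finH finite_subset by blast
  have LS: "subspace T \<and> F \<subseteq> T \<and> dim T \<le> dim F + 2" if T: "T \<in> L" for T
  proof -
    obtain q p where qp: "T = S q p" using T by (auto simp: L_def)
    have "F \<subseteq> T" unfolding qp S_def by (meson span_superset subset_insertI subset_trans)
    moreover have "dim T \<le> dim F + 2" unfolding qp S_def by (simp add: dim_insert)
    ultimately show ?thesis unfolding qp S_def by simp
  qed
  have HX: "rcard (H \<inter> T) \<le> w * rcard (X \<inter> T)" if T: "T \<in> L" for T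
    by (rule card_le_representatives[OF finP F HP HF X(1) X(3) light]) (use LS[OF T] in auto)
  have "(\<Sum>T\<in>L. rcard (X \<inter> T) ^ 2) \<le> 18432 * (rcard X ^ 2 / K + rcard X * B)"
  proof (rule st_second_moment[OF F finX _ _ _ K])
    show "b \<notin> span (insert a F)" if "a \<in> X" "b \<in> X" "a \<noteq> b" for a b using X(2) that by blast
    show "X \<inter> F = {}" using X(1) HF by blast
    show "finite L" using finA3 by (simp add: L_def)
    show "K \<le> rcard (X \<inter> T)" if T: "T \<in> L" for T
    proof -
      have "w * K / \<eta> < rcard (P \<inter> T)" "\<eta> * rcard (P \<inter> T) \<le> rcard (H \<inter> T)"
        using T by (auto simp: L_def A3_def)
      then have "w * K < rcard (H \<inter> T)" using \<eta> by (simp add: field_simps)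
      then have "w * K < w * rcard (X \<inter> T)" using HX[OF T] by linarith
      then show ?thesis using w by simp
    qed
    show "T = span (insert a (insert b F))"
      if T: "T \<in> L" "a \<in> X \<inter> T" "b \<in> X \<inter> T" "a \<noteq> b" for T a b
      using LS[OF T(1)] T X HF by (intro span_two_eq[OF F]) auto
    show "rcard (X \<inter> T) \<le> B" if T: "T \<in> L" for T
    proof -
      obtain q p where qp: "q \<in> H" "p \<in> H" "T = S q p" using T by (auto simp: L_def A3_def)
      have "card (X \<inter> T) \<le> card (P \<inter> T)" using X(1) HP finP by (intro card_mono) auto
      then show ?thesis using poor[OF qp(2,1)] unfolding qp(3) S_def by linarith
    qed
  qed (fact B)
  moreover have "rcard X \<le> m" unfolding m_def using X(1) HP finP by (simp add: card_mono)
  then have "18432 * (rcard X ^ 2 / K + rcard X * B) \<le> 18432 * (m ^ 2 / K + m * B)"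
    using K B by (intro mult_left_mono add_mono divide_right_mono mult_right_mono power_mono) auto
  ultimately have sX: "(\<Sum>T\<in>L. rcard (X \<inter> T) ^ 2) \<le> 18432 * (m ^ 2 / K + m * B)" by linarith
  have "A3 \<subseteq> (\<Union>T\<in>L. (H \<inter> T) \<times> (H \<inter> T))"
  proof
    fix x assume x: "x \<in> A3"
    then obtain q p where qp: "x = (q, p)" "q \<in> H" "p \<in> H" by (auto simp: A3_def)
    have "S q p \<in> L" using x qp by (force simp: L_def)
    moreover have "q \<in> S q p" "p \<in> S q p" by (auto simp: S_def intro: span_base)
    ultimately show "x \<in> (\<Union>T\<in>L. (H \<inter> T) \<times> (H \<inter> T))" using qp by blast
  qed
  then have "card A3 \<le> card (\<Union>T\<in>L. (H \<inter> T) \<times> (H \<inter> T))"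
    using finA3 finH by (intro card_mono) (auto simp: L_def)
  also have "\<dots> \<le> (\<Sum>T\<in>L. card ((H \<inter> T) \<times> (H \<inter> T)))" by (rule card_UN_le) (use finA3 in \<open>simp add: L_def\<close>)
  finally have "rcard A3 \<le> real (\<Sum>T\<in>L. card ((H \<inter> T) \<times> (H \<inter> T)))" by (simp only: of_nat_le_iff)
  also have "\<dots> = (\<Sum>T\<in>L. rcard (H \<inter> T) ^ 2)" by (simp add: card_cartesian_product power2_eq_square)
  also have "\<dots> \<le> (\<Sum>T\<in>L. (w * rcard (X \<inter> T)) ^ 2)"
    by (intro sum_mono power_mono HX) auto
  also have "\<dots> = w ^ 2 * (\<Sum>T\<in>L. rcard (X \<inter> T) ^ 2)" by (simp add: power_mult_distrib sum_distrib_left)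
  also have "\<dots> \<le> w ^ 2 * (18432 * (m ^ 2 / K + m * B))" using sX by (intro mult_left_mono) auto
  finally have c3: "rcard A3 \<le> w ^ 2 * (18432 * (m ^ 2 / K + m * B))" .
  let ?A = "{(q, p) \<in> H \<times> H. q \<in> span (insert p F) \<or> w * K / \<eta> < rcard (P \<inter> span (insert q (insert p F)))}"
  have "?A \<subseteq> A1 \<union> A2 \<union> A3" by (auto simp: A1_def A2_def A3_def S_def)
  moreover have "finite (A1 \<union> A2 \<union> A3)"
    by (rule finite_subset[of _ "H \<times> H"]) (use finH in \<open>auto simp: A1_def A2_def A3_def\<close>)
  ultimately have "card ?A \<le> card (A1 \<union> A2 \<union> A3)" by (simp add: card_mono)
  also have "\<dots> \<le> card A1 + card A2 + card A3" by (meson add_le_mono card_Un_le le_refl le_trans)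
  finally have "rcard ?A \<le> rcard A1 + rcard A2 + rcard A3" by linarith
  then show ?thesis using c1 c2 c3 unfolding m_def by linarith
qed


section \<open>Tuples of points and Beck's theorem\<close>

definition tuples :: "'a set \<Rightarrow> nat \<Rightarrow> 'a list set" where
  "tuples P k = {xs. set xs \<subseteq> P \<and> length xs = k}"

lemma finite_tuples: "finite P \<Longrightarrow> finite (tuples P k)"
  by (simp add: tuples_def finite_lists_length_eq)

lemma card_tuples: "finite P \<Longrightarrow> card (tuples P k) = card P ^ k"
  by (simp add: tuples_def card_lists_length_eq)

text \<open>Tuples are lists with repetition allowed, so that there are exactly
  \<open>|P| ^ k\<close> of them and failure can be measured as a fraction; dependent tuples simply
  count as failures.\<close>

definition good :: "'a::euclidean_space set \<Rightarrow> real \<Rightarrow> 'a list \<Rightarrow> bool" where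
  "good P w xs \<longleftrightarrow> dim (set xs) = length xs \<and> rcard (P \<inter> span (set xs)) \<le> w"

lemma dim_set_le: "dim (set xs) \<le> length xs" for xs :: "'a::euclidean_space list"
  by (meson card_length dim_le_card' finite_set le_trans)

lemma good_Cons:
  fixes p :: "'a::euclidean_space"
  assumes "good P w (p # ys)"
  shows "dim (set ys) = length ys" "p \<notin> span (set ys)"
    "rcard (P \<inter> span (insert p (span (set ys)))) \<le> w"
proof -
  have "dim (insert p (set ys)) = Suc (length ys)" using assms by (simp add: good_def)
  then show "dim (set ys) = length ys" "p \<notin> span (set ys)"
    using dim_set_le[of ys] by (auto simp: dim_insert split: if_splits)
  show "rcard (P \<inter> span (insert p (span (set ys)))) \<le> w" using assms by (simp add: good_def)
qed

definition spread :: "nat \<Rightarrow> real \<Rightarrow> 'a::euclidean_space set \<Rightarrow> bool" where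
  "spread k \<beta> P \<longleftrightarrow> (\<forall>U. subspace U \<and> dim U \<le> k \<longrightarrow> rcard (P \<inter> U) \<le> \<beta> * rcard P)"

lemma spread_mono:
  assumes "spread k \<beta> P" "k' \<le> k" "\<beta> \<le> \<beta>'"
  shows "spread k' \<beta>' P"
  unfolding spread_def
proof (intro allI impI)
  fix U :: "'a set" assume "subspace U \<and> dim U \<le> k'"
  then have "rcard (P \<inter> U) \<le> \<beta> * rcard P" using assms by (auto simp: spread_def)
  also have "\<dots> \<le> \<beta>' * rcard P" using assms(3) by (simp add: mult_right_mono)
  finally show "rcard (P \<inter> U) \<le> \<beta>' * rcard P" .
qed

text \<open>The line through a single point already tests \<open>spread\<close>. The inequality
  absorbs terms of lower order in \<open>|P|\<close> and forces a lower bound on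
  \<open>|P|\<close>.\<close>

lemma spread_card_ge:
  assumes "spread k \<beta> P" "k \<ge> 1" "finite P" "P \<noteq> {}"
  shows "1 \<le> \<beta> * rcard P"
proof -
  obtain p where p: "p \<in> P" using assms by blast
  have "dim (span {p}) \<le> 1" by simp
  then have "rcard (P \<inter> span {p}) \<le> \<beta> * rcard P"
    using assms(1,2) unfolding spread_def by (meson le_trans subspace_span)
  moreover have "p \<in> P \<inter> span {p}" using p by (simp add: span_base)
  then have "card (P \<inter> span {p}) \<ge> 1" using assms(3) by (metis One_nat_def Suc_leI card_gt_0_iff empty_iff finite_Int)
  ultimately show ?thesis by linarith
qed

text \<open>A failing tuple \<open>q # p # ys\<close> either still fails after omission of
  \<open>q\<close> or of \<open>p\<close>, whence \<open>2 * \<delta>\<close>, or \<open>p\<close>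
  and \<open>q\<close> are light over the span of \<open>ys\<close> and form a bad pair in the
  quotient by it.\<close>

lemma beck_step:
  fixes P :: "'a::euclidean_space set"
  assumes finP: "finite P" and P: "P \<noteq> {}" and \<delta>: "\<delta> \<ge> 0" and w: "w \<ge> 1" and \<eta>: "\<eta> > 0" and K: "K \<ge> 2"
    and \<beta>: "\<beta> > 0" and sp: "spread (k + 2) \<beta> P"
    and IH: "rcard {xs \<in> tuples P (Suc k). \<not> good P w xs} \<le> \<delta> * rcard P ^ Suc k"
  shows "rcard {xs \<in> tuples P (Suc (Suc k)). \<not> good P (w * K / \<eta>) xs}
     \<le> (2 * \<delta> + w * \<beta> + \<eta> * (1 + w) + 18432 * w ^ 2 * (1 / K + \<beta>)) * rcard P ^ Suc (Suc k)"
proof -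
  define m where "m = rcard P"
  define Bad where "Bad = {xs \<in> tuples P (Suc k). \<not> good P w xs}"
  define H where "H ys = {p \<in> P. good P w (p # ys)}" for ys
  define A where "A ys = {(q, p) \<in> H ys \<times> H ys. q \<in> span (insert p (span (set ys))) \<or>
     w * K / \<eta> < rcard (P \<inter> span (insert q (insert p (span (set ys)))))}" for ys
  have m: "m > 0" using finP P by (simp add: m_def card_gt_0_iff)
  have bm: "1 \<le> \<beta> * m" using spread_card_ge[OF sp _ finP P] by (simp add: m_def)
  define D1 where "D1 = (\<lambda>(q, zs). q # zs) ` (P \<times> Bad)"
  define D2 where "D2 = (\<lambda>(p, zs). hd zs # p # tl zs) ` (P \<times> Bad)"
  define D3 where "D3 = (\<Union>ys\<in>tuples P k. (\<lambda>(q, p). q # p # ys) ` A ys)"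
  have finB: "finite Bad" using finite_tuples[OF finP] by (simp add: Bad_def)
  have cPB: "rcard (P \<times> Bad) \<le> \<delta> * m ^ Suc (Suc k)"
    using IH m mult_left_mono[of "rcard Bad" "\<delta> * m ^ Suc k" m]
    by (simp add: card_cartesian_product m_def Bad_def mult_ac)
  have finPB: "finite (P \<times> Bad)" using finP finB by simp
  have "card D1 \<le> card (P \<times> Bad)" "card D2 \<le> card (P \<times> Bad)"
    unfolding D1_def D2_def by (rule card_image_le[OF finPB])+
  then have d1: "rcard D1 \<le> \<delta> * m ^ Suc (Suc k)" and d2: "rcard D2 \<le> \<delta> * m ^ Suc (Suc k)"
    using cPB by linarith+
  define c where "c = w * \<beta> + \<eta> * (1 + w) + 18432 * w ^ 2 * (1 / K + \<beta>)"
  have finA: "finite (A ys)" for ys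
    by (rule finite_subset[of _ "P \<times> P"]) (use finP in \<open>auto simp: A_def H_def\<close>)
  have cA: "rcard (A ys) \<le> c * m ^ 2" if ys: "ys \<in> tuples P k" for ys
  proof -
    have "rcard (A ys) \<le> m * w + m * (\<eta> * (1 + w) * m) + w ^ 2 * (18432 * (m ^ 2 / K + m * (\<beta> * m)))"
      unfolding A_def m_def
    proof (rule rich_pairs_bound[OF finP subspace_span _ _ w _ _ _ \<eta> K])
      show "H ys \<subseteq> P" "H ys \<inter> span (set ys) = {}" by (auto simp: H_def dest: good_Cons)
      show "rcard (P \<inter> span (insert p (span (set ys)))) \<le> w" if "p \<in> H ys" for p
        using that good_Cons(3)[of P w p ys] by (simp add: H_def)
      show "0 \<le> \<beta> * rcard P" using \<beta> by simp
      fix p q assume "p \<in> H ys" "q \<in> H ys"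
      have "dim (insert q (insert p (set ys))) \<le> k + 2"
        using dim_set_le[of ys] ys by (simp add: dim_insert tuples_def)
      then have "dim (span (insert q (insert p (span (set ys))))) \<le> k + 2"
        by (simp add: span_insert2_span)
      then show "rcard (P \<inter> span (insert q (insert p (span (set ys))))) \<le> \<beta> * rcard P"
        using sp subspace_span unfolding spread_def by blast
    qed
    \<comment> \<open>The term \<open>m * w\<close> is linear in \<open>m\<close>;
      \<open>1 \<le> \<beta> * m\<close> makes it quadratic with a small factor.\<close>
    also have "\<dots> \<le> (\<beta> * m) * (m * w) + m * (\<eta> * (1 + w) * m) + w ^ 2 * (18432 * (m ^ 2 / K + m * (\<beta> * m)))"
      using mult_right_mono[OF bm, of "m * w"] m w by simp
    also have "\<dots> = c * m ^ 2" using K by (simp add: c_def field_simps power2_eq_square)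
    finally show ?thesis .
  qed
  have "card D3 \<le> (\<Sum>ys\<in>tuples P k. card ((\<lambda>(q, p). q # p # ys) ` A ys))"
    unfolding D3_def by (rule card_UN_le[OF finite_tuples[OF finP]])
  also have "\<dots> \<le> (\<Sum>ys\<in>tuples P k. card (A ys))" by (intro sum_mono card_image_le finA)
  finally have "rcard D3 \<le> (\<Sum>ys\<in>tuples P k. rcard (A ys))" by (metis of_nat_le_iff of_nat_sum)
  also have "\<dots> \<le> (\<Sum>ys\<in>tuples P k. c * m ^ 2)" by (rule sum_mono) (rule cA)
  also have "\<dots> = c * m ^ Suc (Suc k)" using finP by (simp add: card_tuples m_def power2_eq_square)
  finally have d3: "rcard D3 \<le> c * m ^ Suc (Suc k)" .
  have "{xs \<in> tuples P (Suc (Suc k)). \<not> good P (w * K / \<eta>) xs} \<subseteq> D1 \<union> D2 \<union> D3"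
  proof
    fix xs assume xs: "xs \<in> {xs \<in> tuples P (Suc (Suc k)). \<not> good P (w * K / \<eta>) xs}"
    then obtain q p ys where e: "xs = q # p # ys" and ys: "ys \<in> tuples P k" and qp: "q \<in> P" "p \<in> P"
      by (auto simp: tuples_def length_Suc_conv)
    consider "\<not> good P w (p # ys)" | "\<not> good P w (q # ys)" | "good P w (p # ys)" "good P w (q # ys)" by blast
    then show "xs \<in> D1 \<union> D2 \<union> D3"
    proof cases
      case 1
      then have "p # ys \<in> Bad" using ys qp by (simp add: Bad_def tuples_def)
      then have "xs \<in> D1" using qp unfolding D1_def e by (intro image_eqI[of _ _ "(q, p # ys)"]) auto
      then show ?thesis by simp
    next
      case 2
      then have "q # ys \<in> Bad" using ys qp by (simp add: Bad_def tuples_def)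
      then have "xs \<in> D2" using qp unfolding D2_def e by (intro image_eqI[of _ _ "(p, q # ys)"]) auto
      then show ?thesis by simp
    next
      case 3
      have "(q, p) \<in> A ys"
      proof (cases "q \<in> span (insert p (set ys))")
        case True
        then show ?thesis using 3 qp by (simp add: A_def H_def)
      next
        case False
        have "dim (set (p # ys)) = Suc (length ys)" using 3 by (simp add: good_def)
        then have "dim (set xs) = length xs" using False by (simp add: e dim_insert)
        then have "w * K / \<eta> < rcard (P \<inter> span (insert q (insert p (set ys))))"
          using xs by (simp add: good_def e)
        then show ?thesis using 3 qp by (simp add: A_def H_def span_insert2_span)
      qed
      then have "xs \<in> D3" using ys unfolding D3_def e by force
      then show ?thesis by simp
    qed
  qed
  moreover have "finite (D1 \<union> D2 \<union> D3)"
    using finP finB finA finite_tuples[OF finP] by (simp add: D1_def D2_def D3_def)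
  ultimately have "card {xs \<in> tuples P (Suc (Suc k)). \<not> good P (w * K / \<eta>) xs} \<le> card (D1 \<union> D2 \<union> D3)"
    by (simp add: card_mono)
  also have "\<dots> \<le> card D1 + card D2 + card D3" by (meson add_le_mono card_Un_le le_refl le_trans)
  finally have "rcard {xs \<in> tuples P (Suc (Suc k)). \<not> good P (w * K / \<eta>) xs}
      \<le> \<delta> * m ^ Suc (Suc k) + \<delta> * m ^ Suc (Suc k) + c * m ^ Suc (Suc k)"
    using d1 d2 d3 by linarith
  also have "\<dots> = (2 * \<delta> + w * \<beta> + \<eta> * (1 + w) + 18432 * w ^ 2 * (1 / K + \<beta>)) * m ^ Suc (Suc k)"
    unfolding c_def by (simp add: distrib_right)
  finally show ?thesis by (simp add: m_def)
qed

text \<open>Induction on the length of the tuples. The base case is the simplicity of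
  \<open>P\<close>: one vector spans a line without further points, so nothing fails.\<close>

theorem beck:
  assumes "\<delta> > 0"
  shows "\<exists>\<beta> w. \<beta> > 0 \<and> w \<ge> 1 \<and> (\<forall>P :: 'a::euclidean_space set.
     finite P \<longrightarrow> P \<noteq> {} \<longrightarrow> simple P \<longrightarrow> spread (Suc k) \<beta> P \<longrightarrow>
       rcard {xs \<in> tuples P (Suc k). \<not> good P w xs} \<le> \<delta> * rcard P ^ Suc k)"
  using assms
proof (induction k arbitrary: \<delta>)
  case 0
  have "rcard {xs \<in> tuples P (Suc 0). \<not> good P 1 xs} \<le> \<delta> * rcard P ^ Suc 0"
    if P: "finite P" "simple P" for P :: "'a set"
  proof -
    have "good P 1 xs" if xs: "xs \<in> tuples P (Suc 0)" for xs
    proof -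
      obtain p where p: "xs = [p]" "p \<in> P" using xs by (auto simp: tuples_def length_Suc_conv)
      then have "p \<noteq> 0" using P(2) by (auto simp: simple_def)
      then show ?thesis using p P(2) by (simp add: good_def simple_card_span)
    qed
    then have e: "{xs \<in> tuples P (Suc 0). \<not> good P 1 xs} = {}" by blast
    show ?thesis using 0 unfolding e by simp
  qed
  then show ?case by (intro exI[of _ 1]) auto
next
  case (Suc k)
  have "\<delta> / 4 > 0" using Suc.prems by simp
  then obtain \<beta>' w where IH: "\<beta>' > 0" "w \<ge> 1" "\<And>P :: 'a set.
     finite P \<Longrightarrow> P \<noteq> {} \<Longrightarrow> simple P \<Longrightarrow> spread (Suc k) \<beta>' P \<Longrightarrow>
       rcard {xs \<in> tuples P (Suc k). \<not> good P w xs} \<le> \<delta> / 4 * rcard P ^ Suc k"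
    using Suc.IH by blast
  \<comment> \<open>Half of \<open>\<delta>\<close> goes to the two shorter tuples. The parameters
    are chosen after \<open>w\<close>, so that \<open>\<eta>\<close>, \<open>K\<close> and
    \<open>\<beta>\<close> each keep their terms below \<open>\<delta> / 8\<close>.\<close>
  define \<eta> where "\<eta> = \<delta> / (8 * (1 + w))"
  define K where "K = max 2 (8 * 18432 * w ^ 2 / \<delta>)"
  define \<beta> where "\<beta> = min \<beta>' (\<delta> / (8 * (w + 18432 * w ^ 2)))"
  have w2: "w + 18432 * w ^ 2 > 0" using IH(2) by (simp add: add_pos_pos)
  have \<eta>: "\<eta> > 0" and K: "K \<ge> 2" and \<beta>: "\<beta> > 0" "\<beta> \<le> \<beta>'"
    using Suc.prems IH w2 by (auto simp: \<eta>_def K_def \<beta>_def)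
  have e1: "\<eta> * (1 + w) = \<delta> / 8" unfolding \<eta>_def using IH(2) by (simp add: field_simps)
  have "8 * 18432 * w ^ 2 / \<delta> \<le> K" unfolding K_def by (rule max.cobounded2)
  then have e2: "18432 * w ^ 2 * (1 / K) \<le> \<delta> / 8" using Suc.prems K by (simp add: field_simps)
  have "\<beta> \<le> \<delta> / (8 * (w + 18432 * w ^ 2))" unfolding \<beta>_def by (rule min.cobounded2)
  then have "\<beta> * (8 * (w + 18432 * w ^ 2)) \<le> \<delta>" using w2 by (simp add: pos_le_divide_eq)
  then have e3: "w * \<beta> + 18432 * w ^ 2 * \<beta> \<le> \<delta> / 8" by (simp add: algebra_simps)
  have tot: "2 * (\<delta> / 4) + w * \<beta> + \<eta> * (1 + w) + 18432 * w ^ 2 * (1 / K + \<beta>) \<le> \<delta>"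
    using e1 e2 e3 Suc.prems by (simp add: distrib_left)
  have "rcard {xs \<in> tuples P (Suc (Suc k)). \<not> good P (max 1 (w * K / \<eta>)) xs} \<le> \<delta> * rcard P ^ Suc (Suc k)"
    if P: "finite P" "P \<noteq> {}" "simple P" "spread (Suc (Suc k)) \<beta> P" for P :: "'a set"
  proof -
    have sp: "spread (k + 2) \<beta> P" using P(4) by simp
    have "spread (Suc k) \<beta>' P" by (rule spread_mono[OF P(4)]) (use \<beta> in auto)
    note b = beck_step[OF P(1,2) _ IH(2) \<eta> K \<beta>(1) sp IH(3)[OF P(1-3) this]]
    have "card {xs \<in> tuples P (Suc (Suc k)). \<not> good P (max 1 (w * K / \<eta>)) xs}
       \<le> card {xs \<in> tuples P (Suc (Suc k)). \<not> good P (w * K / \<eta>) xs}"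
      using finite_tuples[OF P(1)] by (intro card_mono) (auto simp: good_def)
    then have "rcard {xs \<in> tuples P (Suc (Suc k)). \<not> good P (max 1 (w * K / \<eta>)) xs}
       \<le> (2 * (\<delta> / 4) + w * \<beta> + \<eta> * (1 + w) + 18432 * w ^ 2 * (1 / K + \<beta>)) * rcard P ^ Suc (Suc k)"
      using b Suc.prems by linarith
    also have "\<dots> \<le> \<delta> * rcard P ^ Suc (Suc k)" using tot by (intro mult_right_mono) auto
    finally show ?thesis .
  qed
  then show ?case using \<beta>(1) by (intro exI[of _ \<beta>] exI[of _ "max 1 (w * K / \<eta>)"]) auto
qed


text \<open>Non-degeneracy in the sense of Elekes and Toth. Note that \<open>nondeg k \<beta> P S\<close> is meant for \<open>dim S = k\<close>,
  and that for \<open>k \<ge> 2\<close> and \<open>P \<inter> S \<noteq> {}\<close> it forces at least \<open>1 / \<beta>\<close> points on \<open>S\<close>.\<close>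

definition nondeg :: "nat \<Rightarrow> real \<Rightarrow> 'a::euclidean_space set \<Rightarrow> 'a set \<Rightarrow> bool" where
  "nondeg k \<beta> P S \<longleftrightarrow>
     (\<forall>U. subspace U \<and> dim U < k \<longrightarrow> rcard (P \<inter> S \<inter> U) \<le> \<beta> * rcard (P \<inter> S))"

lemma nondeg_mono:
  assumes "nondeg k \<beta> P S" "\<beta> \<le> \<beta>'"
  shows "nondeg k \<beta>' P S"
  unfolding nondeg_def
proof (intro allI impI)
  fix U :: "'a set" assume "subspace U \<and> dim U < k"
  then have "rcard (P \<inter> S \<inter> U) \<le> \<beta> * rcard (P \<inter> S)" using assms(1) by (simp add: nondeg_def)
  also have "\<dots> \<le> \<beta>' * rcard (P \<inter> S)" using assms(2) by (simp add: mult_right_mono)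
  finally show "rcard (P \<inter> S \<inter> U) \<le> \<beta>' * rcard (P \<inter> S)" .
qed

section \<open>Counting non-degenerate rich subspaces\<close>

definition rich_tuples :: "'a::euclidean_space set \<Rightarrow> real \<Rightarrow> nat \<Rightarrow> 'a set \<Rightarrow> 'a list set" where
  "rich_tuples P w j S = {ys \<in> tuples (P \<inter> S) j.
     rcard (P \<inter> S) / 2 \<le> rcard {p \<in> P \<inter> S. good (P \<inter> S) w (p # ys)}}"

text \<open>At least three quarters of the \<open>(j + 1)\<close>-tuples are good. Those that extend
  a \<open>j\<close>-tuple with fewer than half of the points as good extensions make up at most one
  half, so a quarter of the \<open>j\<close>-tuples must be rich.\<close>

lemma many_rich_tuples:
  fixes P S :: "'a::euclidean_space set"
  assumes fin: "finite P" and m: "rcard (P \<inter> S) > 0"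
    and b: "rcard {xs \<in> tuples (P \<inter> S) (Suc j). \<not> good (P \<inter> S) w xs} \<le> 1 / 4 * rcard (P \<inter> S) ^ Suc j"
  shows "rcard (P \<inter> S) ^ j / 4 \<le> rcard (rich_tuples P w j S)"
proof -
  define R where "R = P \<inter> S"
  define m where "m = rcard R"
  define G where "G ys = {p \<in> R. good R w (p # ys)}" for ys
  have finR: "finite R" using fin by (simp add: R_def)
  have m0: "m > 0" using m by (simp add: m_def R_def)
  have cT: "rcard (tuples R i) = m ^ i" for i using finR by (simp add: card_tuples m_def)
  let ?A = "{xs \<in> tuples R (Suc j). good R w xs}"
  have "tuples R (Suc j) = ?A \<union> {xs \<in> tuples R (Suc j). \<not> good R w xs}" by blast
  then have "card (tuples R (Suc j)) \<le> card ?A + card {xs \<in> tuples R (Suc j). \<not> good R w xs}"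
    by (metis (no_types, lifting) card_Un_le)
  then have c0: "m ^ Suc j \<le> rcard ?A + 1 / 4 * m ^ Suc j"
    using b cT[of "Suc j"] by (simp add: m_def R_def)
  have sub: "?A \<subseteq> (\<Union>ys\<in>tuples R j. (\<lambda>p. p # ys) ` G ys)"
  proof
    fix xs assume "xs \<in> ?A"
    then obtain p ys where "xs = p # ys" "ys \<in> tuples R j" "p \<in> G ys"
      by (auto simp: tuples_def length_Suc_conv G_def)
    then show "xs \<in> (\<Union>ys\<in>tuples R j. (\<lambda>p. p # ys) ` G ys)" by blast
  qed
  have "finite (\<Union>ys\<in>tuples R j. (\<lambda>p. p # ys) ` G ys)"
    using finR finite_tuples[OF finR] by (simp add: G_def)
  then have "card ?A \<le> card (\<Union>ys\<in>tuples R j. (\<lambda>p. p # ys) ` G ys)"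
    using sub by (rule card_mono)
  then have "card ?A \<le> (\<Sum>ys\<in>tuples R j. card ((\<lambda>p. p # ys) ` G ys))"
    using card_UN_le[OF finite_tuples[OF finR]] le_trans by blast
  also have "\<dots> \<le> (\<Sum>ys\<in>tuples R j. card (G ys))"
    using finR by (intro sum_mono card_image_le) (auto simp: G_def)
  finally have "rcard ?A \<le> real (\<Sum>ys\<in>tuples R j. card (G ys))" by (simp only: of_nat_le_iff)
  also have "\<dots> = (\<Sum>ys\<in>tuples R j. rcard (G ys))" by (rule of_nat_sum)
  also have "\<dots> \<le> (\<Sum>ys\<in>tuples R j. m / 2 + (if m / 2 \<le> rcard (G ys) then m else 0))"
  proof (rule sum_mono)
    fix ys
    have "card (G ys) \<le> card R" using finR by (intro card_mono) (auto simp: G_def)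
    then have "rcard (G ys) \<le> m" by (simp add: m_def)
    then show "rcard (G ys) \<le> m / 2 + (if m / 2 \<le> rcard (G ys) then m else 0)" using m0 by auto
  qed
  also have "\<dots> = m ^ j * (m / 2) + m * rcard {ys \<in> tuples R j. m / 2 \<le> rcard (G ys)}"
    using finite_tuples[OF finR] cT[of j] by (simp add: sum.distrib sum.If_cases Int_def mult.commute)
  finally have "rcard ?A \<le> m ^ j * (m / 2) + m * rcard (rich_tuples P w j S)"
    by (simp add: rich_tuples_def R_def m_def G_def)
  with c0 have "m ^ Suc j \<le> m ^ j * (m / 2) + m * rcard (rich_tuples P w j S) + 1 / 4 * m ^ Suc j"
    by linarith
  then have "m * (m ^ j / 4) \<le> m * rcard (rich_tuples P w j S)" by (simp add: algebra_simps)
  then show ?thesis using m0 by (simp add: m_def R_def)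
qed

text \<open>Modulo the span of \<open>ys\<close> the subspaces become lines. Half of the points of
  each extend \<open>ys\<close> to a good tuple, hence are light and give at least
  \<open>r / (2 * w)\<close> points of the quotient, to which Szemeredi and Trotter apply.\<close>

lemma few_subspaces_through:
  fixes P :: "'a::euclidean_space set"
  assumes fin: "finite P" and w: "w \<ge> 1" and r: "r > 0" and ys: "ys \<in> tuples P j" and finL: "finite L"
    and L: "\<And>S. S \<in> L \<Longrightarrow> subspace S \<and> dim S = j + 2 \<and> r \<le> rcard (P \<inter> S) \<and>
      8 * w \<le> rcard (P \<inter> S) \<and> ys \<in> rich_tuples P w j S"
  shows "rcard L \<le> 18432 * w ^ 3 * (rcard P ^ 2 / r ^ 3 + rcard P / r)"
proof -
  define F where "F = span (set ys)"
  define H where "H = {p \<in> P. good P w (p # ys)}"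
  \<comment> \<open>\<open>8 * w\<close> points on \<open>S\<close> give at least 4 representatives,
    so the maximum secures \<open>K \<ge> 2\<close> also for small \<open>r\<close>.\<close>
  define K where "K = max 4 (r / (2 * w))"
  have F: "subspace F" by (simp add: F_def)
  have HP: "H \<subseteq> P" and HF: "H \<inter> F = {}" by (auto simp: H_def F_def dest: good_Cons)
  have finH: "finite H" using HP fin finite_subset by blast
  obtain X where X: "X \<subseteq> H" "\<And>a b. a \<in> X \<Longrightarrow> b \<in> X \<Longrightarrow> a \<noteq> b \<Longrightarrow> b \<notin> span (insert a F)"
    "\<And>p. p \<in> H \<Longrightarrow> \<exists>x\<in>X. p \<in> span (insert x F)"
    using representatives[OF F finH HF] by blast
  have light: "rcard (P \<inter> span (insert p F)) \<le> w" if "p \<in> H" for p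
    using that good_Cons(3)[of P w p ys] by (simp add: H_def F_def)
  have FS: "F \<subseteq> S" if "S \<in> L" for S
    using L[OF that] unfolding F_def rich_tuples_def tuples_def by (intro span_minimal) auto
  have K: "K \<ge> 2" by (simp add: K_def)
  have "rcard L \<le> 2304 * (rcard X ^ 2 / K ^ 3 + rcard X / K)"
  proof (rule szemeredi_trotter_quotient[OF F _ _ _ finL K])
    show "finite X" using X(1) finH finite_subset by blast
    show "X \<inter> F = {}" using X(1) HF by blast
    show "b \<notin> span (insert a F)" if "a \<in> X" "b \<in> X" "a \<noteq> b" for a b using X(2) that by blast
    show "K \<le> rcard (X \<inter> S)" if S: "S \<in> L" for S
    proof -
      \<comment> \<open>The span of the tuple stays inside \<open>S\<close>, so goodness relative to
        \<open>P \<inter> S\<close> is goodness relative to \<open>P\<close>.\<close>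
      have "{p \<in> P \<inter> S. good (P \<inter> S) w (p # ys)} \<subseteq> H \<inter> S"
      proof
        fix p assume p: "p \<in> {p \<in> P \<inter> S. good (P \<inter> S) w (p # ys)}"
        have "set (p # ys) \<subseteq> S" using p L[OF S] by (auto simp: rich_tuples_def tuples_def)
        then have "span (set (p # ys)) \<subseteq> S" using L[OF S] by (intro span_minimal) auto
        then have "P \<inter> S \<inter> span (set (p # ys)) = P \<inter> span (set (p # ys))" by blast
        then show "p \<in> H \<inter> S" using p by (simp add: H_def good_def)
      qed
      then have "card {p \<in> P \<inter> S. good (P \<inter> S) w (p # ys)} \<le> card (H \<inter> S)"
        using finH by (intro card_mono) auto
      moreover have "rcard (P \<inter> S) / 2 \<le> rcard {p \<in> P \<inter> S. good (P \<inter> S) w (p # ys)}"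
        using L[OF S] by (simp add: rich_tuples_def)
      ultimately have "rcard (P \<inter> S) / 2 \<le> rcard (H \<inter> S)" by linarith
      also have "\<dots> \<le> w * rcard (X \<inter> S)"
        by (rule card_le_representatives[OF fin F HP HF X(1) X(3) light]) (use L[OF S] FS[OF S] in auto)
      finally have *: "rcard (P \<inter> S) \<le> 2 * w * rcard (X \<inter> S)" by simp
      have "2 * w * 4 \<le> 2 * w * rcard (X \<inter> S)" using * L[OF S] by linarith
      then have "4 \<le> rcard (X \<inter> S)" using w by simp
      moreover have "r \<le> 2 * w * rcard (X \<inter> S)" using * L[OF S] by linarith
      then have "r / (2 * w) \<le> rcard (X \<inter> S)" using w by (simp add: field_simps)
      ultimately show ?thesis by (simp add: K_def)
    qed
    show "S = span (insert a (insert b F))" if S: "S \<in> L" "a \<in> X \<inter> S" "b \<in> X \<inter> S" "a \<noteq> b" for S a b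
    proof (rule span_two_eq[OF F _ FS[OF S(1)]])
      have "good P w (a # ys)" using S(2) X(1) by (auto simp: H_def)
      then have "dim F = j" using good_Cons(1) ys by (fastforce simp: F_def tuples_def)
      then show "dim S \<le> dim F + 2" using L[OF S(1)] by simp
    qed (use S L[OF S(1)] X HF in auto)
  qed
  also have "\<dots> \<le> 2304 * (rcard P ^ 2 / (r / (2 * w)) ^ 3 + rcard P / (r / (2 * w)))"
  proof -
    have rw: "r / (2 * w) > 0" using r w by simp
    have rK: "r / (2 * w) \<le> K" by (simp add: K_def)
    have XP: "rcard X \<le> rcard P" using X(1) HP fin by (simp add: card_mono)
    show ?thesis using rw rK XP
      by (intro mult_left_mono add_mono frac_le power_mono) (auto simp: zero_less_power)
  qed
  also have "\<dots> = 18432 * (w ^ 3 * (rcard P ^ 2 / r ^ 3)) + 4608 * (w * (rcard P / r))"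
    using w r by (simp add: power_divide power_mult_distrib field_simps)
  also have "\<dots> \<le> 18432 * (w ^ 3 * (rcard P ^ 2 / r ^ 3)) + 18432 * (w ^ 3 * (rcard P / r))"
  proof -
    have "w ^ 1 \<le> w ^ 3" using w by (intro power_increasing) auto
    then have "w * (rcard P / r) \<le> w ^ 3 * (rcard P / r)" using r by (intro mult_right_mono) auto
    moreover have "0 \<le> w * (rcard P / r)" using r w by simp
    ultimately show ?thesis by (smt (verit))
  qed
  finally show ?thesis by (simp add: algebra_simps)
qed

text \<open>Pairs of a subspace \<open>S\<close> and a rich \<open>j\<close>-tuple of it are counted
  in two ways: each \<open>S\<close> has at least \<open>r ^ j / 4\<close> such tuples, and each of
  the \<open>|P| ^ j\<close> tuples is rich in \<open>O(|P| ^ 2 / r ^ 3 + |P| / r)\<close>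
  subspaces.\<close>

theorem elekes_toth:
  shows "\<exists>\<beta> C. \<beta> > 0 \<and> C > 0 \<and> (\<forall>(P :: 'a::euclidean_space set) r L. finite P \<longrightarrow> simple P \<longrightarrow> r > 0 \<longrightarrow> finite L \<longrightarrow>
     (\<forall>S\<in>L. subspace S \<and> dim S = j + 2 \<and> r \<le> rcard (P \<inter> S) \<and> nondeg (j + 2) \<beta> P S) \<longrightarrow>
     rcard L \<le> C * (rcard P ^ (j + 2) / r ^ (j + 3) + rcard P ^ (j + 1) / r ^ (j + 1)))"
proof -
  have "(1 / 4 :: real) > 0" by simp
  from beck[OF this, of j, where 'a='a] obtain \<beta>0 w where b: "\<beta>0 > 0" "w \<ge> 1" "\<And>P :: 'a set.
     finite P \<Longrightarrow> P \<noteq> {} \<Longrightarrow> simple P \<Longrightarrow> spread (Suc j) \<beta>0 P \<Longrightarrow>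
       rcard {xs \<in> tuples P (Suc j). \<not> good P w xs} \<le> 1 / 4 * rcard P ^ Suc j"
    by blast
  \<comment> \<open>The bound \<open>1 / (8 * w)\<close> forces \<open>8 * w\<close> points on every
    \<open>S\<close>, since a single point must not exceed a \<beta>-fraction.\<close>
  define \<beta> where "\<beta> = min \<beta>0 (1 / (8 * w))"
  define C where "C = 4 * (18432 * w ^ 3)"
  have \<beta>: "\<beta> > 0" "\<beta> \<le> \<beta>0" "\<beta> \<le> 1 / (8 * w)" using b by (auto simp: \<beta>_def)
  have "rcard L \<le> C * (rcard P ^ (j + 2) / r ^ (j + 3) + rcard P ^ (j + 1) / r ^ (j + 1))"
    if P: "finite P" "simple P" and r: "r > 0" and L: "finite L"
      "\<And>S. S \<in> L \<Longrightarrow> subspace S \<and> dim S = j + 2 \<and> r \<le> rcard (P \<inter> S) \<and> nondeg (j + 2) \<beta> P S"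
    for P :: "'a set" and r L
  proof -
    define m where "m = rcard P"
    have sp: "spread (Suc j) \<beta> (P \<inter> S)" if "S \<in> L" for S
      using L(2)[OF that] by (simp add: spread_def nondeg_def)
    have pos: "rcard (P \<inter> S) > 0" if "S \<in> L" for S using L(2)[OF that] r by linarith
    have ne: "P \<inter> S \<noteq> {}" if "S \<in> L" for S using pos[OF that] by auto
    have big: "8 * w \<le> rcard (P \<inter> S)" if S: "S \<in> L" for S
    proof -
      have "1 \<le> \<beta> * rcard (P \<inter> S)"
        by (rule spread_card_ge[OF sp[OF S]]) (use P ne[OF S] in auto)
      also have "\<dots> \<le> 1 / (8 * w) * rcard (P \<inter> S)" using \<beta>(3) by (rule mult_right_mono) simp
      finally show ?thesis using b(2) by (simp add: field_simps)
    qed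
    have many: "r ^ j / 4 \<le> rcard (rich_tuples P w j S)" if S: "S \<in> L" for S
    proof -
      have "spread (Suc j) \<beta>0 (P \<inter> S)" by (rule spread_mono[OF sp[OF S]]) (use \<beta> in auto)
      then have "rcard (P \<inter> S) ^ j / 4 \<le> rcard (rich_tuples P w j S)"
        using P ne[OF S] by (intro many_rich_tuples pos[OF S] b(3)) (auto intro: simple_subset)
      moreover have "r ^ j \<le> rcard (P \<inter> S) ^ j" using L(2)[OF S] r by (intro power_mono) auto
      ultimately show ?thesis by linarith
    qed
    have sub: "rich_tuples P w j S \<subseteq> tuples P j" for S by (auto simp: rich_tuples_def tuples_def)
    have "rcard L * (r ^ j / 4) = (\<Sum>S\<in>L. r ^ j / 4)" by simp
    also have "\<dots> \<le> (\<Sum>S\<in>L. rcard (rich_tuples P w j S))" by (rule sum_mono) (rule many)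
    also have "\<dots> = (\<Sum>S\<in>L. \<Sum>ys\<in>tuples P j. if ys \<in> rich_tuples P w j S then 1 else 0)"
      using sub finite_tuples[OF P(1)] by (intro sum.cong refl) (simp add: sum.If_cases Int_absorb1)
    also have "\<dots> = (\<Sum>ys\<in>tuples P j. \<Sum>S\<in>L. if ys \<in> rich_tuples P w j S then 1 else 0)" by (rule sum.swap)
    also have "\<dots> = (\<Sum>ys\<in>tuples P j. rcard {S \<in> L. ys \<in> rich_tuples P w j S})"
      using L(1) by (simp add: sum.If_cases Int_def)
    also have "\<dots> \<le> (\<Sum>ys\<in>tuples P j. 18432 * w ^ 3 * (m ^ 2 / r ^ 3 + m / r))"
      unfolding m_def
      by (intro sum_mono few_subspaces_through[OF P(1) b(2) r]) (use L big in auto)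
    also have "\<dots> = m ^ j * (18432 * w ^ 3 * (m ^ 2 / r ^ 3 + m / r))" using P(1) by (simp add: card_tuples m_def)
    finally have "rcard L * (r ^ j / 4) \<le> m ^ j * (18432 * w ^ 3 * (m ^ 2 / r ^ 3 + m / r))" .
    then have "rcard L \<le> m ^ j * (18432 * w ^ 3 * (m ^ 2 / r ^ 3 + m / r)) / (r ^ j / 4)"
      using r by (simp add: pos_le_divide_eq)
    also have "\<dots> = C * (m ^ (j + 2) / r ^ (j + 3) + m ^ (j + 1) / r ^ (j + 1))"
      using r by (simp add: C_def field_simps power_add power2_eq_square power3_eq_cube)
    finally show ?thesis by (simp add: m_def)
  qed
  moreover have "C > 0" using b(2) by (simp add: C_def)
  ultimately show ?thesis using \<beta>(1) by (intro exI[of _ \<beta>] exI[of _ C] conjI allI impI) simp_all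
qed

section \<open>Popular flats\<close>

text \<open>The conclusion of the count with its constants as parameters, so that one pair
  \<open>\<beta>\<close>, \<open>C\<close> can serve several dimensions; decreasing
  \<open>\<beta>\<close> or increasing \<open>C\<close> only weakens it.\<close>

definition et_bound :: "'a::euclidean_space itself \<Rightarrow> nat \<Rightarrow> real \<Rightarrow> real \<Rightarrow> bool" where
  "et_bound _ j \<beta> C \<longleftrightarrow> (\<forall>(P :: 'a set) r L. finite P \<longrightarrow> simple P \<longrightarrow> r > 0 \<longrightarrow> finite L \<longrightarrow>
     (\<forall>S\<in>L. subspace S \<and> dim S = j + 2 \<and> r \<le> rcard (P \<inter> S) \<and> nondeg (j + 2) \<beta> P S) \<longrightarrow>
     rcard L \<le> C * (rcard P ^ (j + 2) / r ^ (j + 3) + rcard P ^ (j + 1) / r ^ (j + 1)))"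

lemma et_bound_mono:
  assumes "et_bound TYPE('a::euclidean_space) j \<beta> C" "\<beta>' \<le> \<beta>" "C \<le> C'"
  shows "et_bound TYPE('a) j \<beta>' C'"
  unfolding et_bound_def
proof (intro allI impI)
  fix P :: "'a set" and r L
  assume P: "finite P" "simple P" "r > 0" "finite L"
    "\<forall>S\<in>L. subspace S \<and> dim S = j + 2 \<and> r \<le> rcard (P \<inter> S) \<and> nondeg (j + 2) \<beta>' P S"
  have "\<forall>S\<in>L. subspace S \<and> dim S = j + 2 \<and> r \<le> rcard (P \<inter> S) \<and> nondeg (j + 2) \<beta> P S"
    using P(5) nondeg_mono[OF _ assms(2)] by blast
  then have "rcard L \<le> C * (rcard P ^ (j + 2) / r ^ (j + 3) + rcard P ^ (j + 1) / r ^ (j + 1))"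
    using assms(1) P(1-4) unfolding et_bound_def by blast
  also have "\<dots> \<le> C' * (rcard P ^ (j + 2) / r ^ (j + 3) + rcard P ^ (j + 1) / r ^ (j + 1))"
    using assms(3) P(3) by (intro mult_right_mono) auto
  finally show "rcard L \<le> C' * (rcard P ^ (j + 2) / r ^ (j + 3) + rcard P ^ (j + 1) / r ^ (j + 1))" .
qed

lemma et_bound_uniform:
  "\<exists>\<beta> C. 0 < \<beta> \<and> \<beta> \<le> 1 \<and> 0 < C \<and> (\<forall>j\<le>J. et_bound TYPE('a::euclidean_space) j \<beta> C)"
proof (induction J)
  case 0
  obtain \<beta> C where "\<beta> > 0" "C > 0" "et_bound TYPE('a) 0 \<beta> C"
    using elekes_toth[where 'a='a and j=0] unfolding et_bound_def by blast
  then have "et_bound TYPE('a) 0 (min \<beta> 1) C" using et_bound_mono[of 0 \<beta> C "min \<beta> 1" C] by simp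
  then show ?case using \<open>\<beta> > 0\<close> \<open>C > 0\<close> by (intro exI[of _ "min \<beta> 1"] exI[of _ C]) auto
next
  case (Suc J)
  then obtain \<beta>1 C1 where 1: "0 < \<beta>1" "\<beta>1 \<le> 1" "0 < C1" "\<And>j. j \<le> J \<Longrightarrow> et_bound TYPE('a) j \<beta>1 C1" by blast
  obtain \<beta>2 C2 where 2: "\<beta>2 > 0" "C2 > 0" "et_bound TYPE('a) (Suc J) \<beta>2 C2"
    using elekes_toth[where 'a='a and j="Suc J"] unfolding et_bound_def by blast
  have "et_bound TYPE('a) j (min \<beta>1 \<beta>2) (max C1 C2)" if "j \<le> Suc J" for j
  proof (cases "j = Suc J")
    case True
    then show ?thesis using et_bound_mono[OF 2(3)] by simp
  next
    case False
    then show ?thesis using et_bound_mono[OF 1(4)[of j]] that by simp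
  qed
  then show ?case using 1 2 by (intro exI[of _ "min \<beta>1 \<beta>2"] exI[of _ "max C1 C2"]) auto
qed

text \<open>A degenerate subspace is cut with a witness of its degeneracy, which keeps a
  \<beta>-fraction of the points. The dimension drops each time, so at most \<open>dim S\<close>
  factors \<open>\<beta>\<close> are lost.\<close>

lemma nondeg_descent:
  fixes P S :: "'a::euclidean_space set"
  assumes "0 < \<beta>" "\<beta> \<le> 1" "finite P" "subspace S"
  shows "\<exists>U. subspace U \<and> U \<subseteq> S \<and> \<beta> ^ dim S * rcard (P \<inter> S) \<le> rcard (P \<inter> U) \<and> nondeg (dim U) \<beta> P U"
  using assms(4)
proof (induction "dim S" arbitrary: S rule: less_induct)
  case less
  show ?case
  proof (cases "nondeg (dim S) \<beta> P S")
    case True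
    have "\<beta> ^ dim S * rcard (P \<inter> S) \<le> 1 * rcard (P \<inter> S)"
      using assms by (intro mult_right_mono power_le_one) auto
    then show ?thesis using True less.prems by (intro exI[of _ S]) simp
  next
    case False
    then obtain U0 where U0: "subspace U0" "dim U0 < dim S" "\<beta> * rcard (P \<inter> S) < rcard (P \<inter> S \<inter> U0)"
      by (auto simp: nondeg_def not_le)
    let ?T = "S \<inter> U0"
    have T: "subspace ?T" using less.prems U0(1) by (simp add: subspace_inter)
    have dT: "dim ?T \<le> dim U0" by (simp add: dim_subset)
    then have dT: "dim ?T < dim S" using U0(2) by linarith
    obtain U where U: "subspace U" "U \<subseteq> ?T" "\<beta> ^ dim ?T * rcard (P \<inter> ?T) \<le> rcard (P \<inter> U)" "nondeg (dim U) \<beta> P U"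
      using less.hyps[OF dT T] by blast
    have "\<beta> ^ dim S * rcard (P \<inter> S) \<le> \<beta> ^ Suc (dim ?T) * rcard (P \<inter> S)"
      using assms dT by (intro mult_right_mono power_decreasing) auto
    also have "\<dots> = \<beta> ^ dim ?T * (\<beta> * rcard (P \<inter> S))" by simp
    also have "\<dots> \<le> \<beta> ^ dim ?T * rcard (P \<inter> ?T)"
      using U0(3) assms(1) by (intro mult_left_mono) (auto simp: Int_assoc)
    finally show ?thesis using U by (intro exI[of _ U]) auto
  qed
qed

lemma simple_card_dim_le_1:
  assumes "simple P" "finite P" "dim U \<le> 1"
  shows "card (P \<inter> U) \<le> 1"
proof (rule ccontr)
  assume "\<not> card (P \<inter> U) \<le> 1"
  then have "rcard (P \<inter> U) \<ge> 2" by simp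
  then obtain a b where ab: "a \<in> P \<inter> U" "b \<in> P \<inter> U" "a \<noteq> b" by (rule card_ge_2_obtain)
  then have "b \<notin> span {a}" "a \<noteq> 0" using assms(1) by (auto simp: simple_def)
  then have "dim {b, a} = 2" by (simp add: dim_insert)
  moreover have "dim {b, a} \<le> dim U" using ab by (intro dim_subset) auto
  ultimately show False using assms(3) by simp
qed

text \<open>For \<open>r = c * \<eta> * m\<close> the first term is, up to powers of
  \<open>c\<close>, the second one divided by \<open>\<eta> ^ 2 * m\<close>.\<close>

lemma et_arith:
  fixes m \<eta> c :: real
  assumes m: "m > 0" and \<eta>: "\<eta> > 0" and big: "\<eta> ^ 2 * m \<ge> 1" and c: "0 < c" "c \<le> 1"
  shows "m ^ (j + 2) / (c * \<eta> * m) ^ (j + 3) + m ^ (j + 1) / (c * \<eta> * m) ^ (j + 1) \<le> 2 / (c ^ (j + 3) * \<eta> ^ (j + 1))"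
proof -
  have "m ^ (j + 2) / (c * \<eta> * m) ^ (j + 3) = 1 / (c ^ (j + 3) * \<eta> ^ (j + 1)) * (1 / (\<eta> ^ 2 * m))"
    using m \<eta> c by (simp add: power_mult_distrib power_add field_simps power2_eq_square power3_eq_cube)
  also have "\<dots> \<le> 1 / (c ^ (j + 3) * \<eta> ^ (j + 1)) * 1"
    using big m \<eta> c by (intro mult_left_mono) auto
  finally have 1: "m ^ (j + 2) / (c * \<eta> * m) ^ (j + 3) \<le> 1 / (c ^ (j + 3) * \<eta> ^ (j + 1))" by simp
  have "m ^ (j + 1) / (c * \<eta> * m) ^ (j + 1) = 1 / (c ^ (j + 1) * \<eta> ^ (j + 1))"
    using m by (simp add: power_mult_distrib)
  also have "\<dots> \<le> 1 / (c ^ (j + 3) * \<eta> ^ (j + 1))"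
    using \<eta> c by (intro divide_left_mono mult_right_mono power_decreasing) auto
  finally have 2: "m ^ (j + 1) / (c * \<eta> * m) ^ (j + 1) \<le> 1 / (c ^ (j + 3) * \<eta> ^ (j + 1))" .
  have "x + y \<le> 2 / z" if "x \<le> 1 / z" "y \<le> 1 / z" for x y z :: real using that by simp
  then show ?thesis using 1 2 by blast
qed

lemma pigeonhole_fibre:
  assumes "finite J" "f ` J \<subseteq> B" "finite B" "rcard B \<le> N" "J \<noteq> {}" "N > 0"
  shows "\<exists>b\<in>B. rcard J / N \<le> rcard {i \<in> J. f i = b}"
proof (rule ccontr)
  assume "\<not> ?thesis"
  then have lt: "\<And>b. b \<in> B \<Longrightarrow> rcard {i \<in> J. f i = b} < rcard J / N" by auto
  have ne: "B \<noteq> {}" using assms by auto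
  have "J = (\<Union>b\<in>B. {i \<in> J. f i = b})" using assms(2) by auto
  then have "card J \<le> (\<Sum>b\<in>B. card {i \<in> J. f i = b})" using card_UN_le[OF assms(3)] by metis
  then have "rcard J \<le> (\<Sum>b\<in>B. rcard {i \<in> J. f i = b})" by (metis of_nat_le_iff of_nat_sum)
  also have "\<dots> < (\<Sum>b\<in>B. rcard J / N)" by (rule sum_strict_mono[OF assms(3) ne lt])
  also have "\<dots> = rcard B * (rcard J / N)" by simp
  also have "\<dots> \<le> N * (rcard J / N)" using assms(4,6) by (intro mult_right_mono) auto
  finally show False using assms(6) by simp
qed

text \<open>The number of distinct non-degenerate rich flats of dimension \<open>2\<close> or \<open>3\<close> is \<open>O(1 / \<eta>\<^sup>2)\<close>, so one of them is
  shared by many \<open>S i\<close>. For flats of dimension \<open>4\<close> there is no such bound, hence the second alternative.\<close>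

theorem popular_flat:
  "\<exists>A c. A > 0 \<and> 0 < c \<and> c \<le> 1 \<and>
    (\<forall>(P :: 'a::euclidean_space set) \<eta> (J :: 'i set) S k. finite P \<longrightarrow> simple P \<longrightarrow> 0 < \<eta> \<longrightarrow> A \<le> \<eta> ^ 2 * rcard P \<longrightarrow>
      finite J \<longrightarrow> inj_on S J \<longrightarrow> k \<le> 3 \<longrightarrow>
      (\<forall>i\<in>J. subspace (S i) \<and> dim (S i) = k + 2 \<and> \<eta> * rcard P \<le> rcard (P \<inter> S i)) \<longrightarrow>
      J \<noteq> {} \<longrightarrow> A / \<eta> ^ (k + 1) \<le> rcard J \<longrightarrow>
      (\<exists>U. subspace U \<and> c * \<eta> * rcard P \<le> rcard (P \<inter> U) \<and>
         c * \<eta> ^ 2 * rcard J \<le> rcard {i \<in> J. U \<subseteq> S i}) \<or>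
      k = 3 \<and> (\<exists>J' U. J' \<subseteq> J \<and> rcard J / 4 \<le> rcard J' \<and>
         (\<forall>i\<in>J'. subspace (U i) \<and> dim (U i) = 4 \<and> U i \<subseteq> S i \<and> c * \<eta> * rcard P \<le> rcard (P \<inter> U i))))"
proof -
  obtain \<beta> C where \<beta>: "0 < \<beta>" "\<beta> \<le> 1" and C: "0 < C" and et: "\<And>j. j \<le> 3 \<Longrightarrow> et_bound TYPE('a) j \<beta> C"
    using et_bound_uniform[where 'a='a and J=3] by blast
  \<comment> \<open>The exponent is the largest dimension \<open>k + 2\<close> of an
    \<open>S i\<close>, which bounds the length of the descent.\<close>
  define c0 where "c0 = \<beta> ^ 5"
  have c0: "0 < c0" "c0 \<le> 1" using \<beta> by (auto simp: c0_def power_le_one)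
  \<comment> \<open>The second entry comes from distributing a quarter of \<open>J\<close> over
    \<open>4 * C / (c0 ^ 4 * \<eta> ^ 2)\<close> flats.\<close>
  define c where "c = min c0 (c0 ^ 4 / (16 * C))"
  \<comment> \<open>\<open>2 / c0\<close> puts at least two points on every flat found, which
    excludes dimensions 0 and 1; \<open>4 * C\<close> makes the non-degenerate \<open>S i\<close> at
    most half of \<open>J\<close>.\<close>
  define A where "A = max (2 / c0) (4 * C)"
  have A: "2 / c0 \<le> A" "4 * C \<le> A" unfolding A_def by simp_all
  have "1 \<le> 2 / c0" using c0 by simp
  then have A1: "1 \<le> A" using A by linarith
  have c: "0 < c" "c \<le> 1" "c \<le> c0" "c \<le> c0 ^ 4 / (16 * C)" using c0 C by (auto simp: c_def)
  have "(\<exists>U. subspace U \<and> c * \<eta> * rcard P \<le> rcard (P \<inter> U) \<and>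
         c * \<eta> ^ 2 * rcard J \<le> rcard {i \<in> J. U \<subseteq> S i}) \<or>
      k = 3 \<and> (\<exists>J' U. J' \<subseteq> J \<and> rcard J / 4 \<le> rcard J' \<and>
         (\<forall>i\<in>J'. subspace (U i) \<and> dim (U i) = 4 \<and> U i \<subseteq> S i \<and> c * \<eta> * rcard P \<le> rcard (P \<inter> U i)))"
    if P: "finite P" "simple P" and \<eta>: "0 < \<eta>" and big: "A \<le> \<eta> ^ 2 * rcard P" and J: "finite J" "inj_on S J"
      and k: "k \<le> 3" and S: "\<And>i. i \<in> J \<Longrightarrow> subspace (S i) \<and> dim (S i) = k + 2 \<and> \<eta> * rcard P \<le> rcard (P \<inter> S i)"
      and J0: "J \<noteq> {}" and cJ: "A / \<eta> ^ (k + 1) \<le> rcard J"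
    for P :: "'a set" and \<eta> and J :: "'i set" and S k
  proof -
    define m where "m = rcard P"
    have "\<eta> ^ 2 * m \<ge> 1" using big A1 by (simp add: m_def)
    then have m: "m > 0" using \<eta> by (metis less_eq_real_def linorder_not_le m_def mult_zero_right not_one_le_zero of_nat_0_le_iff)
    have em: "\<eta> ^ 2 * m \<ge> 1" by fact
    have \<eta>1: "\<eta> \<le> 1"
    proof -
      obtain i where "i \<in> J" using J0 by blast
      then have "\<eta> * m \<le> rcard (P \<inter> S i)" using S by (simp add: m_def)
      also have "\<dots> \<le> m" unfolding m_def using P(1) by (simp add: card_mono)
      finally show ?thesis using m by simp
    qed
    define N where "N = {i \<in> J. nondeg (k + 2) \<beta> P (S i)}"
    have "rcard (S ` N) \<le> C * (m ^ (k + 2) / (1 * \<eta> * m) ^ (k + 3) + m ^ (k + 1) / (1 * \<eta> * m) ^ (k + 1))"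
      unfolding m_def
      by (rule et[OF k, unfolded et_bound_def, rule_format]) (use P \<eta> m J S in \<open>auto simp: N_def m_def\<close>)
    also have "\<dots> \<le> C * (2 / (1 ^ (k + 3) * \<eta> ^ (k + 1)))"
      by (rule mult_left_mono[OF et_arith[OF m \<eta> em]]) (use C in auto)
    also have "\<dots> = (4 * C) / \<eta> ^ (k + 1) / 2" by simp
    also have "\<dots> \<le> A / \<eta> ^ (k + 1) / 2" using A \<eta> by (intro divide_right_mono) auto
    also have "\<dots> \<le> rcard J / 2" using cJ by simp
    finally have "rcard (S ` N) \<le> rcard J / 2" .
    moreover have "card (S ` N) = card N" using J by (intro card_image) (auto simp: N_def inj_on_def)
    ultimately have cN: "rcard N \<le> rcard J / 2" by simp
    have "\<exists>U. subspace U \<and> U \<subseteq> S i \<and> dim U < k + 2 \<and> c0 * \<eta> * m \<le> rcard (P \<inter> U) \<and> nondeg (dim U) \<beta> P U"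
      if i: "i \<in> J - N" for i
    proof -
      have Si: "subspace (S i)" "dim (S i) = k + 2" "\<eta> * m \<le> rcard (P \<inter> S i)" using i S by (auto simp: m_def)
      obtain U where U: "subspace U" "U \<subseteq> S i" "\<beta> ^ dim (S i) * rcard (P \<inter> S i) \<le> rcard (P \<inter> U)"
        "nondeg (dim U) \<beta> P U"
        using nondeg_descent[OF \<beta> P(1) Si(1)] by blast
      have "dim U < k + 2"
      proof (rule ccontr)
        assume "\<not> dim U < k + 2"
        then have "U = S i" using subspace_dim_equal[OF U(1) Si(1) U(2)] Si(2) by simp
        then show False using U(4) Si(2) i by (simp add: N_def)
      qed
      moreover have "c0 * \<eta> * m \<le> \<beta> ^ dim (S i) * rcard (P \<inter> S i)"
        unfolding c0_def mult.assoc using Si k \<beta> \<eta> m by (intro mult_mono power_decreasing) auto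
      ultimately show ?thesis using U by (intro exI[of _ U]) auto
    qed
    then obtain U where U: "\<And>i. i \<in> J - N \<Longrightarrow> subspace (U i) \<and> U i \<subseteq> S i \<and> dim (U i) < k + 2 \<and>
       c0 * \<eta> * m \<le> rcard (P \<inter> U i) \<and> nondeg (dim (U i)) \<beta> P (U i)"
      using bchoice[of "J - N" "\<lambda>i U. subspace U \<and> U \<subseteq> S i \<and> dim U < k + 2 \<and> c0 * \<eta> * m \<le> rcard (P \<inter> U) \<and> nondeg (dim U) \<beta> P U"]
      by blast
    define J3 where "J3 = {i \<in> J - N. dim (U i) = 4}"
    define J2 where "J2 = {i \<in> J - N. dim (U i) \<noteq> 4}"
    have "card J \<le> card N + card J3 + card J2"
    proof -
      have "J \<subseteq> (N \<union> J3) \<union> J2" by (auto simp: J2_def J3_def)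
      then have "card J \<le> card ((N \<union> J3) \<union> J2)" using J(1) by (intro card_mono) (auto simp: N_def J2_def J3_def)
      then show ?thesis by (meson add_le_mono card_Un_le le_refl le_trans)
    qed
    then have split: "rcard J \<le> rcard N + rcard J3 + rcard J2" by linarith
    have cc: "c * \<eta> * m \<le> c0 * \<eta> * m" using c \<eta> m by (intro mult_right_mono) auto
    show ?thesis
    proof (cases "rcard J / 4 \<le> rcard J3")
      case True
      have "card J > 0" using J(1) J0 by (simp add: card_gt_0_iff)
      then have "J3 \<noteq> {}" using True by auto
      then obtain i where i: "i \<in> J3" by blast
      then have "k = 3" using U[of i] k by (auto simp: J3_def)
      moreover have "\<forall>i\<in>J3. subspace (U i) \<and> dim (U i) = 4 \<and> U i \<subseteq> S i \<and> c * \<eta> * rcard P \<le> rcard (P \<inter> U i)"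
        using U cc unfolding J3_def m_def by fastforce
      moreover have "J3 \<subseteq> J" by (auto simp: J3_def)
      ultimately show ?thesis using True by blast
    next
      case False
      then have cJ2: "rcard J / 4 \<le> rcard J2" using split cN by linarith
      have dU: "dim (U i) = 2 \<or> dim (U i) = 3" if i: "i \<in> J2" for i
      proof -
        have "\<not> dim (U i) \<le> 1"
        proof
          assume "dim (U i) \<le> 1"
          then have "rcard (P \<inter> U i) \<le> 1" using simple_card_dim_le_1[OF P(2,1)] by fastforce
          moreover have "c0 * (\<eta> * m) \<le> rcard (P \<inter> U i)" using U[of i] i by (simp add: J2_def mult.assoc)
          moreover have "\<eta> ^ 2 * m \<le> \<eta> * m" using \<eta> \<eta>1 m by (simp add: power2_eq_square mult_left_le)
          then have "2 / c0 \<le> \<eta> * m" using A big by (simp add: m_def)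
          then have "2 \<le> c0 * (\<eta> * m)" using c0 by (simp add: field_simps)
          ultimately show False by linarith
        qed
        moreover have "dim (U i) < 5" "dim (U i) \<noteq> 4" using U[of i] i k by (auto simp: J2_def)
        ultimately show ?thesis by linarith
      qed
      define B where "B d = {V \<in> U ` J2. dim V = d}" for d
      have fin: "finite J2" using J(1) by (simp add: J2_def)
      have cB: "rcard (B (j + 2)) \<le> C * (2 / (c0 ^ (j + 3) * \<eta> ^ (j + 1)))" if j: "j \<le> 3" for j
      proof -
        have "rcard (B (j + 2)) \<le> C * (m ^ (j + 2) / (c0 * \<eta> * m) ^ (j + 3) + m ^ (j + 1) / (c0 * \<eta> * m) ^ (j + 1))"
          unfolding m_def
        proof (rule et[OF j, unfolded et_bound_def, rule_format])
          fix V assume "V \<in> B (j + 2)"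
          then obtain i where i: "i \<in> J - N" "V = U i" "dim V = j + 2" by (auto simp: B_def J2_def)
          then show "subspace V \<and> dim V = j + 2 \<and> c0 * \<eta> * rcard P \<le> rcard (P \<inter> V) \<and> nondeg (j + 2) \<beta> P V"
            using U[OF i(1)] by (metis m_def)
        qed (use P c0 \<eta> m fin in \<open>auto simp: B_def m_def\<close>)
        also have "\<dots> \<le> C * (2 / (c0 ^ (j + 3) * \<eta> ^ (j + 1)))"
          by (rule mult_left_mono[OF et_arith[OF m \<eta> em c0]]) (use C in auto)
        finally show ?thesis .
      qed
      have "U ` J2 \<subseteq> B 2 \<union> B 3" using dU by (auto simp: B_def)
      then have "card (U ` J2) \<le> card (B 2 \<union> B 3)" using fin by (intro card_mono) (auto simp: B_def)
      then have "card (U ` J2) \<le> card (B 2) + card (B 3)" using card_Un_le le_trans by blast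
      then have "rcard (U ` J2) \<le> rcard (B 2) + rcard (B 3)" by linarith
      also have "\<dots> \<le> C * (2 / (c0 ^ 3 * \<eta>)) + C * (2 / (c0 ^ 4 * \<eta> ^ 2))"
        using cB[of 0] cB[of 1] by (simp add: numeral_3_eq_3 numeral_2_eq_2 eval_nat_numeral)
      also have "\<dots> \<le> C * (2 / (c0 ^ 4 * \<eta> ^ 2)) + C * (2 / (c0 ^ 4 * \<eta> ^ 2))"
      proof -
        have "c0 ^ 4 * \<eta> ^ 2 \<le> c0 ^ 3 * \<eta>"
        proof (rule mult_mono)
          show "c0 ^ 4 \<le> c0 ^ 3" using c0 by (intro power_decreasing) auto
          show "\<eta> ^ 2 \<le> \<eta>" using \<eta> \<eta>1 by (simp add: power2_eq_square mult_left_le)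
        qed (use c0 \<eta> in auto)
        then have "2 / (c0 ^ 3 * \<eta>) \<le> 2 / (c0 ^ 4 * \<eta> ^ 2)" using c0 \<eta> by (intro divide_left_mono) auto
        then show ?thesis using C by (intro add_right_mono mult_left_mono) auto
      qed
      also have "\<dots> = 4 * C / (c0 ^ 4 * \<eta> ^ 2)" by simp
      finally have cU: "rcard (U ` J2) \<le> 4 * C / (c0 ^ 4 * \<eta> ^ 2)" .
      have cJpos: "rcard J > 0" using J(1) J0 by (simp add: card_gt_0_iff)
      then have J2ne: "J2 \<noteq> {}" using cJ2 by auto
      have Npos: "4 * C / (c0 ^ 4 * \<eta> ^ 2) > 0" using C c0 \<eta> by simp
      obtain V where V: "V \<in> U ` J2" "rcard J2 / (4 * C / (c0 ^ 4 * \<eta> ^ 2)) \<le> rcard {i \<in> J2. U i = V}"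
        using pigeonhole_fibre[OF fin order_refl _ cU J2ne Npos] fin by blast
      obtain i where i: "i \<in> J2" "V = U i" using V(1) by blast
      have "subspace V" "c0 * \<eta> * m \<le> rcard (P \<inter> V)" using U[of i] i by (auto simp: J2_def)
      then have 1: "subspace V" "c * \<eta> * rcard P \<le> rcard (P \<inter> V)" using cc by (auto simp: m_def)
      have "{i \<in> J2. U i = V} \<subseteq> {i \<in> J. V \<subseteq> S i}" using U by (auto simp: J2_def)
      then have "card {i \<in> J2. U i = V} \<le> card {i \<in> J. V \<subseteq> S i}" using J(1) by (intro card_mono) auto
      then have "rcard J2 / (4 * C / (c0 ^ 4 * \<eta> ^ 2)) \<le> rcard {i \<in> J. V \<subseteq> S i}" using V(2) by linarith
      moreover have "(rcard J / 4) / (4 * C / (c0 ^ 4 * \<eta> ^ 2)) \<le> rcard J2 / (4 * C / (c0 ^ 4 * \<eta> ^ 2))"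
        by (rule divide_right_mono[OF cJ2]) (use Npos in simp)
      moreover have "(rcard J / 4) / (4 * C / (c0 ^ 4 * \<eta> ^ 2)) = c0 ^ 4 / (16 * C) * (\<eta> ^ 2 * rcard J)"
        using C c0 \<eta> by (simp add: field_simps)
      moreover have "c * (\<eta> ^ 2 * rcard J) \<le> c0 ^ 4 / (16 * C) * (\<eta> ^ 2 * rcard J)"
        by (rule mult_right_mono[OF c(4)]) simp
      ultimately have "c * (\<eta> ^ 2 * rcard J) \<le> rcard {i \<in> J. V \<subseteq> S i}" by linarith
      then have "c * \<eta> ^ 2 * rcard J \<le> rcard {i \<in> J. V \<subseteq> S i}" by (simp only: mult.assoc)
      then show ?thesis using 1 by blast
    qed
  qed
  moreover have "A > 0" using A1 by linarith
  ultimately show ?thesis using c(1,2) by (intro exI[of _ A] exI[of _ c] conjI allI impI) simp_all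
qed

section \<open>Averaging and duality\<close>

text \<open>If all levels \<open>2 ^ j * \<epsilon> / 2\<close> were thinner than claimed, the sums
  of the \<open>x i\<close> truncated at these levels would grow by a geometric series and stay
  below \<open>\<epsilon> * |J|\<close>.\<close>

lemma dyadic_level:
  fixes x :: "'i \<Rightarrow> real"
  assumes fin: "finite J" and ne: "J \<noteq> {}" and x: "\<And>i. i \<in> J \<Longrightarrow> x i \<le> 1" and e: "\<epsilon> > 0"
    and sum: "\<epsilon> * rcard J \<le> (\<Sum>i\<in>J. x i)"
  shows "\<exists>\<eta>. \<epsilon> / 2 \<le> \<eta> \<and> rcard J * (\<epsilon> / \<eta>) ^ 2 / 8 \<le> rcard {i \<in> J. \<eta> \<le> x i}"
proof (rule ccontr)
  assume contra: "\<not> ?thesis"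
  define n where "n = rcard J"
  have n: "n > 0" using fin ne by (simp add: n_def card_gt_0_iff)
  define l where "l j = 2 ^ j * (\<epsilon> / 2)" for j :: nat
  have l: "l j > 0" "\<epsilon> / 2 \<le> l j" for j using e by (simp_all add: l_def)
  have few: "rcard {i \<in> J. l j \<le> x i} \<le> n * (\<epsilon> / l j) ^ 2 / 8" for j
    using contra l(2)[of j] unfolding n_def by (meson not_le less_imp_le)
  define g where "g j = (\<Sum>i\<in>J. min (x i) (l j))" for j
  have step: "g (Suc j) \<le> g j + n * \<epsilon> / 4 / 2 ^ j" for j
  proof -
    have "g (Suc j) \<le> (\<Sum>i\<in>J. min (x i) (l j) + (if l j \<le> x i then l j else 0))"
      unfolding g_def
    proof (rule sum_mono)
      fix i
      have "l (Suc j) = 2 * l j" by (simp add: l_def)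
      then show "min (x i) (l (Suc j)) \<le> min (x i) (l j) + (if l j \<le> x i then l j else 0)"
        using l(1)[of j] by (auto simp: min_def)
    qed
    also have "\<dots> = g j + rcard {i \<in> J. l j \<le> x i} * l j"
      using fin by (simp add: g_def sum.distrib sum.If_cases Int_def)
    also have "\<dots> \<le> g j + n * (\<epsilon> / l j) ^ 2 / 8 * l j"
      using few l(1)[of j] by (intro add_left_mono mult_right_mono) auto
    also have "n * (\<epsilon> / l j) ^ 2 / 8 * l j = n * \<epsilon> / 4 / 2 ^ j"
      using e by (simp add: l_def power2_eq_square field_simps)
    finally show ?thesis .
  qed
  \<comment> \<open>The deficit \<open>1 / (2 * 2 ^ j)\<close> stays positive, which contradicts the
    mean at a level \<open>l j \<ge> 1\<close>, where truncation has no effect.\<close>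
  have g: "g j \<le> n * \<epsilon> * (1 - 1 / (2 * 2 ^ j))" for j
  proof (induction j)
    case 0
    have "g 0 \<le> (\<Sum>i\<in>J. \<epsilon> / 2)" unfolding g_def by (intro sum_mono) (simp add: l_def)
    then show ?case by (simp add: n_def)
  next
    case (Suc j)
    have "g (Suc j) \<le> n * \<epsilon> * (1 - 1 / (2 * 2 ^ j)) + n * \<epsilon> / 4 / 2 ^ j" using step[of j] Suc by linarith
    also have "\<dots> = n * \<epsilon> * (1 - 1 / (2 * 2 ^ Suc j))" by (simp add: field_simps)
    finally show ?case .
  qed
  obtain j where "2 / \<epsilon> < 2 ^ j" using real_arch_pow[of 2 "2 / \<epsilon>"] by auto
  then have lj: "1 \<le> l j" using e by (simp add: l_def field_simps)
  have "(\<Sum>i\<in>J. x i) = g j" unfolding g_def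
  proof (rule sum.cong[OF refl])
    fix i assume "i \<in> J"
    then show "x i = min (x i) (l j)" using x[of i] lj by simp
  qed
  then have "\<epsilon> * n \<le> n * \<epsilon> * (1 - 1 / (2 * 2 ^ j))" using sum g[of j] by (simp add: n_def)
  then have "n * \<epsilon> * (1 / (2 * 2 ^ j)) \<le> 0" by (simp add: algebra_simps)
  moreover have "n * \<epsilon> * (1 / (2 * 2 ^ j)) > 0" using n e by (intro mult_pos_pos) auto
  ultimately show False by linarith
qed

lemma harm_le_ln: "n \<ge> 1 \<Longrightarrow> harm n \<le> 1 + ln (real n)"
proof -
  assume "n \<ge> 1"
  then obtain k where k: "n = Suc k" by (cases n) auto
  have "harm (Suc k) - ln (real (Suc k)) \<le> harm (Suc 0) - ln (real (Suc 0))"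
    using decseq_harm_diff_ln[THEN decseqD, of 0 k] by simp
  then show ?thesis by (simp add: k harm_def)
qed

text \<open>The sum of \<open>s\<close> is the sum over \<open>t\<close> of the numbers of
  \<open>v\<close> with \<open>s v \<ge> t\<close>. If each of these were below a share proportional
  to \<open>1 / t\<close>, harmonic summation would fall short of the total.\<close>

lemma multiplicity_level:
  fixes s :: "'v \<Rightarrow> nat"
  assumes fin: "finite G" and s: "\<And>v. v \<in> G \<Longrightarrow> s v \<le> n" and n: "n \<ge> 1"
  shows "\<exists>t\<ge>1. (\<Sum>v\<in>G. real (s v)) \<le> (1 + ln (real n)) * (real t * rcard {v \<in> G. t \<le> s v})"
proof (cases "(\<Sum>v\<in>G. real (s v)) = 0")
  case True
  have "0 \<le> ln (real n)" using n by simp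
  then show ?thesis using True by (intro exI[of _ 1]) simp
next
  case False
  define T where "T = (\<Sum>v\<in>G. real (s v))"
  have T: "T > 0" using False by (simp add: T_def sum_nonneg less_le)
  have ln: "1 + ln (real n) > 0" using n by (simp add: add_pos_nonneg)
  show ?thesis
  proof (rule ccontr)
    assume contra: "\<not> ?thesis"
    have lt: "(1 + ln (real n)) * (real t * rcard {v \<in> G. t \<le> s v}) < T" if "t \<ge> 1" for t
      using that contra unfolding T_def by (meson not_le)
    have lt': "rcard {v \<in> G. t \<le> s v} < T / (1 + ln (real n)) * (1 / real t)" if "t \<in> {1..n}" for t
    proof -
      have t: "t \<ge> 1" using that by simp
      have "rcard {v \<in> G. t \<le> s v} * ((1 + ln (real n)) * real t) < T" using lt[OF t] by (simp only: mult_ac)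
      then have "rcard {v \<in> G. t \<le> s v} < T / ((1 + ln (real n)) * real t)"
        using ln t by (subst pos_less_divide_eq) (auto intro: mult_pos_pos)
      then show ?thesis by simp
    qed
    have "T = (\<Sum>v\<in>G. \<Sum>t\<in>{1..n}. if t \<le> s v then 1 else 0)"
      unfolding T_def
    proof (rule sum.cong[OF refl])
      fix v assume "v \<in> G"
      then have "s v \<le> n" by (rule s)
      then have eq: "{1..n} \<inter> {t. t \<le> s v} = {1..s v}" by auto
      show "real (s v) = (\<Sum>t\<in>{1..n}. if t \<le> s v then 1 else 0)"
        unfolding sum.If_cases[OF finite_atLeastAtMost] eq by simp
    qed
    also have "\<dots> = (\<Sum>t\<in>{1..n}. \<Sum>v\<in>G. if t \<le> s v then 1 else 0)" by (rule sum.swap)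
    also have "\<dots> = (\<Sum>t\<in>{1..n}. rcard {v \<in> G. t \<le> s v})" using fin by (simp add: sum.If_cases Int_def)
    also have "\<dots> < (\<Sum>t\<in>{1..n}. T / (1 + ln (real n)) * (1 / real t))"
      by (rule sum_strict_mono) (use n lt' in auto)
    also have "\<dots> = T / (1 + ln (real n)) * harm n"
      unfolding harm_def sum_distrib_left by (intro sum.cong) (simp_all add: inverse_eq_divide)
    also have "\<dots> \<le> T / (1 + ln (real n)) * (1 + ln (real n))"
      using harm_le_ln[OF n] T ln by (intro mult_left_mono) auto
    also have "\<dots> = T" using ln by simp
    finally show False by simp
  qed
qed

lemma sum_card_swap:
  assumes "finite A" "finite B"
  shows "(\<Sum>a\<in>A. rcard {b \<in> B. R a b}) = (\<Sum>b\<in>B. rcard {a \<in> A. R a b})"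
proof -
  have "(\<Sum>a\<in>A. rcard {b \<in> B. R a b}) = (\<Sum>a\<in>A. \<Sum>b\<in>B. if R a b then 1 else 0)"
    using assms by (simp add: sum.If_cases Int_def)
  also have "\<dots> = (\<Sum>b\<in>B. \<Sum>a\<in>A. if R a b then 1 else 0)" by (rule sum.swap)
  also have "\<dots> = (\<Sum>b\<in>B. rcard {a \<in> A. R a b})" using assms by (simp add: sum.If_cases Int_def)
  finally show ?thesis .
qed

lemma sum_card_pairs:
  assumes "finite A" "finite B"
  shows "(\<Sum>b\<in>B. rcard {a \<in> A. R a b}) = rcard {(a, b) \<in> A \<times> B. R a b}"
proof -
  have "{(a, b) \<in> A \<times> B. R a b} = (SIGMA a:A. {b \<in> B. R a b})" by auto
  then have "card {(a, b) \<in> A \<times> B. R a b} = (\<Sum>a\<in>A. card {b \<in> B. R a b})" using assms by (simp add: card_SigmaI)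
  then show ?thesis using sum_card_swap[OF assms, of R] by simp
qed

section \<open>Duality by a generic projection\<close>

lemma avoid_proper_subspaces:
  fixes \<B> :: "'a::euclidean_space set set"
  assumes "finite \<B>" "\<And>B. B \<in> \<B> \<Longrightarrow> dim B < DIM('a)"
  shows "\<exists>z. \<forall>B\<in>\<B>. z \<notin> span B"
proof -
  have "\<exists>w. w \<noteq> 0 \<and> (\<forall>y\<in>span B. w \<bullet> y = 0)" if "B \<in> \<B>" for B
    using orthogonal_to_subspace_exists[OF assms(2)[OF that]] by (metis orthogonal_def)
  then have "\<forall>B\<in>\<B>. \<exists>w. w \<noteq> 0 \<and> (\<forall>y\<in>span B. w \<bullet> y = 0)" ..
  from bchoice[OF this] obtain w where w: "\<And>B. B \<in> \<B> \<Longrightarrow> w B \<noteq> 0 \<and> (\<forall>y\<in>span B. w B \<bullet> y = 0)"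
    by (elim exE) blast
  \<comment> \<open>Every proper subspace lies in the hyperplane normal to some \<open>w B\<close>,
    so it is enough that \<open>z\<close> is orthogonal to none of these finitely many
    normals.\<close>
  have "\<exists>z. (\<forall>f\<in>{0}. z \<bullet> f = 0) \<and> (\<forall>v\<in>w ` \<B>. z \<bullet> v \<noteq> 0)"
    by (rule generic_orthogonal) (use assms(1) w in auto)
  then obtain z where "\<And>B. B \<in> \<B> \<Longrightarrow> z \<bullet> w B \<noteq> 0" by auto
  then show ?thesis using w by (metis inner_commute)
qed

lemma dim_orthogonal_pair:
  fixes z p :: "'a::euclidean_space"
  assumes "p \<noteq> 0" "z \<notin> span {p}"
  shows "dim {v. z \<bullet> v = 0 \<and> p \<bullet> v = 0} + 2 = DIM('a)"
proof -
  have "dim {y \<in> UNIV. \<forall>x\<in>span {z, p}. orthogonal x y} + dim (span {z, p}) = dim (UNIV :: 'a set)"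
    by (rule dim_subspace_orthogonal_to_vectors) auto
  moreover have "{y \<in> UNIV. \<forall>x\<in>span {z, p}. orthogonal x y} = {v. z \<bullet> v = 0 \<and> p \<bullet> v = 0}"
  proof (rule set_eqI)
    fix v
    have "(\<forall>x\<in>span {z, p}. orthogonal x v) \<longleftrightarrow> span {z, p} \<subseteq> {x. v \<bullet> x = 0}"
      by (auto simp: orthogonal_def inner_commute)
    also have "\<dots> \<longleftrightarrow> {z, p} \<subseteq> {x. v \<bullet> x = 0}"
      using span_minimal[OF _ subspace_hyperplane] span_superset by (metis subset_trans)
    finally show "v \<in> {y \<in> UNIV. \<forall>x\<in>span {z, p}. orthogonal x y} \<longleftrightarrow> v \<in> {v. z \<bullet> v = 0 \<and> p \<bullet> v = 0}"
      by (auto simp: inner_commute)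
  qed
  moreover have "dim {z, p} = 2" using assms by (simp add: dim_insert)
  ultimately show ?thesis by simp
qed

text \<open>Codimension two subspaces become points of a hyperplane of the dual space: a generic projection from
  \<open>z\<close> turns each \<open>V\<close> into the hyperplane spanned by \<open>V\<close> and \<open>z\<close>, whose normal vector is \<open>\<nu> V\<close>.\<close>

lemma dual_points:
  fixes P :: "'a::euclidean_space set" and G :: "'a set set"
  assumes P: "finite P" "simple P" and G: "finite G" "\<forall>V\<in>G. subspace V \<and> dim V + 2 = DIM('a)"
    and D: "DIM('a) \<ge> 3"
  shows "\<exists>z \<nu>. inj_on \<nu> G \<and> simple (\<nu> ` G) \<and> (\<forall>V\<in>G. z \<bullet> \<nu> V = 0) \<and>
    (\<forall>V\<in>G. \<forall>p\<in>P. p \<in> V \<longleftrightarrow> p \<bullet> \<nu> V = 0) \<and>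
    (\<forall>p\<in>P. dim {v. z \<bullet> v = 0 \<and> p \<bullet> v = 0} + 2 = DIM('a)) \<and> inj_on (\<lambda>p. {v. z \<bullet> v = 0 \<and> p \<bullet> v = 0}) P"
proof -
  note G = G(1) bspec[OF G(2)]
  \<comment> \<open>The three families serve three purposes: \<open>p\<close> in the span of
    \<open>V\<close> and \<open>z\<close> must imply that \<open>p\<close> is in \<open>V\<close>;
    distinct \<open>V\<close> must yield distinct hyperplanes (and the case \<open>V = W\<close>
    keeps \<open>z\<close> outside \<open>V\<close>); distinct \<open>p\<close> must yield distinct
    subspaces orthogonal to \<open>z\<close> and \<open>p\<close>.\<close>
  define \<B> where "\<B> = (\<lambda>(p, V). insert p V) ` (P \<times> G) \<union>
     {B \<in> (\<lambda>(V, W). V \<union> W) ` (G \<times> G). dim B < DIM('a)} \<union> (\<lambda>(p, q). {p, q}) ` (P \<times> P)"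
  have "\<exists>z. \<forall>B\<in>\<B>. z \<notin> span B"
  proof (rule avoid_proper_subspaces)
    show "finite \<B>" using P(1) G(1) by (simp add: \<B>_def)
    fix B assume "B \<in> \<B>"
    then consider p V where "B = insert p V" "V \<in> G" | "dim B < DIM('a)" | p q where "B = {p, q}"
      by (auto simp: \<B>_def)
    then show "dim B < DIM('a)"
    proof cases
      case 1
      then show ?thesis using G(2)[of V] by (simp add: dim_insert)
    next
      case 3
      then show ?thesis using D by (simp add: dim_insert)
    qed
  qed
  then obtain z where z: "\<And>B. B \<in> \<B> \<Longrightarrow> z \<notin> span B" by blast
  have z1: "z \<notin> span (insert p V)" if "p \<in> P" "V \<in> G" for p V
    using that by (intro z) (auto simp: \<B>_def)
  have z2: "z \<notin> span (V \<union> W)" if "V \<in> G" "W \<in> G" "dim (V \<union> W) < DIM('a)" for V W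
    using that by (intro z) (auto simp: \<B>_def)
  have z3: "z \<notin> span {p, q}" if "p \<in> P" "q \<in> P" for p q
    using that by (intro z) (auto simp: \<B>_def)
  have z0: "z \<notin> V" if "V \<in> G" for V
    using z2[OF that that] G(2)[OF that] by (auto intro: span_base)
  have dz: "dim (insert z V) + 1 = DIM('a)" if V: "V \<in> G" for V
  proof -
    have "span V = V" using G(2)[OF V] by (simp add: span_eq_iff)
    then show ?thesis using z0[OF V] G(2)[OF V] by (simp add: dim_insert del: span_eq_iff)
  qed
  have "\<exists>x. x \<noteq> 0 \<and> (\<forall>y\<in>span (insert z V). x \<bullet> y = 0)" if V: "V \<in> G" for V
  proof -
    have "dim (insert z V) < DIM('a)" using dz[OF V] by simp
    then show ?thesis using orthogonal_to_subspace_exists by (metis orthogonal_def)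
  qed
  then have "\<forall>V\<in>G. \<exists>x. x \<noteq> 0 \<and> (\<forall>y\<in>span (insert z V). x \<bullet> y = 0)" ..
  from bchoice[OF this] obtain \<nu> where \<nu>: "\<And>V. V \<in> G \<Longrightarrow> \<nu> V \<noteq> 0 \<and> (\<forall>y\<in>span (insert z V). \<nu> V \<bullet> y = 0)"
    by (elim exE) blast
  have hyp: "span (insert z V) = {y. \<nu> V \<bullet> y = 0}" if V: "V \<in> G" for V
  proof (rule subspace_dim_equal[OF subspace_span subspace_hyperplane])
    show "span (insert z V) \<subseteq> {y. \<nu> V \<bullet> y = 0}" using \<nu>[OF V] by blast
    have "dim {y. \<nu> V \<bullet> y = 0} = DIM('a) - 1" using \<nu>[OF V] by (simp add: dim_hyperplane)
    then show "dim {y. \<nu> V \<bullet> y = 0} \<le> dim (span (insert z V))" using dz[OF V] by simp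
  qed
  \<comment> \<open>Proportional normals would place \<open>V\<close> and \<open>W\<close> in one
    hyperplane. Being distinct and of codimension one in it, they span it, so \<open>z\<close> would
    lie in the span of their union, against its choice.\<close>
  have indep: "\<nu> W \<notin> span {\<nu> V}" if V: "V \<in> G" "W \<in> G" "V \<noteq> W" for V W
  proof
    assume "\<nu> W \<in> span {\<nu> V}"
    then obtain c where c: "\<nu> W = c *\<^sub>R \<nu> V" by (auto simp: span_singleton)
    then have "c \<noteq> 0" using \<nu>[OF V(2)] by auto
    then have "{y. \<nu> W \<bullet> y = 0} = {y. \<nu> V \<bullet> y = 0}" by (simp add: c)
    then have eq: "span (insert z W) = span (insert z V)" using hyp V by simp
    have "V \<subseteq> span (insert z V)" "W \<subseteq> span (insert z W)" by (auto intro: span_base)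
    then have sub: "V \<union> W \<subseteq> span (insert z V)" unfolding eq by simp
    have "dim (V \<union> W) \<le> dim (span (insert z V))" using sub by (rule dim_subset)
    then have dl: "dim (V \<union> W) < DIM('a)" using dz[OF V(1)] by simp
    have nsub: "\<not> W \<subseteq> V" using subspace_dim_equal[of W V] G(2)[OF V(1)] G(2)[OF V(2)] V(3) by auto
    then obtain w where w: "w \<in> W" "w \<notin> V" by blast
    have "span V = V" using G(2)[OF V(1)] by (simp add: span_eq_iff)
    then have "dim (insert w V) = dim V + 1" using w by (simp add: dim_insert del: span_eq_iff)
    moreover have "dim (insert w V) \<le> dim (V \<union> W)" using w by (intro dim_subset) auto
    ultimately have "dim (span (insert z V)) \<le> dim (span (V \<union> W))" using dz[OF V(1)] G(2)[OF V(1)] by simp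
    then have "span (V \<union> W) = span (insert z V)"
      by (rule subspace_dim_equal[OF subspace_span subspace_span span_minimal[OF sub subspace_span]])
    moreover have "z \<in> span (insert z V)" by (simp add: span_base)
    ultimately show False using z2[OF V(1,2) dl] by simp
  qed
  have inj: "inj_on \<nu> G" by (rule inj_onI) (metis indep insertI1 span_base)
  have simpN: "simple (\<nu> ` G)" unfolding simple_def
  proof (intro conjI ballI impI)
    show "0 \<notin> \<nu> ` G" using \<nu> by force
    show "b \<notin> span {a}" if "a \<in> \<nu> ` G" "b \<in> \<nu> ` G" "a \<noteq> b" for a b using that indep by blast
  qed
  have zn: "z \<bullet> \<nu> V = 0" if V: "V \<in> G" for V
    using \<nu>[OF V] by (metis inner_commute insertI1 span_base)
  have mem: "p \<in> V \<longleftrightarrow> p \<bullet> \<nu> V = 0" if V: "V \<in> G" and p: "p \<in> P" for V p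
  proof
    assume "p \<in> V"
    then show "p \<bullet> \<nu> V = 0" using \<nu>[OF V] by (metis inner_commute insertI2 span_base)
  next
    assume "p \<bullet> \<nu> V = 0"
    then have "p \<in> span (insert z V)" using hyp[OF V] by (simp add: inner_commute)
    then show "p \<in> V" using span_insert_exchange[of V p z] G(2)[OF V] z1[OF p V] by blast
  qed
  have dims: "dim {v. z \<bullet> v = 0 \<and> p \<bullet> v = 0} + 2 = DIM('a)" if p: "p \<in> P" for p
    by (rule dim_orthogonal_pair) (use p P(2) z3[OF p p] in \<open>auto simp: simple_def\<close>)
  have "inj_on (\<lambda>p. {v. z \<bullet> v = 0 \<and> p \<bullet> v = 0}) P"
  proof (rule inj_onI, rule ccontr)
    fix p q assume pq: "p \<in> P" "q \<in> P" "{v. z \<bullet> v = 0 \<and> p \<bullet> v = 0} = {v. z \<bullet> v = 0 \<and> q \<bullet> v = 0}" "p \<noteq> q"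
    have "q \<notin> span {z, p}"
    proof
      assume "q \<in> span {z, p}"
      then have "q \<in> span (insert z (span {p}))" by simp
      moreover have "q \<notin> span {p}" using pq P(2) by (auto simp: simple_def)
      ultimately have "z \<in> span (insert q (span {p}))" using span_insert_exchange subspace_span by blast
      then show False using z3[OF pq(2,1)] by simp
    qed
    then obtain y where y: "\<forall>f\<in>span {z, p}. y \<bullet> f = 0" "y \<bullet> q \<noteq> 0"
      using generic_orthogonal[of "span {z, p}" "{q}"] by auto
    have "z \<in> span {z, p}" "p \<in> span {z, p}" by (auto intro: span_base)
    then have "y \<in> {v. z \<bullet> v = 0 \<and> p \<bullet> v = 0}" using y(1) by (auto simp: inner_commute)
    then have "y \<in> {v. z \<bullet> v = 0 \<and> q \<bullet> v = 0}" using pq(3) by simp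
    then show False using y(2) by (simp add: inner_commute)
  qed
  then show ?thesis using inj simpN zn mem dims by (intro exI[of _ z] exI[of _ \<nu>]) auto
qed

section \<open>Large bicliques\<close>

lemma sum_card_fibres:
  assumes "finite J" "finite W"
  shows "(\<Sum>V\<in>W. rcard {q \<in> J. g q = V}) = rcard {q \<in> J. g q \<in> W}"
proof -
  have "(\<Sum>V\<in>W. rcard {q \<in> J. g q = V}) = (\<Sum>q\<in>J. rcard {V \<in> W. g q = V})"
    by (rule sum_card_swap[OF assms(2,1)])
  also have "\<dots> = (\<Sum>q\<in>J. if g q \<in> W then 1 else 0)"
  proof (rule sum.cong[OF refl])
    fix q
    have "{V \<in> W. g q = V} = (if g q \<in> W then {g q} else {})" by auto
    then show "rcard {V \<in> W. g q = V} = (if g q \<in> W then 1 else 0)" by simp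
  qed
  also have "\<dots> = rcard {q \<in> J. g q \<in> W}" using assms(1) by (simp add: sum.If_cases Int_def)
  finally show ?thesis .
qed

lemma inj_on_orthogonal_hyperplane:
  assumes "simple Q"
  shows "inj_on (\<lambda>q. {v. q \<bullet> v = 0}) Q"
proof (rule inj_onI, rule ccontr)
  fix p q assume pq: "p \<in> Q" "q \<in> Q" "{v. p \<bullet> v = 0} = {v. q \<bullet> v = 0}" "p \<noteq> q"
  then have "{q} \<inter> span {p} = {}" using assms by (auto simp: simple_def)
  then obtain y where y: "\<forall>f\<in>span {p}. y \<bullet> f = 0" "y \<bullet> q \<noteq> 0"
    using generic_orthogonal[of "span {p}" "{q}"] by auto
  have "y \<bullet> p = 0" using y(1) by (simp add: span_base)
  then have "y \<in> {v. q \<bullet> v = 0}" unfolding pq(3)[symmetric] by (simp add: inner_commute)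
  then show False using y(2) by (simp add: inner_commute)
qed

text \<open>Points and hyperplanes are vectors of the same space, so \<open>popular_flat\<close> can
  be applied from either side, with constants common to both uses. The two largeness conditions are
  what the thresholds \<open>A0 / \<eta> ^ 4\<close> for hyperplanes and
  \<open>A0 / \<theta> ^ 3\<close> for points ask for.\<close>

theorem large_biclique_vectors:
  assumes dim6: "DIM('a::euclidean_space) = 6"
  shows "\<exists>A c. A > 0 \<and> c > 0 \<and> (\<forall>(P :: 'a set) Q e. finite P \<longrightarrow> finite Q \<longrightarrow> simple P \<longrightarrow> simple Q \<longrightarrow>
    P \<noteq> {} \<longrightarrow> Q \<noteq> {} \<longrightarrow> 0 < e \<longrightarrow>
    e * rcard P * rcard Q = rcard {(p, q) \<in> P \<times> Q. p \<bullet> q = 0} \<longrightarrow>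
    A \<le> e ^ 3 * rcard P \<longrightarrow> A \<le> e ^ 4 * rcard Q \<longrightarrow>
    (\<exists>X Y. X \<subseteq> P \<and> Y \<subseteq> Q \<and> (\<forall>p\<in>X. \<forall>q\<in>Y. p \<bullet> q = 0) \<and>
      c * (e ^ 3 * rcard P * rcard Q / (1 + ln (rcard Q))) \<le> rcard X * rcard Y))"
proof -
  obtain A0 c0 where A0: "A0 > 0" and c0: "0 < c0" "c0 \<le> 1" and popular:
    "\<And>(P :: 'a set) \<eta> (J :: 'a set) S k. finite P \<Longrightarrow> simple P \<Longrightarrow> 0 < \<eta> \<Longrightarrow> A0 \<le> \<eta> ^ 2 * rcard P \<Longrightarrow>
      finite J \<Longrightarrow> inj_on S J \<Longrightarrow> k \<le> 3 \<Longrightarrow>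
      \<forall>i\<in>J. subspace (S i) \<and> dim (S i) = k + 2 \<and> \<eta> * rcard P \<le> rcard (P \<inter> S i) \<Longrightarrow>
      J \<noteq> {} \<Longrightarrow> A0 / \<eta> ^ (k + 1) \<le> rcard J \<Longrightarrow>
      (\<exists>U. subspace U \<and> c0 * \<eta> * rcard P \<le> rcard (P \<inter> U) \<and>
         c0 * \<eta> ^ 2 * rcard J \<le> rcard {i \<in> J. U \<subseteq> S i}) \<or>
      k = 3 \<and> (\<exists>J' U. J' \<subseteq> J \<and> rcard J / 4 \<le> rcard J' \<and>
         (\<forall>i\<in>J'. subspace (U i) \<and> dim (U i) = 4 \<and> U i \<subseteq> S i \<and> c0 * \<eta> * rcard P \<le> rcard (P \<inter> U i)))"
    using popular_flat[where 'a='a and 'i='a] by (elim exE conjE) blast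
  \<comment> \<open>\<open>T\<close> separates few flats from many. It satisfies
    \<open>(c0 * \<eta> / 2) ^ 2 * (T / \<eta> ^ 2) = A0\<close>, which is the largeness of the dual
    point set required in \<open>bigN\<close>.\<close>
  define T where "T = 4 * A0 / c0 ^ 2"
  \<comment> \<open>The first entry serves the hyperplanes in \<open>manyJ\<close>, the second the
    points in \<open>manyK\<close>.\<close>
  define A where "A = max (32 * A0) (128 * A0 / c0 ^ 3)"
  \<comment> \<open>One entry for each outcome: a popular flat, few flats of dimension 4, many of
    them.\<close>
  define c where "c = min (c0 ^ 2 / 16) (min (c0 / (64 * T)) (c0 ^ 5 / 1024))"
  have T: "T > 0" using A0 c0 by (simp add: T_def)
  have A: "32 * A0 \<le> A" "128 * A0 / c0 ^ 3 \<le> A" unfolding A_def by simp_all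
  have c: "c \<le> c0 ^ 2 / 16" "c \<le> c0 / (64 * T)" "c \<le> c0 ^ 5 / 1024" "c > 0"
    using c0 T unfolding c_def by auto
  have "\<exists>X Y. X \<subseteq> P \<and> Y \<subseteq> Q \<and> (\<forall>p\<in>X. \<forall>q\<in>Y. p \<bullet> q = 0) \<and>
      c * (e ^ 3 * rcard P * rcard Q / (1 + ln (rcard Q))) \<le> rcard X * rcard Y"
    if P: "finite P" "simple P" "P \<noteq> {}" and Q: "finite Q" "simple Q" "Q \<noteq> {}" and e: "0 < e"
      and I: "e * rcard P * rcard Q = rcard {(p, q) \<in> P \<times> Q. p \<bullet> q = 0}"
      and A3: "A \<le> e ^ 3 * rcard P" and A4: "A \<le> e ^ 4 * rcard Q"
    for P Q :: "'a set" and e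
  proof -
    define m where "m = rcard P"
    define n where "n = rcard Q"
    define \<Lambda> where "\<Lambda> = 1 + ln n"
    have m: "m \<ge> 1" and n: "n \<ge> 1" using P Q by (simp_all add: m_def n_def card_gt_0_iff Suc_leI)
    have \<Lambda>: "\<Lambda> \<ge> 1" using n by (simp add: \<Lambda>_def)
    have A3: "A \<le> e ^ 3 * m" and A4: "A \<le> e ^ 4 * n" using A3 A4 by (simp_all add: m_def n_def)
    have reduce: ?thesis if "X \<subseteq> P" "Y \<subseteq> Q" "\<forall>p\<in>X. \<forall>q\<in>Y. p \<bullet> q = 0" "c \<le> c1" "c1 * (e ^ 3 * m * n / \<Lambda>) \<le> rcard X * rcard Y"
      for X Y c1
    proof -
      have "c * (e ^ 3 * m * n / \<Lambda>) \<le> c1 * (e ^ 3 * m * n / \<Lambda>)"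
        using that(4) e m n \<Lambda> by (intro mult_right_mono) auto
      then show ?thesis using that unfolding m_def n_def \<Lambda>_def by (intro exI[of _ X] exI[of _ Y]) auto
    qed
    define x where "x q = rcard {p \<in> P. p \<bullet> q = 0} / m" for q
    have x1: "x q \<le> 1" for q
    proof -
      have "card {p \<in> P. p \<bullet> q = 0} \<le> card P" using P(1) by (intro card_mono) auto
      then show ?thesis using m by (simp add: x_def m_def)
    qed
    have "(\<Sum>q\<in>Q. x q) = (\<Sum>q\<in>Q. rcard {p \<in> P. p \<bullet> q = 0}) / m"
      unfolding x_def by (rule sum_divide_distrib[symmetric])
    also have "\<dots> = e * n" unfolding sum_card_pairs[OF P(1) Q(1)] I[symmetric]
      using m by (simp add: m_def n_def)
    finally have sx: "(\<Sum>q\<in>Q. x q) = e * n" .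
    have "(\<Sum>q\<in>Q. x q) \<le> (\<Sum>q\<in>Q. 1)" by (rule sum_mono) (rule x1)
    then have "e * n \<le> 1 * n" using sx by (simp add: n_def)
    then have e1: "e \<le> 1" by (rule mult_right_le_imp_le) (use n in simp)
    obtain \<eta> where \<eta>2: "e / 2 \<le> \<eta>" and J: "rcard Q * (e / \<eta>) ^ 2 / 8 \<le> rcard {q \<in> Q. \<eta> \<le> x q}"
      using dyadic_level[of Q x e, OF Q(1,3) x1 e] sx unfolding n_def by auto
    define Jq where "Jq = {q \<in> Q. \<eta> \<le> x q}"
    have \<eta>: "\<eta> > 0" using \<eta>2 e by linarith
    have cJ: "n * e ^ 2 / (8 * \<eta> ^ 2) \<le> rcard Jq" using J by (simp add: n_def Jq_def power_divide)
    have finJ: "finite Jq" using Q(1) by (simp add: Jq_def)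
    have "n * e ^ 2 / (8 * \<eta> ^ 2) > 0" using n e \<eta> by simp
    then have "card Jq \<noteq> 0" using cJ by linarith
    then have Jne: "Jq \<noteq> {}" by auto
    have \<eta>sq: "e ^ 2 / 4 \<le> \<eta> ^ 2"
      using power_mono[OF \<eta>2, of 2] e by (simp add: power_divide)
    have e32: "e ^ 3 \<le> e ^ 2" using e e1 by (intro power_decreasing) auto
    have big: "A0 \<le> \<eta> ^ 2 * m"
    proof -
      have "A0 \<le> A / 4" using A A0 by linarith
      also have "\<dots> \<le> e ^ 3 * m / 4" using A3 by simp
      also have "\<dots> \<le> e ^ 2 * m / 4" using e32 m by simp
      also have "\<dots> \<le> \<eta> ^ 2 * m" using \<eta>sq m mult_right_mono[of "e ^ 2 / 4" "\<eta> ^ 2" m] by simp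
      finally show ?thesis .
    qed
    have manyJ: "A0 / \<eta> ^ 4 \<le> rcard Jq"
    proof -
      have "8 * A0 \<le> A / 4" using A by linarith
      also have "\<dots> \<le> e ^ 4 * n / 4" using A4 by simp
      also have "\<dots> = n * e ^ 2 * (e ^ 2 / 4)" by (simp add: power2_eq_square power4_eq_xxxx)
      also have "\<dots> \<le> n * e ^ 2 * \<eta> ^ 2" using \<eta>sq n by (intro mult_left_mono) auto
      finally have "8 * A0 \<le> n * e ^ 2 * \<eta> ^ 2" .
      then have "A0 / \<eta> ^ 4 \<le> (n * e ^ 2 * \<eta> ^ 2 / 8) / \<eta> ^ 4" using \<eta> by (intro divide_right_mono) auto
      also have "\<dots> = n * e ^ 2 / (8 * \<eta> ^ 2)" using \<eta> by (simp add: power2_eq_square power4_eq_xxxx)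
      finally show ?thesis using cJ by linarith
    qed
    define S where "S q = {v. q \<bullet> v = 0}" for q :: 'a
    have PS: "P \<inter> S q = {p \<in> P. p \<bullet> q = 0}" for q by (auto simp: S_def inner_commute)
    have Sprop: "\<forall>q\<in>Jq. subspace (S q) \<and> dim (S q) = 3 + 2 \<and> \<eta> * rcard P \<le> rcard (P \<inter> S q)"
    proof
      fix q assume q: "q \<in> Jq"
      then have "q \<noteq> 0" using Q(2) by (auto simp: Jq_def simple_def)
      then have "dim (S q) = 5" using dim6 by (simp add: S_def dim_hyperplane)
      moreover have "\<eta> \<le> rcard (P \<inter> S q) / m" using q by (simp add: Jq_def x_def PS)
      then have "\<eta> * m \<le> rcard (P \<inter> S q)" using m by (simp add: field_simps)
      ultimately show "subspace (S q) \<and> dim (S q) = 3 + 2 \<and> \<eta> * rcard P \<le> rcard (P \<inter> S q)"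
        by (simp add: m_def S_def subspace_hyperplane)
    qed
    have injS: "inj_on S Jq"
      unfolding S_def using inj_on_orthogonal_hyperplane[OF Q(2)] by (rule inj_on_subset) (auto simp: Jq_def)
    have manyJ': "A0 / \<eta> ^ (3 + 1) \<le> rcard Jq" using manyJ by simp
    consider (flat) U where "c0 * \<eta> * m \<le> rcard (P \<inter> U)" "c0 * \<eta> ^ 2 * rcard Jq \<le> rcard {q \<in> Jq. U \<subseteq> S q}"
      | (codim2) J' G where "J' \<subseteq> Jq" "rcard Jq / 4 \<le> rcard J'"
        "\<And>q. q \<in> J' \<Longrightarrow> subspace (G q) \<and> dim (G q) = 4 \<and> G q \<subseteq> S q \<and> c0 * \<eta> * m \<le> rcard (P \<inter> G q)"
      using popular[OF P(1,2) \<eta> big[unfolded m_def] finJ injS order_refl Sprop Jne manyJ'] unfolding m_def by blast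
    then show ?thesis
    proof cases
      case flat
      define X where "X = P \<inter> U"
      define Y where "Y = {q \<in> Jq. U \<subseteq> S q}"
      have XY: "X \<subseteq> P" "Y \<subseteq> Q" by (auto simp: X_def Y_def Jq_def)
      have inc: "\<forall>p\<in>X. \<forall>q\<in>Y. p \<bullet> q = 0" by (auto simp: X_def Y_def S_def inner_commute)
      have "c0 * \<eta> ^ 2 * (n * e ^ 2 / (8 * \<eta> ^ 2)) \<le> c0 * \<eta> ^ 2 * rcard Jq"
        using cJ c0 by (intro mult_left_mono) auto
      then have "c0 * n * e ^ 2 / 8 \<le> rcard Y" using flat(2) \<eta> by (simp add: Y_def)
      moreover have "c0 * (e / 2) * m \<le> c0 * \<eta> * m" using \<eta>2 c0 m by (intro mult_right_mono mult_left_mono) auto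
      then have "c0 * (e / 2) * m \<le> rcard X" using flat(1) by (simp add: X_def)
      ultimately have "(c0 * (e / 2) * m) * (c0 * n * e ^ 2 / 8) \<le> rcard X * rcard Y"
        using c0 e m n by (intro mult_mono) auto
      moreover have "(c0 * (e / 2) * m) * (c0 * n * e ^ 2 / 8) = c0 ^ 2 / 16 * (e ^ 3 * m * n)"
        by (simp add: power2_eq_square power3_eq_cube)
      moreover have "c0 ^ 2 / 16 * (e ^ 3 * m * n / \<Lambda>) \<le> c0 ^ 2 / 16 * (e ^ 3 * m * n)"
      proof (rule mult_left_mono)
        have "e ^ 3 * m * n / \<Lambda> \<le> e ^ 3 * m * n / 1" using \<Lambda> e m n by (intro divide_left_mono) auto
        then show "e ^ 3 * m * n / \<Lambda> \<le> e ^ 3 * m * n" by simp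
      qed simp
      ultimately have "c0 ^ 2 / 16 * (e ^ 3 * m * n / \<Lambda>) \<le> rcard X * rcard Y" by linarith
      then show ?thesis using reduce[OF XY inc c(1)] by blast
    next
      case codim2
      have finJ': "finite J'" using codim2(1) finJ finite_subset by blast
      define GG where "GG = G ` J'"
      define s where "s V = card {q \<in> J'. G q = V}" for V
      have "card {q \<in> J'. G q = V} \<le> card Q" for V
        using codim2(1) Q(1) by (intro card_mono) (auto simp: Jq_def)
      then have sn: "s V \<le> card Q" for V by (simp add: s_def)
      have finG: "finite GG" using finJ' by (simp add: GG_def)
      have cQ: "card Q \<ge> 1" using n by (simp add: n_def)
      \<comment> \<open>The only step that loses a logarithm: restrict to subspaces of multiplicity at least \<open>t\<close>.\<close>
      have "\<exists>t\<ge>1. (\<Sum>V\<in>GG. real (s V)) \<le> \<Lambda> * (real t * rcard {V \<in> GG. t \<le> s V})"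
        unfolding \<Lambda>_def n_def by (rule multiplicity_level[OF finG sn cQ])
      then obtain t where t: "t \<ge> 1" and st: "(\<Sum>V\<in>GG. real (s V)) \<le> \<Lambda> * (real t * rcard {V \<in> GG. t \<le> s V})"
        by (elim exE conjE)
      have sumG: "(\<Sum>V\<in>GG. real (s V)) = rcard J'"
      proof -
        have "{q \<in> J'. G q \<in> GG} = J'" by (auto simp: GG_def)
        then show ?thesis unfolding s_def sum_card_fibres[OF finJ' finG] by simp
      qed
      define Gt where "Gt = {V \<in> GG. t \<le> s V}"
      define N where "N = rcard Gt"
      have "n * e ^ 2 / (8 * \<eta> ^ 2) / 4 \<le> \<Lambda> * (real t * N)"
        using cJ codim2(2) st sumG by (simp add: Gt_def N_def)
      then have tN: "n * e ^ 2 / (32 * \<eta> ^ 2 * \<Lambda>) \<le> real t * N" using \<Lambda> \<eta> by (simp add: field_simps)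
      have tN0: "n * e ^ 2 / (32 * \<eta> ^ 2 * \<Lambda>) > 0" using \<Lambda> \<eta> n e by simp
      have "real t * N > 0" using tN tN0 by linarith
      then have N: "N > 0" by (simp add: zero_less_mult_iff)
      have finGt: "finite Gt" using finG by (simp add: Gt_def)
      have Gt_ne: "Gt \<noteq> {}" using N by (auto simp: N_def)
      have GtG: "subspace V \<and> dim V = 4 \<and> c0 * \<eta> * m \<le> rcard (P \<inter> V)" if "V \<in> Gt" for V
        using that codim2(3) by (auto simp: Gt_def GG_def)
      show ?thesis
      proof (cases "N < T / \<eta> ^ 2")
        case True
        \<comment> \<open>With few distinct flats the multiplicity \<open>t\<close> must be large,
          so any one of them is already popular.\<close>
        obtain V where V: "V \<in> Gt" using Gt_ne by blast
        define X where "X = P \<inter> V"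
        define Y where "Y = {q \<in> J'. G q = V}"
        have XY: "X \<subseteq> P" "Y \<subseteq> Q" using codim2(1) by (auto simp: X_def Y_def Jq_def)
        have inc: "\<forall>p\<in>X. \<forall>q\<in>Y. p \<bullet> q = 0"
        proof (intro ballI)
          fix p q assume "p \<in> X" "q \<in> Y"
          then have "p \<in> S q" using codim2(3)[of q] by (auto simp: X_def Y_def)
          then show "p \<bullet> q = 0" by (simp add: S_def inner_commute)
        qed
        have "real t * N \<le> real t * (T / \<eta> ^ 2)" using True by (intro mult_left_mono) auto
        then have "n * e ^ 2 / (32 * \<eta> ^ 2 * \<Lambda>) \<le> real t * (T / \<eta> ^ 2)" using tN by linarith
        then have "n * e ^ 2 / (32 * \<eta> ^ 2 * \<Lambda>) * (\<eta> ^ 2 / T) \<le> real t * (T / \<eta> ^ 2) * (\<eta> ^ 2 / T)"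
          using T by (intro mult_right_mono) auto
        then have "n * e ^ 2 / (32 * \<Lambda> * T) \<le> real t" using T \<eta> by simp
        also have "\<dots> \<le> rcard Y" using V by (simp add: Gt_def s_def Y_def)
        finally have Yt: "n * e ^ 2 / (32 * \<Lambda> * T) \<le> rcard Y" .
        have "c0 * (e / 2) * m \<le> c0 * \<eta> * m" using \<eta>2 c0 m by (intro mult_right_mono mult_left_mono) auto
        then have "c0 * (e / 2) * m \<le> rcard X" using GtG[OF V] by (simp add: X_def)
        then have "(c0 * (e / 2) * m) * (n * e ^ 2 / (32 * \<Lambda> * T)) \<le> rcard X * rcard Y"
          using Yt c0 e m n T \<Lambda> by (intro mult_mono) auto
        moreover have "(c0 * (e / 2) * m) * (n * e ^ 2 / (32 * \<Lambda> * T)) = c0 / (64 * T) * (e ^ 3 * m * n / \<Lambda>)"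
          by (simp add: power2_eq_square power3_eq_cube mult_ac)
        ultimately show ?thesis using reduce[OF XY inc c(2)] by simp
      next
        case False
        then have NT: "T / \<eta> ^ 2 \<le> N" by simp
        have Gdim: "\<forall>V\<in>Gt. subspace V \<and> dim V + 2 = DIM('a)" using GtG dim6 by simp
        have "DIM('a) \<ge> 3" using dim6 by simp
        from dual_points[OF P(1,2) finGt Gdim this]
        obtain z \<nu> where \<nu>: "inj_on \<nu> Gt" "simple (\<nu> ` Gt)" "\<And>V. V \<in> Gt \<Longrightarrow> z \<bullet> \<nu> V = 0"
          "\<And>V p. V \<in> Gt \<Longrightarrow> p \<in> P \<Longrightarrow> p \<in> V \<longleftrightarrow> p \<bullet> \<nu> V = 0"
          "\<And>p. p \<in> P \<Longrightarrow> dim {v. z \<bullet> v = 0 \<and> p \<bullet> v = 0} + 2 = DIM('a)"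
          "inj_on (\<lambda>p. {v. z \<bullet> v = 0 \<and> p \<bullet> v = 0}) P"
          by (elim exE conjE) blast
        define D where "D = \<nu> ` Gt"
        define R where "R p = {v. z \<bullet> v = 0 \<and> p \<bullet> v = 0}" for p :: 'a
        \<comment> \<open>The density of the selected flats through \<open>p\<close>. Its mean is at
          least \<open>c0 * \<eta>\<close>, and a second level choice bounds it below by
          \<open>\<theta>\<close> on a set \<open>K\<close>.\<close>
        define y where "y p = rcard {V \<in> Gt. p \<in> V} / N" for p
        have DN: "rcard D = N" using \<nu>(1) by (simp add: D_def N_def card_image)
        have y1: "y p \<le> 1" for p
        proof -
          have "card {V \<in> Gt. p \<in> V} \<le> card Gt" using finGt by (intro card_mono) auto
          then show ?thesis using N by (simp add: y_def N_def)
        qed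
        have "c0 * \<eta> * m * N = (\<Sum>V\<in>Gt. c0 * \<eta> * m)" by (simp add: N_def)
        also have "\<dots> \<le> (\<Sum>V\<in>Gt. rcard (P \<inter> V))" by (rule sum_mono) (use GtG in blast)
        also have "\<dots> = (\<Sum>V\<in>Gt. rcard {p \<in> P. p \<in> V})" by (simp add: Int_def)
        also have "\<dots> = (\<Sum>p\<in>P. rcard {V \<in> Gt. p \<in> V})" by (rule sum_card_swap[OF finGt P(1)])
        also have "\<dots> = (\<Sum>p\<in>P. y p) * N" using N by (simp add: y_def sum_divide_distrib[symmetric])
        finally have sy: "c0 * \<eta> * rcard P \<le> (\<Sum>p\<in>P. y p)" using N by (simp add: m_def)
        have c\<eta>: "c0 * \<eta> > 0" using c0 \<eta> by simp
        obtain \<theta> where \<theta>2: "c0 * \<eta> / 2 \<le> \<theta>" and P': "rcard P * (c0 * \<eta> / \<theta>) ^ 2 / 8 \<le> rcard {p \<in> P. \<theta> \<le> y p}"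
          using dyadic_level[of P y "c0 * \<eta>", OF P(1,3) y1 c\<eta> sy] by blast
        define K where "K = {p \<in> P. \<theta> \<le> y p}"
        have \<theta>: "\<theta> > 0" using \<theta>2 c\<eta> by linarith
        have cK: "m * (c0 * \<eta>) ^ 2 / (8 * \<theta> ^ 2) \<le> rcard K" using P' by (simp add: m_def K_def power_divide)
        have "m * (c0 * \<eta>) ^ 2 / (8 * \<theta> ^ 2) > 0"
          by (intro divide_pos_pos mult_pos_pos zero_less_power c\<eta> \<theta>) (use m in auto)
        then have "card K \<noteq> 0" using cK by linarith
        then have Kne: "K \<noteq> {}" by auto
        have finK: "finite K" using P(1) by (simp add: K_def)
        have bigN: "A0 \<le> \<theta> ^ 2 * rcard D"
        proof -
          have "(c0 * \<eta> / 2) ^ 2 \<le> \<theta> ^ 2" using \<theta>2 c\<eta> by (intro power_mono) auto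
          then have "(c0 * \<eta> / 2) ^ 2 * (T / \<eta> ^ 2) \<le> \<theta> ^ 2 * N" using NT T \<eta> by (intro mult_mono) auto
          moreover have "(c0 * \<eta> / 2) ^ 2 * (T / \<eta> ^ 2) = A0" using c0 \<eta> by (simp add: T_def power_mult_distrib power_divide)
          ultimately show ?thesis by (simp add: DN)
        qed
        have manyK: "A0 / \<theta> ^ (2 + 1) \<le> rcard K"
        proof -
          have "128 * A0 \<le> A * c0 ^ 3" using A(2) c0 by (simp add: field_simps)
          also have "\<dots> \<le> e ^ 3 * m * c0 ^ 3" using A3 c0 by (intro mult_right_mono) auto
          also have "\<dots> = (e * e ^ 2 * m * c0 ^ 2) * c0" by (simp add: power2_eq_square power3_eq_cube)
          also have "\<dots> \<le> ((2 * \<eta>) * (2 * \<eta>) ^ 2 * m * c0 ^ 2) * c0"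
            using \<eta>2 e m c0 \<eta> by (intro mult_right_mono mult_mono power_mono) auto
          also have "\<dots> = 16 * (m * (c0 * \<eta>) ^ 2 * (c0 * \<eta> / 2))" by (simp add: power2_eq_square mult_ac)
          also have "\<dots> \<le> 16 * (m * (c0 * \<eta>) ^ 2 * \<theta>)" using \<theta>2 m by (intro mult_left_mono) auto
          finally have "8 * A0 \<le> m * (c0 * \<eta>) ^ 2 * \<theta>" by linarith
          then have "A0 / \<theta> ^ 3 \<le> (m * (c0 * \<eta>) ^ 2 * \<theta> / 8) / \<theta> ^ 3" using \<theta> by (intro divide_right_mono) auto
          also have "\<dots> = m * (c0 * \<eta>) ^ 2 / (8 * \<theta> ^ 2)" using \<theta> by (simp add: power2_eq_square power3_eq_cube)
          finally show ?thesis using cK by simp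
        qed
        have DR: "rcard (D \<inter> R p) = y p * N" if p: "p \<in> P" for p
        proof -
          have "D \<inter> R p = \<nu> ` {V \<in> Gt. p \<in> V}" using \<nu>(3,4) p by (auto simp: D_def R_def)
          moreover have "inj_on \<nu> {V \<in> Gt. p \<in> V}" using \<nu>(1) by (rule inj_on_subset) auto
          ultimately show ?thesis using N by (simp add: y_def card_image)
        qed
        have Rprop: "\<forall>p\<in>K. subspace (R p) \<and> dim (R p) = 2 + 2 \<and> \<theta> * rcard D \<le> rcard (D \<inter> R p)"
        proof
          fix p assume p: "p \<in> K"
          then have pP: "p \<in> P" "\<theta> \<le> y p" by (auto simp: K_def)
          have "R p = {v. z \<bullet> v = 0} \<inter> {v. p \<bullet> v = 0}" by (auto simp: R_def)
          then have "subspace (R p)" by (simp add: subspace_inter subspace_hyperplane)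
          moreover have "dim (R p) = 2 + 2" using \<nu>(5)[OF pP(1)] dim6 by (simp add: R_def)
          moreover have "\<theta> * rcard D \<le> rcard (D \<inter> R p)"
            unfolding DR[OF pP(1)] DN using pP(2) N by (intro mult_right_mono) auto
          ultimately show "subspace (R p) \<and> dim (R p) = 2 + 2 \<and> \<theta> * rcard D \<le> rcard (D \<inter> R p)" by blast
        qed
        have injR: "inj_on R K" unfolding R_def using \<nu>(6) by (rule inj_on_subset) (auto simp: K_def)
        have finD: "finite D" using finGt by (simp add: D_def)
        have simpD: "simple D" using \<nu>(2) by (simp add: D_def)
        \<comment> \<open>With \<open>k = 2\<close> the alternative reserved for
          \<open>k = 3\<close> cannot occur, so a popular flat of the dual space results.\<close>
        have "(2::nat) \<le> 3" by simp
        from popular[OF finD simpD \<theta> bigN finK injR this Rprop Kne manyK]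
        obtain U where U: "c0 * \<theta> * N \<le> rcard (D \<inter> U)" "c0 * \<theta> ^ 2 * rcard K \<le> rcard {p \<in> K. U \<subseteq> R p}"
          unfolding DN by auto
        define X where "X = {p \<in> K. U \<subseteq> R p}"
        define W where "W = {V \<in> Gt. \<nu> V \<in> U}"
        define Y where "Y = {q \<in> J'. G q \<in> W}"
        have XY: "X \<subseteq> P" "Y \<subseteq> Q" using codim2(1) by (auto simp: X_def Y_def Jq_def K_def)
        have inc: "\<forall>p\<in>X. \<forall>q\<in>Y. p \<bullet> q = 0"
        proof (intro ballI)
          fix p q assume pq: "p \<in> X" "q \<in> Y"
          then have "\<nu> (G q) \<in> R p" by (auto simp: X_def Y_def W_def)
          then have "p \<bullet> \<nu> (G q) = 0" by (simp add: R_def)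
          moreover have "p \<in> P" "G q \<in> Gt" "q \<in> J'" using pq by (auto simp: X_def Y_def W_def K_def)
          ultimately have "p \<in> S q" using \<nu>(4)[of "G q" p] codim2(3)[of q] by blast
          then show "p \<bullet> q = 0" by (simp add: S_def inner_commute)
        qed
        have "D \<inter> U = \<nu> ` W" by (auto simp: D_def W_def)
        moreover have "inj_on \<nu> W" using \<nu>(1) by (rule inj_on_subset) (auto simp: W_def)
        ultimately have cW: "c0 * \<theta> * N \<le> rcard W" using U(1) by (simp add: card_image)
        have finW: "finite W" using finGt by (simp add: W_def)
        \<comment> \<open>The multiplicity returns here: each flat of \<open>W\<close> serves at
          least \<open>t\<close> hyperplanes.\<close>
        have "real t * rcard W = (\<Sum>V\<in>W. real t)" by simp
        also have "\<dots> \<le> (\<Sum>V\<in>W. rcard {q \<in> J'. G q = V})"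
          by (rule sum_mono) (simp add: W_def Gt_def s_def)
        also have "\<dots> = rcard Y" unfolding Y_def by (rule sum_card_fibres[OF finJ' finW])
        finally have tW: "real t * rcard W \<le> rcard Y" .
        have "c0 * \<theta> * (n * e ^ 2 / (32 * \<eta> ^ 2 * \<Lambda>)) \<le> c0 * \<theta> * (real t * N)"
          using tN c0 \<theta> by (intro mult_left_mono) auto
        also have "\<dots> = real t * (c0 * \<theta> * N)" by simp
        also have "\<dots> \<le> real t * rcard W" using cW by (intro mult_left_mono) auto
        finally have cY: "c0 * \<theta> * (n * e ^ 2 / (32 * \<eta> ^ 2 * \<Lambda>)) \<le> rcard Y" using tW by linarith
        have "c0 * (c0 * \<eta> / 2) * (n * e ^ 2 / (32 * \<eta> ^ 2 * \<Lambda>)) \<le> c0 * \<theta> * (n * e ^ 2 / (32 * \<eta> ^ 2 * \<Lambda>))"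
          using \<theta>2 c0 tN0 by (intro mult_right_mono mult_left_mono) auto
        then have cY: "c0 * (c0 * \<eta> / 2) * (n * e ^ 2 / (32 * \<eta> ^ 2 * \<Lambda>)) \<le> rcard Y" using cY by linarith
        have "c0 * \<theta> ^ 2 * (m * (c0 * \<eta>) ^ 2 / (8 * \<theta> ^ 2)) \<le> c0 * \<theta> ^ 2 * rcard K"
          using cK c0 by (intro mult_left_mono) auto
        then have cX: "c0 * (m * (c0 * \<eta>) ^ 2) / 8 \<le> rcard X" using U(2) \<theta> by (simp add: X_def)
        \<comment> \<open>\<open>\<theta>\<close> has cancelled from the number of points, and
          \<open>\<eta> ^ 2\<close> cancels between the two factors; in the remaining
          \<open>\<eta> * e ^ 2\<close> the factor \<open>\<eta>\<close> is at least
          \<open>e / 2\<close>.\<close>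
        have "(c0 * (m * (c0 * \<eta>) ^ 2) / 8) * (c0 * (c0 * \<eta> / 2) * (n * e ^ 2 / (32 * \<eta> ^ 2 * \<Lambda>))) \<le> rcard X * rcard Y"
          by (rule mult_mono[OF cX cY]) (use c0 \<eta> n e \<Lambda> in auto)
        moreover have "(c0 * (m * (c0 * \<eta>) ^ 2) / 8) * (c0 * (c0 * \<eta> / 2) * (n * e ^ 2 / (32 * \<eta> ^ 2 * \<Lambda>)))
            = c0 ^ 5 / 512 * (\<eta> * (e ^ 2 * m * n / \<Lambda>))"
          using \<eta> by (simp add: power_mult_distrib eval_nat_numeral mult_ac)
        moreover have "c0 ^ 5 / 512 * (e / 2 * (e ^ 2 * m * n / \<Lambda>)) \<le> c0 ^ 5 / 512 * (\<eta> * (e ^ 2 * m * n / \<Lambda>))"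
          using \<eta>2 c0 m n e \<Lambda> by (intro mult_left_mono mult_right_mono) auto
        moreover have "c0 ^ 5 / 512 * (e / 2 * (e ^ 2 * m * n / \<Lambda>)) = c0 ^ 5 / 1024 * (e ^ 3 * m * n / \<Lambda>)"
          by (simp add: power2_eq_square power3_eq_cube mult_ac)
        ultimately have "c0 ^ 5 / 1024 * (e ^ 3 * m * n / \<Lambda>) \<le> rcard X * rcard Y" by linarith
        then show ?thesis using reduce[OF XY inc c(3)] by blast
      qed
    qed
  qed
  moreover have "A > 0" using A A0 by linarith
  ultimately show ?thesis using c(4) by (intro exI[of _ A] exI[of _ c] conjI allI impI) simp_all
qed

section \<open>Homogeneous coordinates\<close>

lemma simple_homogenize: "simple ((\<lambda>p. (p, 1::real)) ` P)" for P :: "'b::euclidean_space set"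
  by (auto simp: simple_def span_singleton zero_prod_def)

text \<open>Proportional coefficient vectors describe the same hyperplane, so distinct hyperplanes
  cannot have proportional ones, however \<open>N\<close> was chosen.\<close>

lemma simple_normals:
  fixes N :: "'b set \<Rightarrow> 'b::euclidean_space \<times> real"
  assumes "\<And>q. q \<in> Q \<Longrightarrow> fst (N q) \<noteq> 0 \<and> q = {x. fst (N q) \<bullet> x + snd (N q) = 0}"
  shows "simple (N ` Q)" "inj_on N Q"
proof -
  have eq: "q = q'" if q: "q \<in> Q" "q' \<in> Q" "N q' = c *\<^sub>R N q" for q q' c
  proof -
    have c: "c \<noteq> 0" using assms[OF q(2)] q(3) by auto
    have "fst (N q') \<bullet> x + snd (N q') = c * (fst (N q) \<bullet> x + snd (N q))" for x
      unfolding q(3) by (simp add: algebra_simps)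
    then have "{x. fst (N q') \<bullet> x + snd (N q') = 0} = {x. fst (N q) \<bullet> x + snd (N q) = 0}" using c by simp
    then show ?thesis using assms[OF q(1)] assms[OF q(2)] by blast
  qed
  show "simple (N ` Q)" unfolding simple_def
  proof (intro conjI ballI impI notI)
    assume "0 \<in> N ` Q"
    then obtain q where "q \<in> Q" "N q = 0" by (metis imageE)
    then show False using assms[of q] by simp
  next
    fix u v assume uv: "u \<in> N ` Q" "v \<in> N ` Q" "u \<noteq> v" "v \<in> span {u}"
    then obtain q q' where q: "q \<in> Q" "q' \<in> Q" "u = N q" "v = N q'" by blast
    obtain c where "v = c *\<^sub>R u" using uv(4) by (auto simp: span_singleton)
    then have "N q' = c *\<^sub>R N q" using q by simp
    then have "q = q'" by (rule eq[OF q(1,2)])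
    then show False using q uv(3) by simp
  qed
  show "inj_on N Q"
  proof (rule inj_onI)
    fix q q' assume "q \<in> Q" "q' \<in> Q" "N q = N q'"
    then show "q = q'" using eq[of q q' 1] by simp
  qed
qed

lemma powr_power_nat:
  assumes "x > 0" "a * real k = real j"
  shows "(x powr a) ^ k = x ^ j"
proof -
  have "(x powr a) ^ k = x powr (a * real k)" using assms(1) by (simp add: powr_power mult.commute)
  then show ?thesis using assms by (simp add: powr_realpow)
qed

text \<open>A point \<open>p\<close> becomes \<open>(p, 1)\<close> and the hyperplane
  \<open>a \<bullet> x = b\<close> becomes \<open>(a, - b)\<close>, so that incidence is
  orthogonality. The fractional exponents disappear when the lower bounds on \<open>e\<close> are
  raised to the third and fourth power.\<close>

lemma large_biclique:
  "\<exists>C c :: real. C > 0 \<and> c > 0 \<and> (\<forall>m n I (P :: (real ^ 5) set) Q.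
     m > 0 \<longrightarrow> n > 0 \<longrightarrow> m * n \<ge> 2 \<longrightarrow> configuration m n I P Q \<longrightarrow>
     real I \<ge> C * (real m * real n powr (3/4) + real n * real m powr (2/3)) \<longrightarrow>
     (\<exists>r s. contains_K P Q r s \<and>
        real (r * s) \<ge> c * (real I / real (m * n)) ^ 3 * real (m * n) * (log 2 (real (m * n))) powi (-10)))"
proof -
  have d6: "DIM((real ^ 5) \<times> real) = 6" by simp
  obtain A c where A: "A > 0" and c: "c > 0" and main: "\<And>(P :: ((real ^ 5) \<times> real) set) Q e.
    finite P \<Longrightarrow> finite Q \<Longrightarrow> simple P \<Longrightarrow> simple Q \<Longrightarrow> P \<noteq> {} \<Longrightarrow> Q \<noteq> {} \<Longrightarrow> 0 < e \<Longrightarrow>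
    e * rcard P * rcard Q = rcard {(p, q) \<in> P \<times> Q. p \<bullet> q = 0} \<Longrightarrow>
    A \<le> e ^ 3 * rcard P \<Longrightarrow> A \<le> e ^ 4 * rcard Q \<Longrightarrow>
    \<exists>X Y. X \<subseteq> P \<and> Y \<subseteq> Q \<and> (\<forall>p\<in>X. \<forall>q\<in>Y. p \<bullet> q = 0) \<and>
      c * (e ^ 3 * rcard P * rcard Q / (1 + ln (rcard Q))) \<le> rcard X * rcard Y"
    using large_biclique_vectors[OF d6] by (elim exE conjE) blast
  \<comment> \<open>The two conditions come out with \<open>C ^ 3\<close> and \<open>C ^ 4\<close>;
    for \<open>C \<ge> 1\<close> both dominate \<open>C\<close>, hence \<open>A\<close>.\<close>
  define C where "C = max 1 A"
  have C: "C \<ge> 1" "C \<ge> A" by (simp_all add: C_def)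
  have "\<exists>r s. contains_K P Q r s \<and>
      real (r * s) \<ge> c / 2 * (real I / real (m * n)) ^ 3 * real (m * n) * (log 2 (real (m * n))) powi (-10)"
    if mn: "m > 0" "n > 0" "m * n \<ge> 2" and conf: "configuration m n I P Q"
      and I: "real I \<ge> C * (real m * real n powr (3/4) + real n * real m powr (2/3))"
    for m n I and P :: "(real ^ 5) set" and Q
  proof -
    define e where "e = real I / real (m * n)"
    have P: "finite P" "card P = m" and Q: "finite Q" "card Q = n" and hyp: "\<And>q. q \<in> Q \<Longrightarrow> hyperplane q"
      and cI: "card (incidence_graph P Q) = I" using conf by (auto simp: configuration_def)
    have "\<exists>u :: (real ^ 5) \<times> real. fst u \<noteq> 0 \<and> q = {x. fst u \<bullet> x + snd u = 0}" if "q \<in> Q" for q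
    proof -
      obtain a b where ab: "a \<noteq> 0" "q = {x. a \<bullet> x = b}" using hyp[OF \<open>q \<in> Q\<close>] by (auto simp: hyperplane_def)
      then show ?thesis by (intro exI[of _ "(a, - b)"]) auto
    qed
    then have "\<forall>q\<in>Q. \<exists>u :: (real ^ 5) \<times> real. fst u \<noteq> 0 \<and> q = {x. fst u \<bullet> x + snd u = 0}" ..
    from bchoice[OF this] obtain N :: "(real ^ 5) set \<Rightarrow> (real ^ 5) \<times> real"
      where N: "\<And>q. q \<in> Q \<Longrightarrow> fst (N q) \<noteq> 0 \<and> q = {x. fst (N q) \<bullet> x + snd (N q) = 0}"
      by (elim exE) blast
    define h where "h p = (p, 1::real)" for p :: "real ^ 5"
    have injh: "inj h" by (auto simp: h_def inj_def)
    have inc: "h p \<bullet> N q = 0 \<longleftrightarrow> p \<in> q" if "q \<in> Q" for p q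
    proof -
      have "h p \<bullet> N q = fst (N q) \<bullet> p + snd (N q)" by (simp add: h_def inner_prod_def inner_commute)
      then show ?thesis using N[OF that] by auto
    qed
    have simpQ: "simple (N ` Q)" and injN: "inj_on N Q" using simple_normals[of Q N] N by blast+
    have simpP: "simple (h ` P)" using simple_homogenize unfolding h_def by blast
    have cP: "card (h ` P) = m" using P injh by (simp add: card_image inj_on_subset)
    have cQ: "card (N ` Q) = n" using Q injN by (simp add: card_image)
    have "{(p, q) \<in> h ` P \<times> N ` Q. p \<bullet> q = 0} = (\<lambda>(p, q). (h p, N q)) ` incidence_graph P Q"
    proof (intro set_eqI iffI)
      fix x assume x: "x \<in> {(p, q) \<in> h ` P \<times> N ` Q. p \<bullet> q = 0}"
      obtain u v where "x = (u, v)" by (rule prod.exhaust)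
      with x have "x = (u, v)" "u \<in> h ` P" "v \<in> N ` Q" "u \<bullet> v = 0" by simp_all
      then obtain p q where "x = (h p, N q)" "p \<in> P" "q \<in> Q" "h p \<bullet> N q = 0" by blast
      then show "x \<in> (\<lambda>(p, q). (h p, N q)) ` incidence_graph P Q"
        using inc[of q p] by (intro image_eqI[of _ _ "(p, q)"]) (auto simp: incidence_graph_def)
    next
      fix x assume "x \<in> (\<lambda>(p, q). (h p, N q)) ` incidence_graph P Q"
      then show "x \<in> {(p, q) \<in> h ` P \<times> N ` Q. p \<bullet> q = 0}" using inc by (auto simp: incidence_graph_def)
    qed
    moreover have "inj_on (\<lambda>(p, q). (h p, N q)) (incidence_graph P Q)"
      using injh injN by (auto simp: inj_on_def incidence_graph_def)
    ultimately have cE: "card {(p, q) \<in> h ` P \<times> N ` Q. p \<bullet> q = 0} = I" using cI by (simp add: card_image)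
    have mr: "real m > 0" and nr: "real n > 0" using mn by auto
    have En: "C * real n powr (3/4) / real n \<le> e"
    proof -
      have "C * (real m * real n powr (3/4)) \<le> real I"
      proof -
        have "C * (real m * real n powr (3/4)) \<le> C * (real m * real n powr (3/4) + real n * real m powr (2/3))"
          using C nr by (intro mult_left_mono) auto
        then show ?thesis using I by linarith
      qed
      then have "C * (real m * real n powr (3/4)) / (real m * real n) \<le> real I / (real m * real n)"
        using mr nr by (intro divide_right_mono) auto
      then show ?thesis using mr by (simp add: e_def)
    qed
    have Em: "C * real m powr (2/3) / real m \<le> e"
    proof -
      have "C * (real n * real m powr (2/3)) \<le> real I"
      proof -
        have "C * (real n * real m powr (2/3)) \<le> C * (real m * real n powr (3/4) + real n * real m powr (2/3))"
          using C mr by (intro mult_left_mono) auto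
        then show ?thesis using I by linarith
      qed
      then have "C * (real n * real m powr (2/3)) / (real n * real m) \<le> real I / (real n * real m)"
        using mr nr by (intro divide_right_mono) auto
      then show ?thesis using nr by (simp add: e_def mult.commute)
    qed
    have e: "e > 0"
    proof -
      have "0 < C * real m powr (2/3) / real m" using C mr by (intro divide_pos_pos mult_pos_pos) auto
      then show ?thesis using Em by linarith
    qed
    have CA: "A \<le> C ^ k" if "k \<ge> 1" for k
      using C power_increasing[of 1 k C] that by simp
    have E3: "A \<le> e ^ 3 * real m"
    proof -
      have "(C * real m powr (2/3) / real m) ^ 3 * real m = C ^ 3 * ((real m powr (2/3)) ^ 3 / real m ^ 2)"
        using mr by (simp add: power_mult_distrib power_divide power3_eq_cube power2_eq_square)
      also have "(real m powr (2/3)) ^ 3 = real m ^ 2" by (rule powr_power_nat) (use mr in auto)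
      finally have "C ^ 3 = (C * real m powr (2/3) / real m) ^ 3 * real m" using mr by simp
      also have "\<dots> \<le> e ^ 3 * real m"
        using Em C mr by (intro mult_right_mono power_mono) auto
      finally show ?thesis using CA[of 3] by linarith
    qed
    have E4: "A \<le> e ^ 4 * real n"
    proof -
      have "(C * real n powr (3/4) / real n) ^ 4 * real n = C ^ 4 * ((real n powr (3/4)) ^ 4 / real n ^ 3)"
        using nr by (simp add: power_mult_distrib power_divide power4_eq_xxxx power3_eq_cube)
      also have "(real n powr (3/4)) ^ 4 = real n ^ 3" by (rule powr_power_nat) (use nr in auto)
      finally have "C ^ 4 = (C * real n powr (3/4) / real n) ^ 4 * real n" using nr by simp
      also have "\<dots> \<le> e ^ 4 * real n"
        using En C nr by (intro mult_right_mono power_mono) auto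
      finally show ?thesis using CA[of 4] by linarith
    qed
    have eI: "e * rcard (h ` P) * rcard (N ` Q) = rcard {(p, q) \<in> h ` P \<times> N ` Q. p \<bullet> q = 0}"
      unfolding cP cQ cE using mr nr by (simp add: e_def)
    have ne: "h ` P \<noteq> {}" "N ` Q \<noteq> {}" using P Q mn by auto
    have fin: "finite (h ` P)" "finite (N ` Q)" using P Q by auto
    obtain X Y where XY: "X \<subseteq> h ` P" "Y \<subseteq> N ` Q" "\<forall>p\<in>X. \<forall>q\<in>Y. p \<bullet> q = 0"
      "c * (e ^ 3 * real m * real n / (1 + ln (real n))) \<le> rcard X * rcard Y"
      using main[OF fin simpP simpQ ne e eI] E3 E4 unfolding cP cQ by blast
    obtain X' where X': "X' \<subseteq> P" "X = h ` X'" using XY(1) by (meson subset_imageE)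
    obtain Y' where Y': "Y' \<subseteq> Q" "Y = N ` Y'" using XY(2) by (meson subset_imageE)
    have cX: "card X = card X'" unfolding X'(2) using injh by (intro card_image inj_on_subset[OF injh]) auto
    have cY: "card Y = card Y'" unfolding Y'(2) using inj_on_subset[OF injN Y'(1)] by (rule card_image)
    have "X' \<times> Y' \<subseteq> incidence_graph P Q"
    proof clarify
      fix p q assume pq: "p \<in> X'" "q \<in> Y'"
      then have "h p \<bullet> N q = 0" using XY(3) X' Y' by blast
      then show "(p, q) \<in> incidence_graph P Q" using inc[of q p] pq X'(1) Y'(1) by (auto simp: incidence_graph_def)
    qed
    then have K: "contains_K P Q (card X) (card Y)" unfolding contains_K_def using X'(1) Y'(1) cX cY by metis
    define L where "L = log 2 (real (m * n))"
    have L1: "L \<ge> 1"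
    proof -
      have "real (m * n) \<ge> 2" using mn(3) by (metis of_nat_le_iff of_nat_numeral)
      then show ?thesis by (simp add: L_def)
    qed
    \<comment> \<open>Since \<open>m * n \<ge> 2\<close> gives \<open>L \<ge> 1\<close>, the single
      factor \<open>1 + ln n\<close> is at most \<open>2 * L ^ 10\<close>; the 2 is the one in
      \<open>c / 2\<close>.\<close>
    have "ln (real n) \<le> ln (real (m * n))" using mn by simp
    also have "\<dots> = L * ln 2" by (simp add: L_def log_def)
    also have "\<dots> \<le> L * 1" using L1 ln_le_minus_one[of 2] by (intro mult_left_mono) auto
    finally have lnL: "1 + ln (real n) \<le> 2 * L" using L1 by simp
    have ln0: "0 < 1 + ln (real n)" using mn by (intro add_pos_nonneg) auto
    have "L ^ 1 \<le> L ^ 10" using L1 by (intro power_increasing) auto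
    then have l10: "1 + ln (real n) \<le> 2 * L ^ 10" using lnL by simp
    have pw: "L powi (-10) = 1 / L ^ 10" by (simp add: power_int_def inverse_eq_divide power_divide)
    have "c / 2 * e ^ 3 * real (m * n) * L powi (-10) = c * (e ^ 3 * real m * real n / (2 * L ^ 10))"
      unfolding pw using L1 by simp
    also have "\<dots> \<le> c * (e ^ 3 * real m * real n / (1 + ln (real n)))"
      using c e mr nr l10 ln0 by (intro mult_left_mono divide_left_mono mult_pos_pos) auto
    also have "\<dots> \<le> real (card X * card Y)" using XY(4) by simp
    finally show ?thesis using K unfolding e_def L_def by (intro exI[of _ "card X"] exI[of _ "card Y"]) simp
  qed
  then show ?thesis using C c by (intro exI[of _ C] exI[of _ "c / 2"] conjI allI impI) auto
qed

text \<open>\<open>Max\<close> is meaningful only on a finite set; here both sides of a biclique are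
  bounded by the sizes of \<open>P\<close> and \<open>Q\<close>.\<close>

lemma contains_K_le_rs:
  assumes "finite P" "finite Q" "contains_K P Q r s"
  shows "r * s \<le> rs P Q"
proof -
  have "{r * s | r s. contains_K P Q r s} \<subseteq> (\<lambda>(r, s). r * s) ` ({..card P} \<times> {..card Q})"
  proof clarify
    fix r s assume "contains_K P Q r s"
    then have "r \<le> card P" "s \<le> card Q" using assms(1,2) by (auto simp: contains_K_def intro: card_mono)
    then show "r * s \<in> (\<lambda>(r, s). r * s) ` ({..card P} \<times> {..card Q})" by force
  qed
  then have "finite {r * s | r s. contains_K P Q r s}" by (rule finite_subset) simp
  then show ?thesis unfolding rs_def using assms(3) by (intro Max_ge) auto
qed

theorem theorem2:
  "\<exists>C5 C5' :: real. C5 > 0 \<and> C5' > 0 \<and>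
     (\<forall>(m::nat) (n::nat) (I::nat) (P :: (real ^ 5) set) (Q :: (real ^ 5) set set).
        m > 0 \<longrightarrow> n > 0 \<longrightarrow> m * n \<ge> 2 \<longrightarrow>
        configuration m n I P Q \<longrightarrow>
        real I \<ge> C5 * (real m * real n powr (3/4) + real n * real m powr (2/3)) \<longrightarrow>
        (\<exists>r s. contains_K P Q r s \<and>
           real (r * s) \<ge> C5' * (real I / real (m * n)) ^ 3 * real (m * n)
                             * (log 2 (real (m * n))) powi (-10))) \<and>
     (\<forall>(m::nat) (n::nat) (I::nat).
        m > 0 \<longrightarrow> n > 0 \<longrightarrow> m * n \<ge> 2 \<longrightarrow>
        (\<exists>(P :: (real ^ 5) set) (Q :: (real ^ 5) set set). configuration m n I P Q) \<longrightarrow>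
        real I \<ge> C5 * (real m * real n powr (3/4) + real n * real m powr (2/3)) \<longrightarrow>
        real (rs_min TYPE(real ^ 5) m n I)
          \<ge> C5' * (real I / real (m * n)) ^ 3 * real (m * n)
              * (log 2 (real (m * n))) powi (-10))"
proof -
  obtain C c :: real where C: "C > 0" "c > 0" and main: "\<And>m n I (P :: (real ^ 5) set) Q.
     m > 0 \<Longrightarrow> n > 0 \<Longrightarrow> m * n \<ge> 2 \<Longrightarrow> configuration m n I P Q \<Longrightarrow>
     real I \<ge> C * (real m * real n powr (3/4) + real n * real m powr (2/3)) \<Longrightarrow>
     \<exists>r s. contains_K P Q r s \<and>
        real (r * s) \<ge> c * (real I / real (m * n)) ^ 3 * real (m * n) * (log 2 (real (m * n))) powi (-10)"
    using large_biclique by (elim exE conjE) blast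
  have "c * (real I / real (m * n)) ^ 3 * real (m * n) * (log 2 (real (m * n))) powi (-10)
      \<le> real (rs_min TYPE(real ^ 5) m n I)"
    if mn: "m > 0" "n > 0" "m * n \<ge> 2" and ex: "\<exists>(P :: (real ^ 5) set) Q. configuration m n I P Q"
      and I: "real I \<ge> C * (real m * real n powr (3/4) + real n * real m powr (2/3))" for m n I
  proof -
    \<comment> \<open>\<open>ex\<close> makes the set nonempty, so the infimum is attained by an
      actual configuration.\<close>
    have "rs_min TYPE(real ^ 5) m n I \<in> {rs P Q | (P :: (real ^ 5) set) Q. configuration m n I P Q}"
      unfolding rs_min_def using ex by (intro Inf_nat_def1) blast
    then obtain P :: "(real ^ 5) set" and Q where PQ: "configuration m n I P Q" "rs_min TYPE(real ^ 5) m n I = rs P Q"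
      by blast
    obtain r s where rs: "contains_K P Q r s"
      "real (r * s) \<ge> c * (real I / real (m * n)) ^ 3 * real (m * n) * (log 2 (real (m * n))) powi (-10)"
      using main[OF mn PQ(1) I] by blast
    have "r * s \<le> rs P Q" using PQ(1) rs(1) by (intro contains_K_le_rs) (auto simp: configuration_def)
    then have "real (r * s) \<le> real (rs P Q)" by (simp only: of_nat_le_iff)
    then show ?thesis using rs(2) PQ(2) by linarith
  qed
  then show ?thesis using C main by (intro exI[of _ C] exI[of _ c] conjI allI impI) auto
qed

end
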